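(* For any string $T$ of length $n$ over an alphabet $\Sigma=[0,\sigma)$ with $\sigma=n^{\mathcal{O}(1)}$, we can answer $\textsf{PrefSuf}(i,j)$ queries, for any $i,j\in[0,n)$, in $\mathcal{O}(1)$ time after an $\mathcal{O}(n/\log_\sigma n)$-time preprocessing. The data structure size is $\mathcal{O}(n/\log_\sigma n)$ and the output is given as a compact representation of $\mathcal{O}(1)$ size.
   Context: Let $T=T[0..n-1]$ be a string of length $n$ over an integer alphabet $\Sigma=[0,\sigma)$ with $\sigma=n^{\mathcal{O}(1)}$, where $T[a..b]$ denotes the substring of $T$ from position $a$ to position $b$ inclusive. A prefix-suffix query $\textsf{PrefSuf}(i,j)$, for $i,j\in[0,n)$, asks to return all occurrences (starting positions) of $T$ in the string $T[0..i]T[j..n-1]$. The model of computation is the word RAM with $w$-bit machine words, $w=\Omega(\log n)$, where $T$ is given in packed representation ($\lceil\log\sigma\rceil$ bits per letter). *)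

theory Defs
  imports Complex_Main
begin

section \<open>Strings\<close>

text \<open>
  Strings are 0-indexed lists of natural numbers. The fragment from position \<open>a\<close> to position
  \<open>b\<close> includes both ends.
\<close>

definition fragment :: "'a list \<Rightarrow> nat \<Rightarrow> nat \<Rightarrow> 'a list" where
  "fragment T a b = take (Suc b - a) (drop a T)"

definition occurrences :: "'a list \<Rightarrow> 'a list \<Rightarrow> nat set" where
  "occurrences P S = {p. p + length P \<le> length S \<and> take (length P) (drop p S) = P}"

definition pref_suf :: "'a list \<Rightarrow> nat \<Rightarrow> nat \<Rightarrow> nat set" where
  "pref_suf T i j = occurrences T (fragment T 0 i @ fragment T j (length T - 1))"


section \<open>The word RAM\<close>

text \<open>
  Words are natural numbers below \<open>2 ^ w\<close>; the word size \<open>w\<close> is a parameter of the semantics, not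
  of the program, so that one program serves all word sizes (and all inputs). A program names
  finitely many registers; the memory is addressed by the contents of registers. Every instruction
  takes one unit of time.
\<close>

datatype binop = Add | Sub | Mul | Div | Mod | And | Or | Xor | Shl | Shr | Lt | Eq

datatype instr =
    SetConst nat nat        \<comment> \<open>register, constant\<close>
  | BinOp binop nat nat nat \<comment> \<open>operation, destination register, two source registers\<close>
  | Load nat nat            \<comment> \<open>destination register, register holding the address\<close>
  | Store nat nat           \<comment> \<open>register holding the address, source register\<close>
  | JumpZero nat nat        \<comment> \<open>register tested for zero, target line\<close>

record config =
  pc :: nat
  reg :: "nat \<Rightarrow> nat"
  mem :: "nat \<Rightarrow> nat"

fun binop_val :: "nat \<Rightarrow> binop \<Rightarrow> nat \<Rightarrow> nat \<Rightarrow> nat" where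
  "binop_val w Add x y = (x + y) mod 2 ^ w"
| "binop_val w Sub x y = nat ((int x - int y) mod 2 ^ w)"
| "binop_val w Mul x y = (x * y) mod 2 ^ w"
| "binop_val w Div x y = x div y"
| "binop_val w Mod x y = x mod y"
| "binop_val w And x y = Bit_Operations.and x y"
| "binop_val w Or x y = Bit_Operations.or x y"
| "binop_val w Xor x y = Bit_Operations.xor x y"
| "binop_val w Shl x y = (x * 2 ^ y) mod 2 ^ w"
| "binop_val w Shr x y = x div 2 ^ y"
| "binop_val w Lt x y = of_bool (x < y)"
| "binop_val w Eq x y = of_bool (x = y)"

fun exec_instr :: "nat \<Rightarrow> instr \<Rightarrow> config \<Rightarrow> config" where
  "exec_instr w (SetConst r k) c =
     c\<lparr>pc := Suc (pc c), reg := (reg c)(r := k mod 2 ^ w)\<rparr>"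
| "exec_instr w (BinOp f r s t) c =
     c\<lparr>pc := Suc (pc c), reg := (reg c)(r := binop_val w f (reg c s) (reg c t))\<rparr>"
| "exec_instr w (Load r s) c =
     c\<lparr>pc := Suc (pc c), reg := (reg c)(r := mem c (reg c s))\<rparr>"
| "exec_instr w (Store r s) c =
     c\<lparr>pc := Suc (pc c), mem := (mem c)(reg c r := reg c s)\<rparr>"
| "exec_instr w (JumpZero r l) c =
     c\<lparr>pc := (if reg c r = 0 then l else Suc (pc c))\<rparr>"

text \<open>A machine halts when its program counter leaves the program, and then stays put.\<close>

definition halted :: "instr list \<Rightarrow> config \<Rightarrow> bool" where
  "halted prog c \<longleftrightarrow> length prog \<le> pc c"

definition step :: "nat \<Rightarrow> instr list \<Rightarrow> config \<Rightarrow> config" where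
  "step w prog c = (if halted prog c then c else exec_instr w (prog ! pc c) c)"

definition halts_within ::
    "nat \<Rightarrow> instr list \<Rightarrow> config \<Rightarrow> real \<Rightarrow> config \<Rightarrow> bool" where
  "halts_within w prog c t c' \<longleftrightarrow>
     (\<exists>s. real s \<le> t \<and> c' = (step w prog ^^ s) c \<and> halted prog c')"

text \<open>The arguments are passed in the first registers; all other registers are zero.\<close>

definition start :: "nat list \<Rightarrow> (nat \<Rightarrow> nat) \<Rightarrow> config" where
  "start args M =
     \<lparr>pc = 0, reg = (\<lambda>r. if r < length args then args ! r else 0), mem = M\<rparr>"

definition word_mem :: "nat \<Rightarrow> (nat \<Rightarrow> nat) \<Rightarrow> bool" where
  "word_mem w M \<longleftrightarrow> (\<forall>a. M a < 2 ^ w)"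

definition agree_below :: "nat \<Rightarrow> (nat \<Rightarrow> nat) \<Rightarrow> (nat \<Rightarrow> nat) \<Rightarrow> bool" where
  "agree_below s M M' \<longleftrightarrow> (\<forall>a<s. M a = M' a)"


section \<open>Packed input\<close>

definition letter_bits :: "nat \<Rightarrow> nat" where
  "letter_bits \<sigma> = nat \<lceil>log 2 (real \<sigma>)\<rceil>"

text \<open>
  With \<open>b\<close> bits per letter, the letter at position \<open>k\<close> occupies bits \<open>b * k, \<dots>, b * k + b - 1\<close> of
  one long bit string, which is cut into words of \<open>w\<close> bits. A letter may straddle word boundaries,
  and \<open>b > w\<close> is possible.
\<close>

definition packed_word :: "nat \<Rightarrow> nat \<Rightarrow> nat list \<Rightarrow> nat \<Rightarrow> nat" where
  "packed_word w b T q = (\<Sum>k<length T. T ! k * 2 ^ (b * k)) div 2 ^ (w * q) mod 2 ^ w"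

text \<open>
  The packed string occupies a prefix of the memory (\<open>q\<close> is the index of one of its
  \<open>\<lceil>length T * b / w\<rceil>\<close> words iff \<open>q * w < length T * b\<close>). All other cells hold arbitrary words.
\<close>

definition holds_packed :: "nat \<Rightarrow> nat \<Rightarrow> nat list \<Rightarrow> (nat \<Rightarrow> nat) \<Rightarrow> bool" where
  "holds_packed w b T M \<longleftrightarrow>
     word_mem w M \<and> (\<forall>q. q * w < length T * b \<longrightarrow> M q = packed_word w b T q)"


section \<open>Compact output\<close>

definition arith_prog :: "nat \<Rightarrow> nat \<Rightarrow> nat \<Rightarrow> nat set" where
  "arith_prog a d l = {a + t * d | t. t < l}"

text \<open>
  A set is returned as a union of arithmetic progressions: register 0 holds their number, and the
  following registers hold, for each of them, its first element, its difference and its length.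
\<close>

definition output_size :: "config \<Rightarrow> nat" where
  "output_size c = 1 + 3 * reg c 0"

definition output_set :: "config \<Rightarrow> nat set" where
  "output_set c =
     (\<Union>k<reg c 0. arith_prog (reg c (3 * k + 1)) (reg c (3 * k + 2)) (reg c (3 * k + 3)))"


section \<open>Data structures for prefix-suffix queries\<close>

text \<open>
  The data structure consists of the first \<open>s\<close> memory cells left by the preprocessing, at most
  \<open>size_bound\<close> many (including whatever part of the string is retained). A query may rely on these
  cells only, and leaves them unchanged, so that any sequence of queries can be answered.
\<close>

definition answers_queries ::
    "nat \<Rightarrow> instr list \<Rightarrow> nat list \<Rightarrow> real \<Rightarrow> real \<Rightarrow> nat \<Rightarrow> (nat \<Rightarrow> nat) \<Rightarrow> bool" where
  "answers_queries w Q T time_bound out_bound s D \<longleftrightarrow>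
     (\<forall>i<length T. \<forall>j<length T. \<forall>M. word_mem w M \<and> agree_below s M D \<longrightarrow>
        (\<exists>c. halts_within w Q (start [i, j] M) time_bound c
           \<and> agree_below s (mem c) D
           \<and> real (output_size c) \<le> out_bound
           \<and> output_set c = pref_suf T i j))"

text \<open>
  On word size: a word must be able to hold positions in the string and addresses of the data
  structure, which for \<open>\<sigma> = n ^ e\<close> has \<open>\<Theta>(n)\<close> cells. So \<open>w = \<Omega>(log n)\<close> is read as
  \<open>K * n \<le> 2 ^ w\<close>, i.e. \<open>w \<ge> log 2 n + log 2 K\<close>, for a constant \<open>K\<close>. For \<open>2 \<le> \<sigma> \<le> n ^ e\<close>
  we have \<open>2 \<le> n\<close>, so that \<open>log \<sigma> n\<close> is positive.
\<close>

text \<open>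
  The preprocessing is given the length of the string, the number of bits per letter and the word
  size.
\<close>

definition solves_pref_suf ::
    "nat \<Rightarrow> instr list \<Rightarrow> instr list \<Rightarrow> nat \<Rightarrow> nat list \<Rightarrow>
     real \<Rightarrow> real \<Rightarrow> real \<Rightarrow> real \<Rightarrow> bool" where
  "solves_pref_suf w P Q b T prep_bound size_bound time_bound out_bound \<longleftrightarrow>
     (\<forall>M. holds_packed w b T M \<longrightarrow>
        (\<exists>c s. halts_within w P (start [length T, b, w] M) prep_bound c
             \<and> real s \<le> size_bound
             \<and> answers_queries w Q T time_bound out_bound s (mem c)))"

end

theory Submission
  imports Defs
begin

text \<open>
  If \<open>j \<le> i + 1\<close>, put \<open>d = i + 1 - j\<close>: the queried string is \<open>T[0..i] T[j..n-1]\<close>, of length \<open>n + d\<close>, and an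
  occurrence of \<open>T\<close> at position \<open>p \<le> d\<close> says that \<open>p\<close> is a period of \<open>T[0..i]\<close> and \<open>d - p\<close> a period of
  \<open>T[j..n-1]\<close>. By the periodicity lemma, an occurrence at some \<open>0 < p < d\<close> makes \<open>T\<close> periodic, with the
  shortest period \<open>r\<close> dividing \<open>d\<close>, and then the occurrences are exactly the multiples of \<open>r\<close> up to \<open>d\<close>.
  If \<open>r\<close> does not divide \<open>d\<close>, only \<open>0\<close> and \<open>d\<close> remain, so that two tests suffice: whether \<open>T[d..]\<close> agrees with
  \<open>T\<close> on \<open>j\<close> letters, and the same for the reversed string.

  To perform such tests in constant time and sublinear space, the string is cut into blocks of
  \<open>\<Theta>(log n)\<close> bits, few enough that a table indexed by the content of three blocks can be afforded.
  Every letter spans \<open>sp\<close> pieces of \<open>c\<close> bits, and \<open>k\<close> pieces form a block, where \<open>sp = 1\<close> or \<open>k = 1\<close>.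
\<close>

text \<open>The obstacle is to test shift \<open>d\<close> against a prefix of length
  \<open>l\<close> in constant time: a full Z-array has n entries, too many by a logarithmic factor.
  The remedy is sparsity. Let \<open>rho\<close> be the shortest period of the first
  \<open>2 * k\<close> letters if it is at most k, and let \<open>M\<close> be the length of the
  longest \<open>rho\<close>-periodic prefix, plus one for the letter that breaks it; without such a
  period \<open>M = 2 * k\<close>. Occurrences of the prefix of length \<open>M\<close> are at least
  k apart, so Z-values, rounded down to whole blocks, are kept for them only, one slot per block.
  Shorter prefixes are periodic, and for them an array \<open>nb\<close> pointing to the next block
  that breaks the period is enough. The rounding loses at most one block, which is recovered by
  comparing the last k letters directly. The occurrences are found by table lookup on windows of
  three blocks, and the Z-algorithm runs over them at constant amortised cost per block.\<close>

section \<open>A small structured language, its compiler to the word RAM and its exact running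
  time\<close>

datatype exp = Cst nat | V nat | Op binop exp exp | Ld exp

type_synonym st = "(nat \<Rightarrow> nat) \<times> (nat \<Rightarrow> nat)"

primrec ev :: "nat \<Rightarrow> exp \<Rightarrow> st \<Rightarrow> nat" where
  "ev w (Cst a) s = a mod 2 ^ w"
| "ev w (V x) s = fst s x"
| "ev w (Op f a b) s = binop_val w f (ev w a s) (ev w b s)"
| "ev w (Ld a) s = snd s (ev w a s)"

text \<open>Registers from \<open>d\<close> upward act as an evaluation stack. Copying is done by OR
  of a register with itself, which reproduces every value without reduction modulo the word
  size.\<close>

primrec cexp :: "exp \<Rightarrow> nat \<Rightarrow> instr list" where
  "cexp (Cst a) d = [SetConst d a]"
| "cexp (V x) d = [BinOp Or d x x]"
| "cexp (Op f a b) d = cexp a d @ cexp b (Suc d) @ [BinOp f d d (Suc d)]"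
| "cexp (Ld a) d = cexp a d @ [Load d d]"

primrec cost :: "exp \<Rightarrow> nat" where
  "cost (Cst a) = 1"
| "cost (V x) = 1"
| "cost (Op f a b) = cost a + cost b + 1"
| "cost (Ld a) = cost a + 1"

primrec evars :: "exp \<Rightarrow> nat set" where
  "evars (Cst a) = {}"
| "evars (V x) = {x}"
| "evars (Op f a b) = evars a \<union> evars b"
| "evars (Ld a) = evars a"

lemma length_cexp [simp]: "length (cexp e d) = cost e"
  by (induction e arbitrary: d) auto

datatype com =
    Asg nat exp
  | Sto exp exp
  | Sq com com (infixr ";;" 60)
  | Cond exp com com
  | Whl exp com
  | Skip

text \<open>Program variables occupy registers below 100, which \<open>vars_ok\<close> enforces;
  evaluation uses registers from 100 on and cannot overwrite a variable.\<close>

abbreviation (input) tmp :: nat where "tmp \<equiv> 100"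

primrec clen :: "com \<Rightarrow> nat" where
  "clen (Asg x e) = cost e + 1"
| "clen (Sto a e) = cost a + cost e + 1"
| "clen (Sq c d) = clen c + clen d"
| "clen (Cond e c d) = cost e + clen c + clen d + 3"
| "clen (Whl e c) = cost e + clen c + 3"
| "clen Skip = 0"

text \<open>Jump targets are absolute, hence the start address \<open>p\<close>. An unconditional
  jump is a zero test of a register that has just been set to zero.\<close>

primrec ccom :: "nat \<Rightarrow> com \<Rightarrow> instr list" where
  "ccom p (Asg x e) = cexp e tmp @ [BinOp Or x tmp tmp]"
| "ccom p (Sto a e) = cexp a tmp @ cexp e (Suc tmp) @ [Store tmp (Suc tmp)]"
| "ccom p (Sq c d) = ccom p c @ ccom (p + clen c) d"
| "ccom p (Cond e c d) =
     cexp e tmp @ [JumpZero tmp (p + cost e + clen c + 3)] @ ccom (p + cost e + 1) c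
     @ [SetConst tmp 0, JumpZero tmp (p + cost e + clen c + clen d + 3)]
     @ ccom (p + cost e + clen c + 3) d"
| "ccom p (Whl e c) =
     cexp e tmp @ [JumpZero tmp (p + cost e + clen c + 3)] @ ccom (p + cost e + 1) c
     @ [SetConst tmp 0, JumpZero tmp p]"
| "ccom p Skip = []"

primrec vars_ok :: "com \<Rightarrow> bool" where
  "vars_ok (Asg x e) \<longleftrightarrow> x < tmp \<and> evars e \<subseteq> {..<tmp}"
| "vars_ok (Sto a e) \<longleftrightarrow> evars a \<subseteq> {..<tmp} \<and> evars e \<subseteq> {..<tmp}"
| "vars_ok (Sq c d) \<longleftrightarrow> vars_ok c \<and> vars_ok d"
| "vars_ok (Cond e c d) \<longleftrightarrow> evars e \<subseteq> {..<tmp} \<and> vars_ok c \<and> vars_ok d"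
| "vars_ok (Whl e c) \<longleftrightarrow> evars e \<subseteq> {..<tmp} \<and> vars_ok c"
| "vars_ok Skip \<longleftrightarrow> True"

lemma length_ccom [simp]: "length (ccom p c) = clen c"
  by (induction c arbitrary: p) auto

text \<open>The time index is the exact number of machine instructions executed by the compiled
  code. The 3 in the rules for a true condition is the test plus the two-instruction jump that skips
  the other branch or returns to the loop head.\<close>

inductive big :: "nat \<Rightarrow> com \<Rightarrow> st \<Rightarrow> nat \<Rightarrow> st \<Rightarrow> bool" for w where
  Asg: "big w (Asg x e) s (cost e + 1) ((fst s)(x := ev w e s), snd s)"
| Sto: "big w (Sto a e) s (cost a + cost e + 1) (fst s, (snd s)(ev w a s := ev w e s))"
| Sq: "big w c s t s' \<Longrightarrow> big w d s' t' s'' \<Longrightarrow> big w (Sq c d) s (t + t') s''"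
| CondT: "ev w e s \<noteq> 0 \<Longrightarrow> big w c s t s' \<Longrightarrow> big w (Cond e c d) s (cost e + 3 + t) s'"
| CondF: "ev w e s = 0 \<Longrightarrow> big w d s t s' \<Longrightarrow> big w (Cond e c d) s (cost e + 1 + t) s'"
| WhlF: "ev w e s = 0 \<Longrightarrow> big w (Whl e c) s (cost e + 1) s"
| WhlT: "ev w e s \<noteq> 0 \<Longrightarrow> big w c s t s' \<Longrightarrow> big w (Whl e c) s' t' s'' \<Longrightarrow>
     big w (Whl e c) s (cost e + 3 + t + t') s''"
| Skip: "big w Skip s 0 s"

definition agrees :: "config \<Rightarrow> st \<Rightarrow> bool" where
  "agrees c s \<longleftrightarrow> (\<forall>x<tmp. reg c x = fst s x) \<and> mem c = snd s"

lemma step_at: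
  assumes "prog = xs @ i # ys" "pc c = length xs"
  shows "step w prog c = exec_instr w i c"
  using assms by (simp add: step_def halted_def nth_append)

definition reach :: "nat \<Rightarrow> instr list \<Rightarrow> nat \<Rightarrow> config \<Rightarrow> config \<Rightarrow> bool" where
  "reach w prog t c c' \<longleftrightarrow> (step w prog ^^ t) c = c'"

lemma reach_step:
  assumes "reach w prog t c c'" "step w prog c' = d"
  shows "reach w prog (Suc t) c d"
  using assms by (simp add: reach_def)

lemma reach_one: "step w prog c = d \<Longrightarrow> reach w prog (Suc 0) c d"
  by (simp add: reach_def)

lemma step_compose: "reach w prog a c c' \<Longrightarrow> reach w prog b c' c''
   \<Longrightarrow> reach w prog (a + b) c c''"
  unfolding reach_def by (metis add.commute comp_apply funpow_add)

text \<open>That registers below \<open>d\<close> stay intact is the strengthening the induction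
  needs: it keeps the left operand alive while the right one is evaluated one register
  higher.\<close>

lemma exec_cexp:
  assumes "prog = xs @ cexp e d @ ys" "pc c = length xs" "d \<ge> tmp" "evars e \<subseteq> {..<tmp}"
    "agrees c s"
  shows "\<exists>c'. reach w prog (cost e) c c' \<and> pc c' = length xs + cost e \<and>
     reg c' d = ev w e s \<and> (\<forall>x<d. reg c' x = reg c x) \<and> mem c' = mem c"
  using assms
proof (induction e arbitrary: d xs ys c)
  case (Cst a)
  have "step w prog c = exec_instr w (SetConst d a) c"
    by (rule step_at[of _ xs _ ys]) (use Cst.prems in auto)
  from reach_one[OF this] Cst.prems show ?case
    by (intro exI[of _ "exec_instr w (SetConst d a) c"] conjI) auto
next
  case (V x)
  have "step w prog c = exec_instr w (BinOp Or d x x) c"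
    by (rule step_at[of _ xs _ ys]) (use V.prems in auto)
  from reach_one[OF this] V.prems show ?case
    by (intro exI[of _ "exec_instr w (BinOp Or d x x) c"] conjI) (auto simp: agrees_def)
next
  case (Op f a b)
  obtain c1 where c1: "reach w prog (cost a) c c1" "pc c1 = length xs + cost a"
    "reg c1 d = ev w a s" "\<forall>x<d. reg c1 x = reg c x" "mem c1 = mem c"
    using Op.IH(1)[of xs d "cexp b (Suc d) @ [BinOp f d d (Suc d)] @ ys" c, OF _ Op.prems(2,3) _ Op.prems(5)]
      Op.prems(1,4) by auto
  have ag: "agrees c1 s" using c1 Op.prems by (auto simp: agrees_def)
  obtain c2 where c2: "reach w prog (cost b) c1 c2" "pc c2 = length xs + cost a + cost b"
    "reg c2 (Suc d) = ev w b s" "\<forall>x<Suc d. reg c2 x = reg c1 x" "mem c2 = mem c1"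
    using Op.IH(2)[of "xs @ cexp a d" "Suc d" "[BinOp f d d (Suc d)] @ ys" c1, OF _ _ _ _ ag]
      Op.prems(1,3,4) c1(2) by auto
  have st: "step w prog c2 = exec_instr w (BinOp f d d (Suc d)) c2"
    by (rule step_at[of _ "xs @ cexp a d @ cexp b (Suc d)" _ ys]) (use Op.prems c2 in auto)
  from reach_step[OF step_compose[OF c1(1) c2(1)] st] show ?case
    by (intro exI[of _ "exec_instr w (BinOp f d d (Suc d)) c2"] conjI) (use c1(3,4,5) c2(2-5) in auto)
next
  case (Ld a)
  obtain c1 where c1: "reach w prog (cost a) c c1" "pc c1 = length xs + cost a"
    "reg c1 d = ev w a s" "\<forall>x<d. reg c1 x = reg c x" "mem c1 = mem c"
    using Ld.IH[of xs d "[Load d d] @ ys" c, OF _ Ld.prems(2,3) _ Ld.prems(5)] Ld.prems(1,4) by auto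
  have st: "step w prog c1 = exec_instr w (Load d d) c1"
    by (rule step_at[of _ "xs @ cexp a d" _ ys]) (use Ld.prems c1 in auto)
  from reach_step[OF c1(1) this] show ?case
    by (intro exI[of _ "exec_instr w (Load d d) c1"] conjI) (use c1 Ld.prems in \<open>auto simp: agrees_def\<close>)
qed

lemma exec_cexp_tmp:
  assumes "prog = xs @ cexp e tmp @ ys" "pc c = length xs" "evars e \<subseteq> {..<tmp}" "agrees c s"
  shows "\<exists>c'. reach w prog (cost e) c c' \<and> pc c' = length xs + cost e \<and>
     reg c' tmp = ev w e s \<and> agrees c' s"
  using exec_cexp[OF assms(1,2) order_refl assms(3,4), of w] assms(4) unfolding agrees_def
  by (metis (no_types))

lemma exec_test:
  assumes "prog = xs @ cexp e tmp @ JumpZero tmp l # ys" "pc c = length xs"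
    "evars e \<subseteq> {..<tmp}" "agrees c s"
  shows "\<exists>c'. reach w prog (cost e + 1) c c' \<and>
     pc c' = (if ev w e s = 0 then l else length xs + cost e + 1) \<and> agrees c' s"
proof -
  obtain c1 where c1: "reach w prog (cost e) c c1" "pc c1 = length xs + cost e"
     "reg c1 tmp = ev w e s" "agrees c1 s"
    using exec_cexp_tmp[of prog xs e "JumpZero tmp l # ys"] assms by blast
  have "step w prog c1 = exec_instr w (JumpZero tmp l) c1"
    by (rule step_at[of _ "xs @ cexp e tmp" _ ys]) (use assms c1 in auto)
  from reach_step[OF c1(1) this] show ?thesis
    by (intro exI[of _ "exec_instr w (JumpZero tmp l) c1"] conjI) (use c1 in \<open>auto simp: agrees_def\<close>)
qed

lemma exec_goto:
  assumes "prog = xs @ SetConst tmp 0 # JumpZero tmp l # ys" "pc c = length xs" "agrees c s"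
  shows "\<exists>c'. reach w prog 2 c c' \<and> pc c' = l \<and> agrees c' s"
proof -
  have 1: "step w prog c = exec_instr w (SetConst tmp 0) c" (is "_ = ?c1")
    by (rule step_at) (use assms in auto)
  have "step w prog ?c1 = exec_instr w (JumpZero tmp l) ?c1" (is "_ = ?c2")
    by (rule step_at[of _ "xs @ [SetConst tmp 0]" _ ys]) (use assms in auto)
  from reach_step[OF reach_one[OF 1] this] show ?thesis unfolding numeral_2_eq_2
    by (intro exI[of _ ?c2] conjI) (use assms in \<open>auto simp: agrees_def\<close>)
qed

text \<open>Induction follows the execution and not the syntax, so that the remaining iterations of
  a loop are available as an induction hypothesis at the same program address.\<close>

lemma compile_correct:
  assumes "big w com s t s'" "prog = xs @ ccom (length xs) com @ ys" "pc c = length xs"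
    "vars_ok com" "agrees c s"
  shows "\<exists>c'. reach w prog t c c' \<and> pc c' = length xs + clen com \<and> agrees c' s'"
  using assms
proof (induction arbitrary: xs ys c rule: big.induct)
  case (Asg x e s)
  obtain c1 where c1: "reach w prog (cost e) c c1" "pc c1 = length xs + cost e"
     "reg c1 tmp = ev w e s" "agrees c1 s"
    using exec_cexp_tmp[of prog xs e "[BinOp Or x tmp tmp] @ ys" c s w] Asg.prems by auto
  have "step w prog c1 = exec_instr w (BinOp Or x tmp tmp) c1"
    by (rule step_at[of _ "xs @ cexp e tmp" _ ys]) (use Asg c1 in auto)
  from reach_step[OF c1(1) this] show ?case
    by (intro exI[of _ "exec_instr w (BinOp Or x tmp tmp) c1"] conjI)
      (use c1 Asg in \<open>auto simp: agrees_def\<close>)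
next
  case (Sto a e s)
  obtain c1 where c1: "reach w prog (cost a) c c1" "pc c1 = length xs + cost a"
     "reg c1 tmp = ev w a s" "agrees c1 s"
    using exec_cexp_tmp[of prog xs a "cexp e (Suc tmp) @ [Store tmp (Suc tmp)] @ ys" c s w] Sto.prems by auto
  obtain c2 where c2: "reach w prog (cost e) c1 c2" "pc c2 = length xs + cost a + cost e"
     "reg c2 (Suc tmp) = ev w e s" "\<forall>x<Suc tmp. reg c2 x = reg c1 x" "mem c2 = mem c1"
    using exec_cexp[of prog "xs @ cexp a tmp" e "Suc tmp" "[Store tmp (Suc tmp)] @ ys" c1 s w] Sto c1
    by auto
  have "step w prog c2 = exec_instr w (Store tmp (Suc tmp)) c2"
    by (rule step_at[of _ "xs @ cexp a tmp @ cexp e (Suc tmp)" _ ys]) (use Sto c2 in auto)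
  from reach_step[OF step_compose[OF c1(1) c2(1)] this] show ?case
    by (intro exI[of _ "exec_instr w (Store tmp (Suc tmp)) c2"] conjI)
      (use c1 c2 in \<open>auto simp: agrees_def\<close>)
next
  case (Sq c1 s t s' c2 t' s'')
  obtain d1 where d1: "reach w prog t c d1" "pc d1 = length xs + clen c1" "agrees d1 s'"
    using Sq.IH(1)[of xs "ccom (length xs + clen c1) c2 @ ys" c] Sq.prems by auto
  obtain d2 where d2: "reach w prog t' d1 d2" "pc d2 = length xs + clen c1 + clen c2"
     "agrees d2 s''"
    using Sq.IH(2)[of "xs @ ccom (length xs) c1" ys d1] Sq.prems d1 by auto
  show ?case using step_compose[OF d1(1) d2(1)] d2 by auto
next
  case (CondT e s c1 t s' c2)
  let ?n = "length xs + cost e + clen c1 + 3"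
  let ?r = "[SetConst tmp 0, JumpZero tmp (?n + clen c2)] @ ccom ?n c2 @ ys"
  obtain d1 where d1: "reach w prog (cost e + 1) c d1" "pc d1 = length xs + cost e + 1"
     "agrees d1 s"
    using exec_test[of prog xs e ?n "ccom (length xs + cost e + 1) c1 @ ?r" c s w] CondT.prems CondT.hyps by auto
  obtain d2 where d2: "reach w prog t d1 d2" "pc d2 = length xs + cost e + 1 + clen c1"
     "agrees d2 s'"
    using CondT.IH[of "xs @ cexp e tmp @ [JumpZero tmp ?n]" ?r d1] CondT.prems d1
    by (auto simp: algebra_simps numeral_3_eq_3)
  obtain d3 where d3: "reach w prog 2 d2 d3" "pc d3 = ?n + clen c2" "agrees d3 s'"
    using exec_goto[of prog "xs @ cexp e tmp @ [JumpZero tmp ?n] @ ccom (length xs + cost e + 1) c1"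
       "?n + clen c2" "ccom ?n c2 @ ys" d2 s' w] CondT.prems d2(2,3) by (auto simp: algebra_simps numeral_3_eq_3)
  have "reach w prog (cost e + 1 + t + 2) c d3"
    using step_compose[OF step_compose[OF d1(1) d2(1)] d3(1)] .
  then show ?case using d3(2,3) by (intro exI[of _ d3]) (simp add: algebra_simps numeral_2_eq_2 numeral_3_eq_3)
next
  case (CondF e s c2 t s' c1)
  let ?n = "length xs + cost e + clen c1 + 3"
  let ?r = "[SetConst tmp 0, JumpZero tmp (?n + clen c2)] @ ccom ?n c2 @ ys"
  obtain d1 where d1: "reach w prog (cost e + 1) c d1" "pc d1 = ?n" "agrees d1 s"
    using exec_test[of prog xs e ?n "ccom (length xs + cost e + 1) c1 @ ?r" c s w] CondF.prems CondF.hyps by auto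
  obtain d2 where d2: "reach w prog t d1 d2" "pc d2 = ?n + clen c2" "agrees d2 s'"
    using CondF.IH[of "xs @ cexp e tmp @ [JumpZero tmp ?n] @ ccom (length xs + cost e + 1) c1
       @ [SetConst tmp 0, JumpZero tmp (?n + clen c2)]" ys d1] CondF.prems d1
    by (auto simp: algebra_simps numeral_3_eq_3)
  show ?case using step_compose[OF d1(1) d2(1)] d2(2,3) by (intro exI[of _ d2]) (simp add: algebra_simps numeral_2_eq_2 numeral_3_eq_3)
next
  case (WhlF e s c1)
  obtain d1 where d1: "reach w prog (cost e + 1) c d1"
     "pc d1 = length xs + cost e + clen c1 + 3" "agrees d1 s"
    using exec_test[of prog xs e "length xs + cost e + clen c1 + 3"
      "ccom (length xs + cost e + 1) c1 @ [SetConst tmp 0, JumpZero tmp (length xs)] @ ys" c s w]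
      WhlF.prems WhlF.hyps by auto
  then show ?case by auto
next
  case (WhlT e s c1 t s' t' s'')
  let ?n = "length xs + cost e + clen c1 + 3"
  let ?r = "[SetConst tmp 0, JumpZero tmp (length xs)] @ ys"
  obtain d1 where d1: "reach w prog (cost e + 1) c d1" "pc d1 = length xs + cost e + 1"
     "agrees d1 s"
    using exec_test[of prog xs e ?n "ccom (length xs + cost e + 1) c1 @ ?r" c s w] WhlT.prems WhlT.hyps by auto
  obtain d2 where d2: "reach w prog t d1 d2" "pc d2 = length xs + cost e + 1 + clen c1"
     "agrees d2 s'"
    using WhlT.IH(1)[of "xs @ cexp e tmp @ [JumpZero tmp ?n]" ?r d1] WhlT.prems d1
    by (auto simp: algebra_simps numeral_3_eq_3)
  obtain d3 where d3: "reach w prog 2 d2 d3" "pc d3 = length xs" "agrees d3 s'"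
    using exec_goto[of prog "xs @ cexp e tmp @ [JumpZero tmp ?n] @ ccom (length xs + cost e + 1) c1"
       "length xs" ys d2 s' w] WhlT.prems d2(2,3) by (auto simp: algebra_simps numeral_3_eq_3)
  obtain d4 where d4: "reach w prog t' d3 d4" "pc d4 = length xs + clen (Whl e c1)" "agrees d4 s''"
    using WhlT.IH(2)[of xs ys d3] WhlT.prems d3 by auto
  have "reach w prog (cost e + 1 + t + 2 + t') c d4"
    using step_compose[OF step_compose[OF step_compose[OF d1(1) d2(1)] d3(1)] d4(1)] .
  then show ?case using d4(2,3) by (intro exI[of _ d4]) (simp add: algebra_simps numeral_2_eq_2 numeral_3_eq_3)
next
  case (Skip s)
  then show ?case by (auto simp: reach_def)
qed

lemma compile_halts:
  assumes "big w com s t s'" "vars_ok com" "agrees c s" "pc c = 0" "real t \<le> B"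
  shows "\<exists>c'. halts_within w (ccom 0 com) c B c' \<and> agrees c' s'"
  using compile_correct[OF assms(1), of "ccom 0 com" "[]" "[]" c] assms
  unfolding halts_within_def halted_def reach_def
  by (metis add.left_neutral append.left_neutral append.right_neutral length_ccom list.size(3) order_refl)

section \<open>A weakest-precondition calculus that tracks elapsed time\<close>

text \<open>\<open>T\<close> is the time already spent, so that postconditions can bound the total
  time. Execution is deterministic, and asking for a terminating one yields total
  correctness.\<close>

definition wp :: "nat \<Rightarrow> com \<Rightarrow> (st \<Rightarrow> nat \<Rightarrow> bool) \<Rightarrow> st \<Rightarrow> nat \<Rightarrow> bool" where
  "wp w c Q s T \<longleftrightarrow> (\<exists>t s'. big w c s t s' \<and> Q s' (T + t))"

lemma wp_Asg: "Q ((fst s)(x := ev w e s), snd s) (T + cost e + 1) \<Longrightarrow> wp w (Asg x e) Q s T"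
  unfolding wp_def using big.Asg by (metis add.assoc)

lemma wp_Sto: "Q (fst s, (snd s)(ev w a s := ev w e s)) (T + cost a + cost e + 1) \<Longrightarrow> wp w (Sto a e) Q s T"
  unfolding wp_def using big.Sto by (metis add.assoc)

lemma wp_Sq: "wp w c (wp w d Q) s T \<Longrightarrow> wp w (Sq c d) Q s T"
  unfolding wp_def using big.Sq by (metis add.assoc)

lemma wp_Skip: "Q s T \<Longrightarrow> wp w Skip Q s T"
  unfolding wp_def using big.Skip by (metis add.right_neutral)

lemma wp_Cond:
  assumes "ev w e s \<noteq> 0 \<Longrightarrow> wp w c Q s (T + cost e + 3)" "ev w e s = 0 \<Longrightarrow> wp w d Q s (T + cost e + 1)"
  shows "wp w (Cond e c d) Q s T"
  using assms unfolding wp_def by (metis add.assoc big.CondF big.CondT)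

inductive_cases big_AsgE: "big w (Asg x e) s t s'"
inductive_cases big_StoE: "big w (Sto a e) s t s'"
inductive_cases big_SqE: "big w (Sq c d) s t s'"
inductive_cases big_SkipE: "big w Skip s t s'"
inductive_cases big_CondE: "big w (Cond e c d) s t s'"

text \<open>In the form of equations, the rules let the simplifier run loop-free code
  symbolically.\<close>

lemma wp_Asg_eq [simp]:
  "wp w (Asg x e) Q s T \<longleftrightarrow> Q ((fst s)(x := ev w e s), snd s) (T + cost e + 1)"
  by (rule iffI[OF _ wp_Asg]) (auto simp: wp_def add.assoc elim!: big_AsgE)

lemma wp_Sto_eq [simp]: "wp w (Sto a e) Q s T \<longleftrightarrow>
   Q (fst s, (snd s)(ev w a s := ev w e s)) (T + cost a + cost e + 1)"
  by (rule iffI[OF _ wp_Sto]) (auto simp: wp_def add.assoc elim!: big_StoE)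

lemma wp_Skip_eq [simp]: "wp w Skip Q s T \<longleftrightarrow> Q s T"
  by (rule iffI[OF _ wp_Skip]) (auto simp: wp_def elim!: big_SkipE)

lemma wp_Sq_eq [simp]: "wp w (Sq c d) Q s T \<longleftrightarrow> wp w c (wp w d Q) s T"
proof
  assume "wp w (Sq c d) Q s T"
  then obtain t s' where "big w (Sq c d) s t s'" "Q s' (T + t)" unfolding wp_def by blast
  then show "wp w c (wp w d Q) s T"
    by cases (auto simp: wp_def add.assoc[symmetric] simp del: split_paired_Ex)
qed (rule wp_Sq)

lemma wp_Cond_eq [simp]: "wp w (Cond e c d) Q s T \<longleftrightarrow>
   (if ev w e s \<noteq> 0 then wp w c Q s (T + cost e + 3) else wp w d Q s (T + cost e + 1))"
proof
  assume "wp w (Cond e c d) Q s T"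
  then obtain t s' where "big w (Cond e c d) s t s'" "Q s' (T + t)" unfolding wp_def by blast
  then show "if ev w e s \<noteq> 0 then wp w c Q s (T + cost e + 3) else wp w d Q s (T + cost e + 1)"
    by cases (auto simp: wp_def add.assoc[symmetric] simp del: split_paired_Ex)
qed (auto intro: wp_Cond split: if_splits)

lemma wp_mono: "wp w c Q s T \<Longrightarrow> (\<And>s' T'. Q s' T' \<Longrightarrow> Q' s' T') \<Longrightarrow> wp w c Q' s T"
  unfolding wp_def by blast

primrec mods :: "com \<Rightarrow> nat set" where
  "mods (Asg x e) = {x}"
| "mods (Sto a e) = {}"
| "mods (Sq c d) = mods c \<union> mods d"
| "mods (Cond e c d) = mods c \<union> mods d"
| "mods (Whl e c) = mods c"
| "mods Skip = {}"

lemma big_mods: "big w c s t s' \<Longrightarrow> x \<notin> mods c \<Longrightarrow> fst s' x = fst s x"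
  by (induction rule: big.induct) auto

primrec no_store :: "com \<Rightarrow> bool" where
  "no_store (Asg x e) \<longleftrightarrow> True"
| "no_store (Sto a e) \<longleftrightarrow> False"
| "no_store (Sq c d) \<longleftrightarrow> no_store c \<and> no_store d"
| "no_store (Cond e c d) \<longleftrightarrow> no_store c \<and> no_store d"
| "no_store (Whl e c) \<longleftrightarrow> no_store c"
| "no_store Skip \<longleftrightarrow> True"

lemma big_no_store: "big w c s t s' \<Longrightarrow> no_store c \<Longrightarrow> snd s' = snd s"
  by (induction rule: big.induct) auto

lemma wp_frame:
  assumes "wp w c Q s T"
  shows "wp w c (\<lambda>s' T'. Q s' T' \<and> (\<forall>x. x \<notin> mods c \<longrightarrow> fst s' x = fst s x)
     \<and> (no_store c \<longrightarrow> snd s' = snd s)) s T"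
  using assms unfolding wp_def by (meson big_mods big_no_store)

text \<open>The invariant may mention the time elapsed so far, so that amortised bounds can be stated.\<close>

lemma wp_Whl:
  fixes m :: "st \<Rightarrow> nat"
  assumes I: "I s T"
    and body: "\<And>s' T'. I s' T' \<Longrightarrow> ev w e s' \<noteq> 0 \<Longrightarrow> \<forall>x. x \<notin> mods c \<longrightarrow> fst s' x = fst s x \<Longrightarrow>
       no_store c \<longrightarrow> snd s' = snd s \<Longrightarrow>
       wp w c (\<lambda>s'' T''. I s'' T'' \<and> m s'' < m s') s' (T' + cost e + 3)"
    and fin: "\<And>s' T'. I s' T' \<Longrightarrow> ev w e s' = 0 \<Longrightarrow> \<forall>x. x \<notin> mods c \<longrightarrow> fst s' x = fst s x \<Longrightarrow>
       no_store c \<longrightarrow> snd s' = snd s \<Longrightarrow>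
       Q s' (T' + cost e + 1)"
  shows "wp w (Whl e c) Q s T"
proof -
  have "wp w (Whl e c) Q s' T'" if "I s' T'" "\<forall>x. x \<notin> mods c \<longrightarrow> fst s' x = fst s x"
     "no_store c \<longrightarrow> snd s' = snd s" for s' T'
    using that
  proof (induction "m s'" arbitrary: s' T' rule: less_induct)
    case less
    show ?case
    proof (cases "ev w e s' = 0")
      case True
      then show ?thesis using fin[OF less(2) True less(3,4)] big.WhlF[OF True]
        unfolding wp_def by (metis add.assoc)
    next
      case False
      obtain t s'' where b: "big w c s' t s''" "I s'' (T' + cost e + 3 + t)" "m s'' < m s'"
        using body[OF less(2) False less(3,4)] unfolding wp_def by blast
      have "wp w (Whl e c) Q s'' (T' + cost e + 3 + t)"
        by (rule less(1)[OF b(3) b(2)])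
          (use less(3,4) big_mods[OF b(1)] big_no_store[OF b(1)] in auto)
      then obtain t' s3 where "big w (Whl e c) s'' t' s3" "Q s3 (T' + cost e + 3 + t + t')"
        unfolding wp_def by blast
      then show ?thesis unfolding wp_def using big.WhlT[OF False b(1)] by (metis add.assoc)
    qed
  qed
  then show ?thesis using I by blast
qed

lemma bv_simps [simp]:
  "x + y < 2 ^ w \<Longrightarrow> binop_val w Add x y = x + y"
  "x * y < 2 ^ w \<Longrightarrow> binop_val w Mul x y = x * y"
  "x * 2 ^ y < 2 ^ w \<Longrightarrow> binop_val w Shl x y = x * 2 ^ y"
  by auto

lemma bv_Sub [simp]: "y \<le> x \<Longrightarrow> x < 2 ^ w \<Longrightarrow> binop_val w Sub x y = x - y"
proof -
  assume "y \<le> x" "x < 2 ^ w"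
  then have "(int x - int y) mod 2 ^ w = int (x - y)"
    by (metis less_imp_diff_less of_nat_diff of_nat_less_numeral_power_cancel_iff mod_pos_pos_trivial of_nat_0_le_iff)
  then show ?thesis by simp
qed

text \<open>Sums, differences, products and left shifts are from here on simplified only once
  absence of overflow has been shown; elsewhere the modular definition is unfolded by name.\<close>

declare binop_val.simps(1,2,3,9) [simp del]

section \<open>Periods of intervals and the structure of the answer\<close>

definition per_on :: "(nat \<Rightarrow> 'a) \<Rightarrow> nat \<Rightarrow> nat \<Rightarrow> nat \<Rightarrow> bool" where
  "per_on f a b p \<longleftrightarrow> (\<forall>x. a \<le> x \<longrightarrow> x + p < b \<longrightarrow> f x = f (x + p))"

lemma per_onD: "per_on f a b p \<Longrightarrow> a \<le> x \<Longrightarrow> x + p < b \<Longrightarrow> f x = f (x + p)"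
  by (simp add: per_on_def)

lemma per_on_0 [simp]: "per_on f a b 0"
  by (simp add: per_on_def)

lemma per_on_mult: "per_on f a b p \<Longrightarrow> per_on f a b (t * p)"
proof (induction t)
  case (Suc t)
  show ?case unfolding per_on_def
  proof (intro allI impI)
    fix x assume x: "a \<le> x" "x + Suc t * p < b"
    then have "f x = f (x + p)" using Suc.prems by (auto intro!: per_onD)
    also have "\<dots> = f (x + p + t * p)"
      by (rule per_onD[OF Suc.IH[OF Suc.prems]]) (use x in auto)
    finally show "f x = f (x + Suc t * p)" by (simp add: add.assoc)
  qed
qed simp

lemma per_on_dvd: "per_on f a b p \<Longrightarrow> p dvd q \<Longrightarrow> per_on f a b q"
  by (metis dvd_def mult.commute per_on_mult)

text \<open>Euclid's algorithm by subtraction. The difference \<open>q - p\<close> is again a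
  period: step back by p and forward by q, or forward by q and back by p; the length
  \<open>p + q\<close> guarantees that one of the two routes stays inside the interval.\<close>

lemma fine_wilf_weak:
  assumes "per_on f a b p" "per_on f a b q" "0 < p" "0 < q" "a + p + q \<le> b"
  shows "per_on f a b (gcd p q)"
  using assms
proof (induction "p + q" arbitrary: p q rule: less_induct)
  case less
  have sub: "per_on f a b (q - p)" if pq: "per_on f a b p" "per_on f a b q" "p < q" "a + p + q \<le> b" for p q
    unfolding per_on_def
  proof (intro allI impI)
    fix x assume x: "a \<le> x" "x + (q - p) < b"
    show "f x = f (x + (q - p))"
    proof (cases "a + p \<le> x")
      case True
      then have "f (x - p) = f (x - p + p)" "f (x - p) = f (x - p + q)"
        using x pq True per_onD[OF pq(1), of "x - p"] per_onD[OF pq(2), of "x - p"] by force+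
      then show ?thesis using True pq by simp
    next
      case False
      then have "f x = f (x + q)" using x pq by (auto intro!: per_onD[OF pq(2)])
      moreover have "f (x + (q - p)) = f (x + (q - p) + p)"
        using x pq False by (intro per_onD[OF pq(1)]) auto
      ultimately show ?thesis using pq by simp
    qed
  qed
  consider "p = q" | "p < q" | "q < p" by linarith
  then show ?case
  proof cases
    case 1
    then show ?thesis using less by simp
  next
    case 2
    have "per_on f a b (gcd p (q - p))"
      by (rule less.hyps) (use 2 less.prems sub in auto)
    then show ?thesis using 2 by (metis gcd.commute gcd_diff1_nat less_imp_le_nat)
  next
    case 3
    have "per_on f a b (gcd (p - q) q)"
      by (rule less.hyps) (use 3 less.prems sub in auto)
    then show ?thesis using 3 by (simp add: gcd_diff1_nat less_imp_le_nat)
  qed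
qed

text \<open>The period p transports a comparison at distance g to the right until both positions lie
  in the part where g is already known; \<open>p + g\<close> letters of that part are enough to land
  in it.\<close>

lemma per_on_extend_left:
  assumes "per_on f 0 b p" "per_on f a b g" "a + p + g \<le> b" "0 < p"
  shows "per_on f 0 b g"
  unfolding per_on_def
proof (intro allI impI)
  fix x assume "x + g < b"
  then show "f x = f (x + g)"
  proof (induction "b - x" arbitrary: x rule: less_induct)
    case less
    show ?case
    proof (cases "a \<le> x")
      case True
      then show ?thesis using per_onD[OF assms(2)] less.prems by blast
    next
      case False
      have "f x = f (x + p)" using False assms by (intro per_onD[OF assms(1)]) auto
      also have "\<dots> = f (x + p + g)"
        by (rule less.hyps) (use False assms less.prems in auto)
      also have "\<dots> = f (x + g + p)" by (simp add: add_ac)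
      also have "\<dots> = f (x + g)"
        using False assms by (intro per_onD[OF assms(1), symmetric]) auto
      finally show ?thesis .
    qed
  qed
qed

lemma per_on_extend_right:
  assumes "per_on f a n p" "per_on f a b g" "a + p + g \<le> b" "0 < p"
  shows "per_on f a n g"
  unfolding per_on_def
proof (intro allI impI)
  fix x assume "a \<le> x" "x + g < n"
  then show "f x = f (x + g)"
  proof (induction x rule: less_induct)
    case (less x)
    show ?case
    proof (cases "x + g < b")
      case True
      then show ?thesis using per_onD[OF assms(2)] less.prems by blast
    next
      case False
      have "f x = f (x - p + p)" using False assms by simp
      also have "\<dots> = f (x - p)"
        using False assms less.prems by (intro per_onD[OF assms(1), symmetric]) auto
      also have "\<dots> = f (x - p + g)"
        by (rule less.IH) (use False assms less.prems in auto)
      also have "\<dots> = f (x - p + g + p)"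
        using False assms less.prems by (intro per_onD[OF assms(1)]) auto
      also have "x - p + g + p = x + g" using False assms by auto
      finally show ?thesis .
    qed
  qed
qed

lemma per_on_mono: "per_on f a b p \<Longrightarrow> a \<le> a' \<Longrightarrow> b' \<le> b \<Longrightarrow> per_on f a' b' p"
  by (auto simp: per_on_def)

text \<open>The overlap from j to b has exactly \<open>p + q\<close> letters, the least length for
  which \<open>fine_wilf_weak\<close> applies; the common period found there spreads in both
  directions.\<close>

lemma interior_period:
  assumes "per_on f 0 b p" "per_on f j n q" "0 < p" "0 < q" "j + p + q = b" "b \<le> n"
  shows "per_on f 0 n (gcd p q)"
proof -
  let ?g = "gcd p q"
  have g: "?g \<le> p" "?g \<le> q" "0 < ?g" using assms by (auto intro: gcd_le1_nat gcd_le2_nat)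
  have "per_on f j b ?g"
    using assms by (intro fine_wilf_weak) (auto intro: per_on_mono)
  then have l: "per_on f 0 b ?g" and r: "per_on f j n ?g"
    using per_on_extend_left[OF assms(1), of j ?g] per_on_extend_right[OF assms(2), of b ?g] assms(3-5) g
    by linarith+
  show ?thesis unfolding per_on_def
  proof (intro allI impI)
    fix x assume x: "x + ?g < n"
    show "f x = f (x + ?g)"
    proof (cases "x + ?g < b")
      case True then show ?thesis using l by (auto intro: per_onD)
    next
      case False
      then have "j \<le> x" using assms g by linarith
      then show ?thesis using r x by (auto intro: per_onD)
    qed
  qed
qed

definition split_set :: "(nat \<Rightarrow> 'a) \<Rightarrow> nat \<Rightarrow> nat \<Rightarrow> nat \<Rightarrow> nat set" where
  "split_set f n j d = {p. p \<le> d \<and> per_on f 0 (j + d) p \<and> per_on f j n (d - p)}"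

text \<open>An interior occurrence makes g = \<open>gcd p (d - p)\<close> a period of the whole
  string of at most half its length. So r is at most g, \<open>fine_wilf_weak\<close> applies to r
  and g, and minimality forces their gcd to be r. The period r need not be short itself, it only
  bounds all short periods from below, which makes n a legitimate default.\<close>

lemma split_set_interior:
  assumes "j + d \<le> n" "0 < r" "per_on f 0 n r"
    and "\<And>q. 0 < q \<Longrightarrow> 2 * q \<le> n \<Longrightarrow> per_on f 0 n q \<Longrightarrow> r \<le> q"
    and "p \<in> split_set f n j d" "0 < p" "p < d"
  shows "r dvd p \<and> r dvd d"
proof -
  let ?g = "gcd p (d - p)"
  have g: "per_on f 0 n ?g"
    using assms by (intro interior_period[of f "j + d" p j n]) (auto simp: split_set_def)
  have "?g \<le> p" "?g \<le> d - p" "0 < ?g" using assms by (auto intro: gcd_le1_nat gcd_le2_nat)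
  then have g2: "2 * ?g \<le> n" using assms by linarith
  then have "r \<le> ?g" using assms(4) g \<open>0 < ?g\<close> by blast
  then have "per_on f 0 n (gcd r ?g)" 
    using fine_wilf_weak[OF assms(3) g assms(2) \<open>0 < ?g\<close>] g2 \<open>r \<le> ?g\<close> by linarith
  moreover have "gcd r ?g \<le> r" "gcd r ?g > 0" using assms by (auto intro: gcd_le1_nat)
  ultimately have "gcd r ?g = r" using assms(4)[of "gcd r ?g"] g2 \<open>r \<le> ?g\<close> by auto
  then have "r dvd ?g" by (metis gcd_dvd2)
  then have "r dvd p" "r dvd d - p" by auto
  then have "r dvd p + (d - p)" by (rule dvd_add)
  then show ?thesis using \<open>r dvd p\<close> assms by simp
qed

lemma split_set_dvd:
  assumes "j + d \<le> n" "0 < r" "per_on f 0 n r"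
    and "\<And>q. 0 < q \<Longrightarrow> 2 * q \<le> n \<Longrightarrow> per_on f 0 n q \<Longrightarrow> r \<le> q" "r dvd d"
  shows "split_set f n j d = arith_prog 0 r (d div r + 1)"
proof -
  have "p \<in> split_set f n j d \<longleftrightarrow> r dvd p \<and> p \<le> d" for p
  proof
    assume p: "r dvd p \<and> p \<le> d"
    then have "r dvd d - p" using assms(5) by simp
    then have "per_on f 0 n p" "per_on f 0 n (d - p)" using p per_on_dvd[OF assms(3)] by blast+
    then have "per_on f 0 (j + d) p" "per_on f j n (d - p)"
      using per_on_mono[OF _ order_refl assms(1)] per_on_mono[OF _ zero_le order_refl] by blast+
    then show "p \<in> split_set f n j d" using p by (simp add: split_set_def)
  next
    assume p: "p \<in> split_set f n j d"
    then have "p \<le> d" by (simp add: split_set_def)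
    then consider "p = 0" | "p = d" | "0 < p" "p < d" by linarith
    then have "r dvd p" by cases (use assms(5) split_set_interior[OF assms(1-4) p] in auto)
    then show "r dvd p \<and> p \<le> d" using \<open>p \<le> d\<close> by simp
  qed
  moreover have "r dvd p \<and> p \<le> d \<longleftrightarrow> (\<exists>t. p = 0 + t * r \<and> t < d div r + 1)" for p
  proof
    assume "r dvd p \<and> p \<le> d"
    then have "p = 0 + p div r * r" "p div r < d div r + 1"
      using div_le_mono[of p d r] by (simp_all add: le_imp_less_Suc)
    then show "\<exists>t. p = 0 + t * r \<and> t < d div r + 1" by blast
  next
    assume "\<exists>t. p = 0 + t * r \<and> t < d div r + 1"
    then obtain t where "p = t * r" "t \<le> d div r" by (metis add_0 Suc_eq_plus1 less_Suc_eq_le)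
    then show "r dvd p \<and> p \<le> d"
      by (metis dvd_triv_right less_eq_div_iff_mult_less_eq[OF assms(2)])
  qed
  ultimately show ?thesis unfolding arith_prog_def by blast
qed

lemma split_set_not_dvd:
  assumes "j + d \<le> n" "0 < r" "per_on f 0 n r"
    and "\<And>q. 0 < q \<Longrightarrow> 2 * q \<le> n \<Longrightarrow> per_on f 0 n q \<Longrightarrow> r \<le> q" "\<not> r dvd d"
  shows "split_set f n j d = {p. p = 0 \<and> per_on f j n d \<or> p = d \<and> per_on f 0 (j + d) d}"
proof -
  have "p = 0 \<or> p = d" if "p \<in> split_set f n j d" for p
    
  proof (rule ccontr)
    assume "\<not> (p = 0 \<or> p = d)"
    moreover have "p \<le> d" using that by (simp add: split_set_def)
    ultimately have "r dvd d" using split_set_interior[OF assms(1-4) that] by linarith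
    then show False using assms(5) by simp
  qed
  moreover have "0 \<in> split_set f n j d \<longleftrightarrow> per_on f j n d" "d \<in> split_set f n j d \<longleftrightarrow> per_on f 0 (j + d) d"
    by (simp_all add: split_set_def)
  ultimately show ?thesis by blast
qed

text \<open>Positions of the concatenation up to i are read unshifted and later ones shifted by d,
  so the two parts of an occurrence at p compare letters at distance p and \<open>d - p\<close>. If
  j exceeds \<open>i + 1\<close>, the concatenation is shorter than \<open>T\<close>.\<close>

lemma pref_suf_split:
  assumes i: "i < length T" and j: "j < length T"
  shows "pref_suf T i j = (if j \<le> i + 1 then split_set ((!) T) (length T) j (i + 1 - j) else {})"
proof -
  let ?n = "length T"
  let ?A = "fragment T 0 i" and ?B = "fragment T j (?n - 1)"
  have lA: "length ?A = i + 1" and lB: "length ?B = ?n - j"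
    using i j by (auto simp: fragment_def)
  have nA: "?A ! x = T ! x" if "x \<le> i" for x using that i by (simp add: fragment_def)
  have nB: "?B ! x = T ! (j + x)" if "j + x < ?n" for x using that j by (simp add: fragment_def)
  have occ: "p \<in> pref_suf T i j \<longleftrightarrow> p + ?n \<le> i + 1 + (?n - j) \<and> (\<forall>x<?n. (?A @ ?B) ! (p + x) = T ! x)" for p
  proof (cases "p + ?n \<le> length (?A @ ?B)")
    case True
    have "take ?n (drop p (?A @ ?B)) = T \<longleftrightarrow> (\<forall>x<?n. take ?n (drop p (?A @ ?B)) ! x = T ! x)"
      using True by (subst list_eq_iff_nth_eq) (simp del: append_assoc drop_append take_append)
    also have "\<dots> \<longleftrightarrow> (\<forall>x<?n. (?A @ ?B) ! (p + x) = T ! x)"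
      using True by (simp del: append_assoc drop_append take_append)
    finally show ?thesis using True lA lB unfolding pref_suf_def occurrences_def by simp
  next
    case False
    then show ?thesis using lA lB unfolding pref_suf_def occurrences_def by simp
  qed
  have S: "(?A @ ?B) ! y = (if y \<le> i then T ! y else T ! (y - (i + 1) + j))" if "y < i + 1 + (?n - j)" for y
  proof (cases "y \<le> i")
    case True
    then show ?thesis using lA nA by (simp add: nth_append)
  next
    case False
    then have "(?A @ ?B) ! y = ?B ! (y - (i + 1))" using lA by (simp add: nth_append)
    then show ?thesis using False nB[of "y - (i + 1)"] that j by (simp add: add.commute)
  qed
  show ?thesis
  proof (cases "j \<le> i + 1")
    case False
    then have "p \<notin> pref_suf T i j" for p using occ[of p] j by linarith
    then show ?thesis using False by (simp add: set_eq_iff)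
  next
    case True
    let ?d = "i + 1 - j"
    obtain d where d: "i + 1 = j + d" using True le_Suc_ex by blast
    have "(\<forall>x<?n. (?A @ ?B) ! (p + x) = T ! x) \<longleftrightarrow> per_on ((!) T) 0 (j + d) p \<and> per_on ((!) T) j ?n (d - p)"
      if p: "p \<le> d" for p
    proof -
      have "(?A @ ?B) ! (p + x) = (if p + x \<le> i then T ! (p + x) else T ! (p + x - d))" if "x < ?n" for x
      proof -
        have "p + x - (i + 1) + j = p + x - d" if "\<not> p + x \<le> i" using that d by linarith
        moreover have "p + x < i + 1 + (?n - j)" using that p d j by linarith
        ultimately show ?thesis using S[of "p + x"] by simp
      qed
      then have "(\<forall>x<?n. (?A @ ?B) ! (p + x) = T ! x) \<longleftrightarrow>
         (\<forall>x<?n. (if p + x \<le> i then T ! (p + x) else T ! (p + x - d)) = T ! x)" by simp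
      also have "\<dots> \<longleftrightarrow> per_on ((!) T) 0 (j + d) p \<and> per_on ((!) T) j ?n (d - p)" (is "?L \<longleftrightarrow> ?R")
      proof
        assume L: ?L
        have "T ! x = T ! (x + p)" if "x + p < j + d" for x
          using L[rule_format, of x] that d i by (simp add: add.commute)
        moreover have "T ! x = T ! (x + (d - p))" if x: "j \<le> x" "x + (d - p) < ?n" for x
        proof -
          have "p + (x + (d - p)) = x + d" "\<not> x + d \<le> i" using x p d by linarith+
          then show ?thesis using L[rule_format, of "x + (d - p)", OF x(2)] by simp
        qed
        ultimately show ?R unfolding per_on_def by blast
      next
        assume R: ?R
        show ?L
        proof (intro allI impI)
          fix x assume x: "x < ?n"
          show "(if p + x \<le> i then T ! (p + x) else T ! (p + x - d)) = T ! x"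
          proof (cases "p + x \<le> i")
            case True
            have "x + p < j + d" using True d by linarith
            then have "T ! x = T ! (x + p)" using R per_onD[of "(!) T" 0 "j + d" p x] by blast
            then show ?thesis using True by (simp add: add.commute)
          next
            case False
            have e: "p + x - d + (d - p) = x" "j \<le> p + x - d" using False p d by linarith+
            have "T ! (p + x - d) = T ! x"
              using R per_onD[of "(!) T" j ?n "d - p" "p + x - d", OF _ e(2)] e(1) x by metis
            then show ?thesis using False by simp
          qed
        qed
      qed
      finally show ?thesis .
    qed
    moreover have "p + ?n \<le> i + 1 + (?n - j) \<longleftrightarrow> p \<le> d" for p using d j by linarith
    ultimately have "p \<in> pref_suf T i j \<longleftrightarrow> p \<in> split_set ((!) T) ?n j d" for p
      using occ[of p] unfolding split_set_def by blast
    moreover have "i + 1 - j = d" using d by linarith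
    ultimately show ?thesis using True by (simp add: set_eq_iff)
  qed
qed

text \<open>Strings are total functions on positions; \<open>weq S x y t\<close> compares two factors of length \<open>t\<close>.\<close>

definition weq :: "(nat \<Rightarrow> 'a) \<Rightarrow> nat \<Rightarrow> nat \<Rightarrow> nat \<Rightarrow> bool" where
  "weq S x y t \<longleftrightarrow> (\<forall>i<t. S (x + i) = S (y + i))"

abbreviation match :: "(nat \<Rightarrow> 'a) \<Rightarrow> nat \<Rightarrow> nat \<Rightarrow> bool" where
  "match S d l \<equiv> weq S d 0 l"

lemma weqD: "weq S x y t \<Longrightarrow> i < t \<Longrightarrow> S (x + i) = S (y + i)"
  by (simp add: weq_def)

lemma weq_mono: "weq S x y t \<Longrightarrow> t' \<le> t \<Longrightarrow> weq S x y t'"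
  by (simp add: weq_def)

lemma weq_sym: "weq S x y t \<Longrightarrow> weq S y x t"
  by (simp add: weq_def)

lemma weq_trans: "weq S x y t \<Longrightarrow> weq S y z t \<Longrightarrow> weq S x z t"
  by (simp add: weq_def)

lemma weq_shift: "weq S x y t \<Longrightarrow> a + t' \<le> t \<Longrightarrow> weq S (x + a) (y + a) t'"
  by (auto simp: weq_def add.assoc)

lemma weq_append: "weq S x y t \<Longrightarrow> weq S (x + t) (y + t) t' \<Longrightarrow> weq S x y (t + t')"
  unfolding weq_def
proof (intro allI impI)
  fix i assume *: "\<forall>i<t. S (x + i) = S (y + i)" "\<forall>i<t'. S (x + t + i) = S (y + t + i)" "i < t + t'"
  show "S (x + i) = S (y + i)"
  proof (cases "i < t")
    case False
    then have "i - t < t'" "x + t + (i - t) = x + i" "y + t + (i - t) = y + i" using *(3) by auto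
    then show ?thesis using *(2) by metis
  qed (use * in auto)
qed

lemma weq_cover:
  assumes "weq S x y t" "weq S (x + a) (y + a) t'" "a \<le> t"
  shows "weq S x y (a + t')"
  using weq_append[OF weq_mono[OF assms(1,3)] assms(2)] .

section \<open>Constant-time prefix matching from data stored per block\<close>

text \<open>\<open>rho\<close> is the shortest period of the first \<open>2 * k\<close> letters,
  with \<open>k + 1\<close> standing for none up to k. \<open>nb m\<close> is the first block from m
  on that contains a violation of this period, or \<open>NW\<close>. In the periodic case
  \<open>M\<close> includes the first violating letter, and \<open>N + 1\<close> says that there is
  none. Blocks 0 and 1 are left out, so that \<open>x - rho\<close> never truncates.\<close>

locale block_string =
  fixes S :: "nat \<Rightarrow> 'a" and N k NW rho M :: nat and nb :: "nat \<Rightarrow> nat"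
  assumes k: "1 \<le> k" "2 * k \<le> N" and NW: "NW = N div k"
    and rho: "1 \<le> rho" "rho \<le> k + 1"
    and rho_per: "rho \<le> k \<Longrightarrow> weq S rho 0 (2 * k - rho)"
    and rho_min: "\<And>q. 1 \<le> q \<Longrightarrow> q < rho \<Longrightarrow> \<not> weq S q 0 (2 * k - q)"
    and nb: "\<And>m. 2 \<le> m \<Longrightarrow> m \<le> NW \<Longrightarrow> m \<le> nb m \<and> nb m \<le> NW"
    and nb_good: "\<And>m x. 2 \<le> m \<Longrightarrow> m \<le> NW \<Longrightarrow> m * k \<le> x \<Longrightarrow> x < nb m * k \<Longrightarrow> S x = S (x - rho)"
    and nb_bad: "\<And>m. 2 \<le> m \<Longrightarrow> m \<le> NW \<Longrightarrow> nb m < NW \<Longrightarrow>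
       \<exists>x. nb m * k \<le> x \<and> x < nb m * k + k \<and> S x \<noteq> S (x - rho)"
    and M_nonper: "rho = k + 1 \<Longrightarrow> M = 2 * k"
    and M_per: "rho \<le> k \<Longrightarrow> 2 * k < M \<and> M \<le> N + 1"
    and M_good: "\<And>x. rho \<le> k \<Longrightarrow> rho \<le> x \<Longrightarrow> x + 1 < M \<Longrightarrow> S x = S (x - rho)"
    and M_bad: "rho \<le> k \<Longrightarrow> M \<le> N \<Longrightarrow> S (M - 1) \<noteq> S (M - 1 - rho)"
begin

lemma M_ge: "2 * k \<le> M"
  using rho M_nonper M_per by (cases "rho = k + 1") auto

lemma good_shift:
  assumes "rho \<le> k" "weq S x 0 (2 * k)" "2 * k \<le> b - x" "\<And>y. x + 2 * k \<le> y \<Longrightarrow> y < b \<Longrightarrow> S y = S (y - rho)"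
    and "b - x < M"
  shows "weq S x 0 (b - x)"
  unfolding weq_def
proof (intro allI impI)
  fix i assume "i < b - x"
  then show "S (x + i) = S (0 + i)"
  proof (induction i rule: less_induct)
    case (less i)
    show ?case
    proof (cases "i < 2 * k")
      case True
      then show ?thesis using assms(2) by (auto dest: weqD)
    next
      case False
      have "S (x + i) = S (x + i - rho)" using less.prems False by (intro assms(4)) auto
      also have "x + i - rho = x + (i - rho)" using False assms(1) by simp
      also have "S (x + (i - rho)) = S (0 + (i - rho))"
        using less.prems False assms(1) rho by (intro less.IH) auto
      also have "\<dots> = S i" using M_good[of i] less.prems False assms(1,5) by auto
      finally show ?thesis by simp
    qed
  qed
qed

text \<open>Let v be the last \<open>2 * k\<close> letters of the prefix of length \<open>M\<close>.
  Two occurrences at distance e below k give v the period e. Without a short \<open>rho\<close>, v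
  is the prefix of length \<open>2 * k\<close>, which has no such period. Otherwise v without its
  last letter also has period \<open>rho\<close>; going from the last letter back by e, back by
  \<open>rho\<close> and forward by e shows that it equals the letter \<open>rho\<close> before it,
  although it is the first violation.\<close>

lemma v_sparse:
  assumes "x < x'" "x' < x + k" "M \<le> N"
    and v: "weq S x (M - 2 * k) (2 * k)" "weq S x' (M - 2 * k) (2 * k)"
  shows False
proof -
  define e where "e = x' - x"
  define a where "a = M - 2 * k"
  have e: "1 \<le> e" "e < k" "x' = x + e" using assms unfolding e_def by auto
  have per: "S (a + (i + e)) = S (a + i)" if "i + e < 2 * k" for i
    using weqD[OF v(1), of "i + e"] weqD[OF v(2), of i] that e unfolding a_def by (simp add: add_ac)
  show False
  proof (cases "rho = k + 1")
    case True
    then have "a = 0" using M_nonper a_def by simp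
    have "weq S e 0 (2 * k - e)" unfolding weq_def
      using per \<open>a = 0\<close> by (auto simp: add.commute)
    then show False using rho_min[of e] e True by auto
  next
    case False
    then have r: "rho \<le> k" using rho by simp
    have M: "2 * k < M" using M_per r by simp
    have m: "M - 1 = a + (2 * k - 1)" unfolding a_def using M k by linarith
    have g: "S y = S (y - rho)" if "a \<le> y" "y < a + (2 * k - 1)" "rho \<le> y" for y
      using M_good[OF r, of y] that m by auto
    have "S (M - 1) = S (a + (2 * k - 1 - e))" using per[of "2 * k - 1 - e"] e m by auto
    also have "\<dots> = S (a + (2 * k - 1 - e) - rho)" using e r by (intro g) auto
    also have "a + (2 * k - 1 - e) - rho = a + (2 * k - 1 - e - rho)" using e r by simp
    also have "S (a + (2 * k - 1 - e - rho)) = S (a + (2 * k - 1 - e - rho + e))"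
      using e r by (intro per[symmetric]) (use rho in auto)
    also have "a + (2 * k - 1 - e - rho + e) = M - 1 - rho" using e r m by auto
    finally show False using M_bad[OF r assms(3)] by simp
  qed
qed

lemma u_v:
  assumes "weq S p 0 M" shows "weq S (p + (M - 2 * k)) (M - 2 * k) (2 * k)"
  using weq_shift[OF assms, of "M - 2 * k" "2 * k"] M_ge by simp

lemma u_sparse:
  assumes "p < p'" "M \<le> N" "weq S p 0 M" "weq S p' 0 M"
  shows "p + k \<le> p'"
proof (rule ccontr)
  assume "\<not> p + k \<le> p'"
  then have "p + (M - 2 * k) < p' + (M - 2 * k)" "p' + (M - 2 * k) < p + (M - 2 * k) + k"
    using assms(1) by linarith+
  then show False by (rule v_sparse[OF _ _ assms(2) u_v[OF assms(3)] u_v[OF assms(4)]])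
qed

text \<open>One slot per block therefore suffices to store all occurrences of the prefix of length
  \<open>M\<close>.\<close>

lemma u_block:
  assumes "p div k = p' div k" "M \<le> N" "weq S p 0 M" "weq S p' 0 M"
  shows "p = p'"
proof (rule ccontr)
  assume "p \<noteq> p'"
  moreover have False if "q < q'" "q div k = q' div k" "weq S q 0 M" "weq S q' 0 M" for q q'
  proof -
    have "(q + k) div k \<le> q' div k" by (rule div_le_mono[OF u_sparse[OF that(1) assms(2) that(3,4)]])
    then show False using that(2) k by simp
  qed
  moreover have "p < p' \<or> p' < p" using \<open>p \<noteq> p'\<close> by linarith
  ultimately show False using assms by metis
qed

text \<open>Block \<open>d div k + 2\<close> begins within the first \<open>2 * k\<close> letters of
  a match at d, yet more than k behind d, so that \<open>x - rho\<close> still falls into the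
  match.\<close>

lemma next_block: "d + k < (d div k + 2) * k" "(d div k + 2) * k \<le> d + 2 * k"
proof -
  have "d = d div k * k + d mod k" "d mod k < k" using k by simp_all
  then show "d + k < (d div k + 2) * k" "(d div k + 2) * k \<le> d + 2 * k"
    unfolding add_mult_distrib by linarith+
qed

lemma next_block_le:
  assumes "d + 2 * k \<le> N" shows "d div k + 2 \<le> NW"
proof -
  have "(d + 2 * k) div k = d div k + 2" using k by simp
  then show ?thesis using div_le_mono[OF assms, of k] unfolding NW by simp
qed

text \<open>The first \<open>2 * k\<close> letters are known to match, and beyond them both factors
  continue with period \<open>rho\<close>.\<close>

lemma nb_sound:
  assumes "rho \<le> k" "weq S d 0 (2 * k)" "d + 2 * k \<le> N" "d + l \<le> nb (d div k + 2) * k" "l < M"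
  shows "weq S d 0 l"
proof (cases "l \<le> 2 * k")
  case True
  then show ?thesis using weq_mono assms(2) by blast
next
  case False
  have "weq S d 0 (d + l - d)"
  proof (rule good_shift[OF assms(1,2)])
    fix y assume "d + 2 * k \<le> y" "y < d + l"
    then have "(d div k + 2) * k \<le> y" "y < nb (d div k + 2) * k"
      using next_block[of d] assms(4) by linarith+
    then show "S y = S (y - rho)" by (rule nb_good[OF _ next_block_le[OF assms(3)], rotated]) simp
  qed (use False assms in auto)
  then show ?thesis by simp
qed

text \<open>A violation of the period inside the match would have a copy inside a prefix shorter
  than \<open>M\<close>. The slack k is there because \<open>nb\<close> names the block of a
  violation and not its position in the block.\<close>

lemma nb_complete:
  assumes "weq S d 0 l" "2 * k \<le> l" "rho \<le> k \<Longrightarrow> l < M" "d + l \<le> N" "rho = k + 1 \<Longrightarrow> l = 2 * k - 1 \<or> l = 2 * k"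
  shows "d + l \<le> nb (d div k + 2) * k + k"
proof (rule ccontr)
  assume *: "\<not> ?thesis"
  let ?m = "d div k + 2"
  have m: "2 \<le> ?m" "?m \<le> NW" using next_block_le assms by auto
  have "?m \<le> nb ?m" using nb[OF m] by simp
  then have mk: "?m * k \<le> nb ?m * k" by (rule mult_le_mono1)
  show False
  proof (cases "rho = k + 1")
    case True
    then show False using assms(5) mk next_block[of d] * by auto
  next
    case False
    then have r: "rho \<le> k" using rho by simp
    have "nb ?m * k + k \<le> N" using * assms by simp
    then have "(nb ?m * k + k) div k \<le> NW" unfolding NW using div_le_mono by blast
    then have "nb ?m < NW" using k by simp
    then obtain x where x: "nb ?m * k \<le> x" "x < nb ?m * k + k" "S x \<noteq> S (x - rho)"
      using nb_bad[OF m] by blast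
    have xd: "d + k < x" "x < d + l" using next_block[of d] mk x * by linarith+
    have "S x = S (x - d)" using weqD[OF assms(1), of "x - d"] xd by simp
    moreover have "S (x - rho) = S (x - d - rho)" using weqD[OF assms(1), of "x - d - rho"] xd r by simp
    moreover have "S (x - d) = S (x - d - rho)" using xd r assms by (intro M_good) auto
    ultimately show False using x by simp
  qed
qed

text \<open>\<open>nb\<close> certifies all but the last k letters, and the direct comparison
  supplies these.\<close>

lemma mid_query:
  assumes "2 * k < l" "l < M" "d + l \<le> N"
  shows "weq S d 0 l \<longleftrightarrow> weq S d 0 (2 * k) \<and> d + l \<le> nb (d div k + 2) * k + k \<and> weq S (d + l - k) (l - k) k"
    (is "_ \<longleftrightarrow> ?R")
proof
  assume L: "weq S d 0 l"
  have r: "rho \<le> k" using assms rho M_nonper by (cases "rho = k + 1") auto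
  show ?R
  proof (intro conjI)
    show "weq S d 0 (2 * k)" using weq_mono[OF L] assms by simp
    show "d + l \<le> nb (d div k + 2) * k + k" by (rule nb_complete[OF L]) (use assms r in simp_all)
    show "weq S (d + l - k) (l - k) k" using weq_shift[OF L, of "l - k" k] assms by simp
  qed
next
  assume R: ?R
  have r: "rho \<le> k" using assms rho M_nonper by (cases "rho = k + 1") auto
  have "weq S d 0 (l - k)"
    by (rule nb_sound[OF r]) (use R assms in linarith)+
  from weq_cover[OF this, of "l - k" k] R assms show "weq S d 0 l" by auto
qed

text \<open>Only the first \<open>M - 1\<close> letters are periodic, which accounts for the
  additional 1. In the periodic case the run certifies \<open>M - (k + 1)\<close> letters, and the
  given occurrence of v begins no later than where they end and covers the rest.\<close>

lemma cand_check:
  assumes "M \<le> N" "p + M \<le> N" "weq S (p + (M - 2 * k)) (M - 2 * k) (2 * k)"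
  shows "weq S p 0 M \<longleftrightarrow> weq S p 0 (2 * k) \<and> p + M \<le> nb (p div k + 2) * k + k + 1"
proof (cases "rho = k + 1")
  case True
  then have M: "M = 2 * k" using M_nonper by simp
  have "p div k + 2 \<le> NW" using next_block_le assms M by auto
  then have "(p div k + 2) * k \<le> nb (p div k + 2) * k" using nb[of "p div k + 2"] by (intro mult_le_mono1) auto
  then show ?thesis using M next_block[of p] by auto
next
  case False
  then have r: "rho \<le> k" using rho by simp
  have M: "2 * k < M" using M_per r by simp
  show ?thesis
  proof
    assume L: "weq S p 0 M"
    have "p + (M - 1) \<le> nb (p div k + 2) * k + k"
      by (rule nb_complete[OF weq_mono[OF L]]) (use M assms(2) r in simp_all)
    then show "weq S p 0 (2 * k) \<and> p + M \<le> nb (p div k + 2) * k + k + 1"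
      using weq_mono[OF L, of "2 * k"] M by auto
  next
    assume R: "weq S p 0 (2 * k) \<and> p + M \<le> nb (p div k + 2) * k + k + 1"
    have "weq S p 0 (M - (k + 1))"
      by (rule nb_sound[OF r]) (use R assms(2) M k in linarith)+
    from weq_cover[OF this, of "M - 2 * k" "2 * k"] assms(3) M k show "weq S p 0 M" by auto
  qed
qed

text \<open>\<open>z\<close> is the Z-value of \<open>p\<close>, the length of its longest match
  with a prefix, rounded down to whole blocks.\<close>

definition zb_ok :: "nat \<Rightarrow> nat \<Rightarrow> bool" where
  "zb_ok p z \<longleftrightarrow> p + z * k \<le> N \<and> weq S p 0 (z * k) \<and> \<not> (p + z * k + k \<le> N \<and> weq S p 0 (z * k + k))"

lemma zb_ok_le:
  assumes "zb_ok p z" "weq S p 0 l" "p + l \<le> N"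
  shows "l < z * k + k"
proof (rule ccontr)
  assume "\<not> ?thesis"
  then show False using assms weq_mono[OF assms(2), of "z * k + k"] unfolding zb_ok_def by auto
qed

text \<open>Position 0 is excluded because 0 marks an empty slot of \<open>pos\<close>.\<close>

definition cand :: "nat \<Rightarrow> bool" where
  "cand p \<longleftrightarrow> 1 \<le> p \<and> p + M \<le> N \<and> weq S p 0 M"

lemma cand_block: "cand p \<Longrightarrow> cand p' \<Longrightarrow> p div k = p' div k \<Longrightarrow> p = p'"
  unfolding cand_def by (rule u_block) simp_all

text \<open>The state of a sweep from left to right with frontier \<open>b\<close>. Candidates are
  ordered by the position where their trailing \<open>2 * k\<close> letters begin, since these
  letters are what the sweep detects.\<close>

definition list_ok :: "(nat \<Rightarrow> nat) \<Rightarrow> (nat \<Rightarrow> nat) \<Rightarrow> nat \<Rightarrow> bool" where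
  "list_ok pos zb b \<longleftrightarrow>
     (\<forall>e\<le>NW. pos e \<noteq> 0 \<longrightarrow> pos e div k = e \<and> cand (pos e) \<and> zb_ok (pos e) (zb e) \<and> pos e + (M - 2 * k) < b) \<and>
     (\<forall>p. cand p \<longrightarrow> p + (M - 2 * k) < b \<longrightarrow> pos (p div k) = p)"

lemma list_okD:
  assumes "list_ok pos zb b" "e \<le> NW" "pos e \<noteq> 0"
  shows "pos e div k = e" "cand (pos e)" "zb_ok (pos e) (zb e)" "pos e + (M - 2 * k) < b"
  using assms unfolding list_ok_def by blast+

lemma list_ok_pos: "list_ok pos zb b \<Longrightarrow> cand p \<Longrightarrow> p + (M - 2 * k) < b \<Longrightarrow> pos (p div k) = p"
  unfolding list_ok_def by blast

lemma list_ok_insert: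
  assumes "list_ok pos zb b" "cand p" "zb_ok p z" "p + (M - 2 * k) < b'"
    "b \<le> b'" "\<And>q. cand q \<Longrightarrow> q + (M - 2 * k) < b' \<Longrightarrow> b \<le> q + (M - 2 * k) \<Longrightarrow> q = p"
  shows "list_ok (pos(p div k := p)) (zb(p div k := z)) b'"
proof -
  let ?pos = "pos(p div k := p)" and ?zb = "zb(p div k := z)"
  have "?pos e div k = e \<and> cand (?pos e) \<and> zb_ok (?pos e) (?zb e) \<and> ?pos e + (M - 2 * k) < b'"
    if "e \<le> NW" "?pos e \<noteq> 0" for e
  proof (cases "e = p div k")
    case True
    then show ?thesis using assms(2-4) by simp
  next
    case False
    then have "pos e div k = e \<and> cand (pos e) \<and> zb_ok (pos e) (zb e) \<and> pos e + (M - 2 * k) < b"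
      using that assms(1) unfolding list_ok_def by simp
    then show ?thesis using False assms(5) by simp
  qed
  moreover have "?pos (q div k) = q" if q: "cand q" "q + (M - 2 * k) < b'" for q
  proof (cases "q = p")
    case False
    then have "q + (M - 2 * k) < b" using assms(6)[OF q] by linarith
    then have "pos (q div k) = q" using assms(1) q unfolding list_ok_def by blast
    moreover have "q div k \<noteq> p div k" using cand_block[OF q(1) assms(2)] False by blast
    ultimately show ?thesis by simp
  qed simp
  ultimately show ?thesis unfolding list_ok_def by blast
qed

lemma list_ok_extend:
  assumes "list_ok pos zb b" "b \<le> b'" "\<And>q. cand q \<Longrightarrow> q + (M - 2 * k) < b' \<Longrightarrow> \<not> b \<le> q + (M - 2 * k)"
  shows "list_ok pos zb b'"
  unfolding list_ok_def
proof (intro conjI allI impI)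
  fix e assume e: "e \<le> NW" "pos e \<noteq> 0"
  show "pos e div k = e" "cand (pos e)" "zb_ok (pos e) (zb e)" "pos e + (M - 2 * k) < b'"
    using list_okD[OF assms(1) e] assms(2) by simp_all
next
  fix q assume q: "cand q" "q + (M - 2 * k) < b'"
  then have "q + (M - 2 * k) < b" using assms(3) by force
  then show "pos (q div k) = q" by (rule list_ok_pos[OF assms(1) q(1)])
qed

text \<open>A match of at least \<open>M\<close> letters starts at a stored candidate. Its rounded
  Z-value decides the query up to one block, and the comparison of the last k letters settles the
  rest.\<close>

lemma long_query:
  assumes "list_ok pos zb b" "N \<le> b" "1 \<le> d" "M \<le> l" "d + l \<le> N"
  shows "weq S d 0 l \<longleftrightarrow> pos (d div k) = d \<and> l \<le> zb (d div k) * k + k \<and> weq S (d + l - k) (l - k) k"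
    (is "_ \<longleftrightarrow> ?R")
proof -
  have dk: "d div k \<le> NW" unfolding NW using assms by (intro div_le_mono) auto
  have lk: "k \<le> l" using M_ge assms k by linarith
  show ?thesis
  proof
    assume L: "weq S d 0 l"
    have c: "cand d" using L assms weq_mono unfolding cand_def by auto
    then have "d + (M - 2 * k) < b" using assms k M_ge unfolding cand_def by linarith
    then have pos: "pos (d div k) = d" by (rule list_ok_pos[OF assms(1) c])
    then have "zb_ok d (zb (d div k))" using list_okD(3)[OF assms(1) dk] assms(3) by simp
    from zb_ok_le[OF this L assms(5)] show ?R
      using pos weq_shift[OF L, of "l - k" k] lk by auto
  next
    assume R: ?R
    then have "zb_ok d (zb (d div k))" using list_okD(3)[OF assms(1) dk] assms(3) by simp
    then have "weq S d 0 (zb (d div k) * k)" unfolding zb_ok_def by simp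
    from weq_cover[OF this, of "l - k" k] R lk show "weq S d 0 l" by auto
  qed
qed

text \<open>The two cases of the Z-algorithm, for a box \<open>[l, l + zl * k)\<close>.\<close>

lemma z_copy:
  assumes "zb_ok l zl" "l < p" "zb_ok (p - l) z" "p - l + z * k + k \<le> zl * k"
  shows "zb_ok p z"
proof -
  have b: "weq S l 0 (zl * k)" "l + zl * k \<le> N" using assms(1) unfolding zb_ok_def by auto
  have eq: "weq S p (p - l) (z * k + k)"
    using weq_shift[OF b(1), of "p - l" "z * k + k"] assms by simp
  have "p - l + z * k + k \<le> N" using assms(4) b(2) by linarith
  then have z: "weq S (p - l) 0 (z * k)" "\<not> weq S (p - l) 0 (z * k + k)"
    using assms(3) unfolding zb_ok_def by simp_all
  have "weq S p 0 (z * k)" using weq_trans[OF weq_mono[OF eq] z(1)] by simp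
  moreover have "\<not> weq S p 0 (z * k + k)" using z(2) weq_trans[OF weq_sym[OF eq]] by blast
  moreover have "p + z * k \<le> N" using assms(2,4) b(2) by linarith
  ultimately show ?thesis unfolding zb_ok_def by blast
qed

lemma z_start:
  assumes "zb_ok l zl" "l < p" "p < l + zl * k" "cand p"
    and "cand (p - l) \<longrightarrow> (\<exists>z. zb_ok (p - l) z \<and> \<not> p - l + z * k + k \<le> zl * k)"
  shows "weq S p 0 ((l + zl * k - p) div k * k)"
proof -
  let ?t = "l + zl * k - p"
  have b: "weq S l 0 (zl * k)" "l + zl * k \<le> N" using assms(1) unfolding zb_ok_def by auto
  have eq: "weq S p (p - l) ?t"
    using weq_shift[OF b(1), of "p - l" ?t] assms by simp
  have tk: "?t div k * k \<le> ?t" by simp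
  show ?thesis
  \<comment> \<open>If the box reaches at most \<open>M\<close> letters beyond p, candidacy alone
    gives the match. Otherwise the copy \<open>p - l\<close> is a candidate too, and its Z-value
    extends to within one block of the end of the box, which covers the rounded-down
    remainder.\<close>
  proof (cases "?t \<le> M")
    case True
    then show ?thesis using assms(4) weq_mono[OF _ le_trans[OF tk]] unfolding cand_def by blast
  next
    case False
    then have "M \<le> ?t" by simp
    then have "weq S (p - l) p M" using weq_sym[OF weq_mono[OF eq]] by blast
    then have "weq S (p - l) 0 M" using assms(4) weq_trans unfolding cand_def by blast
    moreover have "1 \<le> p - l" "p - l + M \<le> N" using assms(2,4) unfolding cand_def by linarith+
    ultimately have "cand (p - l)" unfolding cand_def by blast
    then obtain z where z: "zb_ok (p - l) z" "\<not> p - l + z * k + k \<le> zl * k" using assms(5) by blast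
    have "?t div k * k < z * k + k" using z(2) tk assms by linarith
    then have "?t div k * k < (z + 1) * k" by simp
    then have "?t div k < z + 1" unfolding mult_less_cancel2 by blast
    then have "?t div k * k \<le> z * k" by (intro mult_le_mono1) simp
    then have "weq S (p - l) 0 (?t div k * k)"
      by (rule weq_mono[rotated]) (use z in \<open>simp add: zb_ok_def\<close>)
    then show ?thesis by (rule weq_trans[OF weq_mono[OF eq tk]])
  qed
qed

end

section \<open>Packed words as numbers in base \<open>2 ^ c\<close>\<close>

definition code :: "nat \<Rightarrow> (nat \<Rightarrow> nat) \<Rightarrow> nat \<Rightarrow> nat" where
  "code c f t = (\<Sum>i<t. f i * 2 ^ (c * i))"

lemma code_0 [simp]: "code c f 0 = 0"
  by (simp add: code_def)

lemma code_Suc: "code c f (Suc t) = code c f t + f t * 2 ^ (c * t)"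
  by (simp add: code_def)

lemma code_cong: "(\<And>i. i < t \<Longrightarrow> f i = g i) \<Longrightarrow> code c f t = code c g t"
  by (simp add: code_def)

lemma code_add: "code c f (a + t) = code c f a + 2 ^ (c * a) * code c (\<lambda>i. f (a + i)) t"
  by (induction t) (simp_all add: code_Suc algebra_simps power_add)

lemma code_less: "(\<And>i. i < t \<Longrightarrow> f i < 2 ^ c) \<Longrightarrow> code c f t < 2 ^ (c * t)"
proof (induction t)
  case (Suc t)
  have "code c f t + f t * 2 ^ (c * t) < (f t + 1) * 2 ^ (c * t)" using Suc by simp
  also have "\<dots> \<le> 2 ^ c * 2 ^ (c * t)" using Suc.prems[of t] by (intro mult_le_mono1) simp
  finally show ?case by (simp add: code_Suc power_add)
qed simp

lemma code_take:
  assumes "\<And>i. i < t \<Longrightarrow> f i < 2 ^ c" "a \<le> t"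
  shows "code c f t mod 2 ^ (c * a) = code c f a"
proof -
  have "code c f a < 2 ^ (c * a)" using assms by (intro code_less) auto
  moreover have "code c f t = code c f a + 2 ^ (c * a) * code c (\<lambda>i. f (a + i)) (t - a)"
    using code_add[of c f a "t - a"] assms by simp
  ultimately show ?thesis by simp
qed

lemma code_drop:
  assumes "\<And>i. i < t \<Longrightarrow> f i < 2 ^ c" "a \<le> t"
  shows "code c f t div 2 ^ (c * a) = code c (\<lambda>i. f (a + i)) (t - a)"
proof -
  have "code c f a < 2 ^ (c * a)" using assms by (intro code_less) auto
  moreover have "code c f t = code c f a + 2 ^ (c * a) * code c (\<lambda>i. f (a + i)) (t - a)"
    using code_add[of c f a "t - a"] assms by simp
  ultimately show ?thesis by simp
qed

lemma code_factor:
  assumes "\<And>i. i < t \<Longrightarrow> f i < 2 ^ c" "a + l \<le> t"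
  shows "code c f t div 2 ^ (c * a) mod 2 ^ (c * l) = code c (\<lambda>i. f (a + i)) l"
  using assms by (subst code_drop) (auto intro!: code_take)

lemma code_eq_iff:
  assumes "\<And>i. i < t \<Longrightarrow> f i < 2 ^ c" "\<And>i. i < t \<Longrightarrow> g i < 2 ^ c"
  shows "code c f t = code c g t \<longleftrightarrow> (\<forall>i<t. f i = g i)"
proof
  assume eq: "code c f t = code c g t"
  show "\<forall>i<t. f i = g i"
  proof (intro allI impI)
    fix i assume i: "i < t"
    have "code c (\<lambda>j. f (i + j)) 1 = code c (\<lambda>j. g (i + j)) 1"
      using code_factor[of t f c i 1] code_factor[of t g c i 1] eq assms i by simp
    then show "f i = g i" by (simp add: code_def)
  qed
qed (auto intro: code_cong)

lemma div_mod_swap: "(x::nat) div 2 ^ a mod 2 ^ l = x mod 2 ^ (a + l) div 2 ^ a"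
  by (metis add_diff_cancel_left' le_add1 drop_bit_eq_div take_bit_eq_mod drop_bit_take_bit)

lemma mod_div_mod: "a + l \<le> e \<Longrightarrow> (x::nat) mod 2 ^ e div 2 ^ a mod 2 ^ l = x div 2 ^ a mod 2 ^ l"
  unfolding div_mod_swap by (simp add: mod_mod_cancel le_imp_power_dvd)

lemma mod_div_pow: "a \<le> e \<Longrightarrow> (x::nat) mod 2 ^ e div 2 ^ a = x div 2 ^ a mod 2 ^ (e - a)"
  unfolding div_mod_swap by simp

lemma mod_mod_pow: "a \<le> b \<Longrightarrow> (x::nat) mod 2 ^ b mod 2 ^ a = x mod 2 ^ a"
  by (simp add: mod_mod_cancel le_imp_power_dvd)

lemma digits_code:
  "x < 2 ^ (c * t) \<Longrightarrow> code c (\<lambda>i. x div 2 ^ (c * i) mod 2 ^ c) t = x"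
proof (induction t arbitrary: x)
  case (Suc t)
  let ?y = "x mod 2 ^ (c * t)"
  have "code c (\<lambda>i. x div 2 ^ (c * i) mod 2 ^ c) t = code c (\<lambda>i. ?y div 2 ^ (c * i) mod 2 ^ c) t"
  proof (rule code_cong)
    fix i assume "i < t"
    then have "c * i + c \<le> c * t" by (metis Suc_leI mult_Suc_right mult_le_mono2 add.commute)
    then show "x div 2 ^ (c * i) mod 2 ^ c = ?y div 2 ^ (c * i) mod 2 ^ c"
      by (simp add: mod_div_mod)
  qed
  also have "\<dots> = ?y" by (rule Suc.IH) simp
  finally have 1: "code c (\<lambda>i. x div 2 ^ (c * i) mod 2 ^ c) t = ?y" .
  have "x div 2 ^ (c * t) < 2 ^ c"
    using Suc.prems by (intro less_mult_imp_div_less) (simp add: power_add mult.commute)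
  then show ?case using 1 mod_div_mult_eq[of x "2 ^ (c * t)"] by (simp add: code_Suc)
qed simp

lemma code_div:
  assumes "a \<le> t" "\<And>i. i < t \<Longrightarrow> f i < 2 ^ c"
  shows "code c f t div 2 ^ (c * a) mod 2 ^ c = (if a < t then f a else 0)"
proof (cases "a < t")
  case True
  then show ?thesis using code_factor[of t f c a 1] assms(2) by (simp add: code_def)
next
  case False
  then show ?thesis using code_less[of t f c] assms by simp
qed

text \<open>Two adjacent words suffice for a factor of at most one word's length: later words
  contribute a multiple of 2 to the power \<open>w + (w - off)\<close>, which vanishes modulo
  \<open>2 ^ t'\<close>.\<close>

lemma stream_read:
  assumes "\<And>i. M i < 2 ^ w" "q + 1 < Q" "t' \<le> w" "off \<le> w"
  shows "(M q div 2 ^ off + M (q + 1) * 2 ^ (w - off)) mod 2 ^ t'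
     = code w M Q div 2 ^ (w * q + off) mod 2 ^ t'"
proof -
  obtain r where "code w M Q div 2 ^ (w * q) = M q + 2 ^ w * (M (q + 1) + 2 ^ w * r)"
  proof -
    have "Q - q = 1 + (1 + (Q - q - 2))" using assms by simp
    then have "code w (\<lambda>i. M (q + i)) (Q - q) = code w (\<lambda>i. M (q + i)) (1 + (1 + (Q - q - 2)))" by simp
    then have "code w (\<lambda>i. M (q + i)) (Q - q) = M q + 2 ^ w * (M (q + 1) + 2 ^ w * code w (\<lambda>i. M (q + (1 + (1 + i)))) (Q - q - 2))"
      unfolding code_add[of w _ 1] by (simp add: code_def)
    then show ?thesis using that code_drop[of Q M w q] assms by simp
  qed
  then have "code w M Q div 2 ^ (w * q + off) = (M q + 2 ^ off * (2 ^ (w - off) * (M (q + 1) + 2 ^ w * r))) div 2 ^ off"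
  proof -
    have "code w M Q div 2 ^ (w * q + off) = code w M Q div 2 ^ (w * q) div 2 ^ off"
      by (simp add: power_add div_mult2_eq)
    moreover have "(2::nat) ^ w = 2 ^ off * 2 ^ (w - off)" using assms(4) by (simp flip: power_add)
    ultimately show ?thesis using \<open>code w M Q div 2 ^ (w * q) = _\<close> by (simp only: mult.assoc)
  qed
  also have "\<dots> = M q div 2 ^ off + 2 ^ (w - off) * (M (q + 1) + 2 ^ w * r)"
    by simp
  also have "\<dots> = M q div 2 ^ off + M (q + 1) * 2 ^ (w - off) + 2 ^ t' * (2 ^ (w - t') * 2 ^ (w - off) * r)"
    using assms(3) by (simp add: algebra_simps flip: power_add)
  finally show ?thesis by simp
qed

text \<open>A prefix of the memory is read as one long number. Words beyond the input are arbitrary,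
  but they disappear modulo \<open>2 ^ (b * n)\<close>.\<close>

lemma code_packed_prefix:
  assumes "length T = n" "\<And>i. i < n \<Longrightarrow> T ! i < 2 ^ b" "\<And>i. M i < 2 ^ w"
    and M: "\<And>q. q * w < n * b \<Longrightarrow> M q = code b ((!) T) n div 2 ^ (w * q) mod 2 ^ w"
    and "n * b \<le> w * Q" "x < n"
  shows "code w M Q div 2 ^ (b * x) mod 2 ^ b = T ! x"
proof -
  let ?U = "code b ((!) T) n"
  have U: "?U < 2 ^ (b * n)" using assms(2) by (intro code_less) auto
  have "code w M Q mod 2 ^ (b * n) = code w (\<lambda>q. ?U div 2 ^ (w * q) mod 2 ^ w) Q mod 2 ^ (b * n)"
    using assms(5)
  proof -
    have "code w M q mod 2 ^ (b * n) = code w (\<lambda>q. ?U div 2 ^ (w * q) mod 2 ^ w) q mod 2 ^ (b * n)" for q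
    proof (induction q)
      case (Suc q)
      have "M q * 2 ^ (w * q) mod 2 ^ (b * n) = (?U div 2 ^ (w * q) mod 2 ^ w) * 2 ^ (w * q) mod 2 ^ (b * n)"
      proof (cases "q * w < n * b")
        case True
        then show ?thesis using M by simp
      next
        case False
        then have "(2::nat) ^ (b * n) dvd 2 ^ (w * q)" by (intro le_imp_power_dvd) (simp add: mult.commute)
        then show ?thesis by simp
      qed
      then show ?case using Suc unfolding code_Suc by (metis mod_add_cong)
    qed simp
    then show ?thesis .
  qed
  also have "code w (\<lambda>q. ?U div 2 ^ (w * q) mod 2 ^ w) Q = ?U"
  proof (rule digits_code)
    show "?U < 2 ^ (w * Q)"
      using U assms(5) by (elim less_le_trans) (intro power_increasing, auto simp: mult.commute)
  qed
  finally have eq: "code w M Q mod 2 ^ (b * n) = ?U" using U by simp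
  have "b * x + b \<le> b * n" using assms(6) by (metis Suc_leI mult_Suc_right mult_le_mono2 add.commute)
  then have "code w M Q div 2 ^ (b * x) mod 2 ^ b = ?U div 2 ^ (b * x) mod 2 ^ b"
    using mod_div_mod[of "b * x" b "b * n" "code w M Q"] eq by simp
  then show ?thesis using code_div[of x n "(!) T" b] assms(2,6) by simp
qed

lemma packed_word_code: "packed_word w b T q = code b ((!) T) (length T) div 2 ^ (w * q) mod 2 ^ w"
  by (simp add: packed_word_def code_def)

text \<open>Letter \<open>y\<close> of the string over \<open>c\<close>-bit letters obtained by cutting every \<open>b\<close>-bit letter into
  \<open>s\<close> pieces.\<close>

definition piece :: "nat \<Rightarrow> nat \<Rightarrow> nat list \<Rightarrow> nat \<Rightarrow> nat" where
  "piece s c T y = T ! (y div s) div 2 ^ (c * (y mod s)) mod 2 ^ c"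

lemma nth_eq_pieces:
  assumes "T ! x < 2 ^ (c * s)" "T ! y < 2 ^ (c * s)"
  shows "T ! x = T ! y \<longleftrightarrow> (\<forall>j<s. piece s c T (x * s + j) = piece s c T (y * s + j))"
proof
  assume *: "\<forall>j<s. piece s c T (x * s + j) = piece s c T (y * s + j)"
  have p: "piece s c T (z * s + j) = T ! z div 2 ^ (c * j) mod 2 ^ c" if "j < s" for z j
    using that by (simp add: piece_def)
  have "T ! x = code c (\<lambda>j. T ! x div 2 ^ (c * j) mod 2 ^ c) s" using digits_code[OF assms(1)] by simp
  also have "\<dots> = code c (\<lambda>j. T ! y div 2 ^ (c * j) mod 2 ^ c) s"
    using * p by (intro code_cong) metis
  also have "\<dots> = T ! y" using digits_code[OF assms(2)] by simp
  finally show "T ! x = T ! y" .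
qed (simp add: piece_def)

lemma all_pieces:
  assumes "0 < s" shows "(\<forall>x<l. \<forall>j<s. P (x * s + j)) \<longleftrightarrow> (\<forall>y<l * s. P (y::nat))"
proof
  assume *: "\<forall>x<l. \<forall>j<s. P (x * s + j)"
  show "\<forall>y<l * s. P y"
  proof (intro allI impI)
    fix y assume "y < l * s"
    then have "y div s < l" "y mod s < s" using assms by (auto simp: less_mult_imp_div_less)
    then have "P (y div s * s + y mod s)" using * by blast
    then show "P y" by simp
  qed
next
  assume *: "\<forall>y<l * s. P y"
  show "\<forall>x<l. \<forall>j<s. P (x * s + j)"
  proof (intro allI impI)
    fix x j assume "x < l" "j < s"
    then have "x * s + j < (x + 1) * s" "(x + 1) * s \<le> l * s" by (simp, intro mult_le_mono1, simp)
    then show "P (x * s + j)" using * by simp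
  qed
qed

lemma match_pieces:
  assumes T: "\<And>x. x < length T \<Longrightarrow> T ! x < 2 ^ (c * s)" and "0 < s" "d + l \<le> length T"
    and S: "\<And>y. y < length T * s \<Longrightarrow> S y = piece s c T y"
  shows "weq S (d * s) 0 (l * s) \<longleftrightarrow> (\<forall>x<l. T ! (d + x) = T ! x)"
proof -
  have "(\<forall>x<l. T ! (d + x) = T ! x) \<longleftrightarrow> (\<forall>x<l. \<forall>j<s. S (d * s + (x * s + j)) = S (x * s + j))"
  proof (intro all_cong1 imp_cong refl)
    fix x assume x: "x < l"
    have "T ! (d + x) = T ! x \<longleftrightarrow> (\<forall>j<s. piece s c T ((d + x) * s + j) = piece s c T (x * s + j))"
      using x assms by (intro nth_eq_pieces) auto
    also have "\<dots> \<longleftrightarrow> (\<forall>j<s. S (d * s + (x * s + j)) = S (x * s + j))"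
    proof (intro all_cong1 imp_cong refl)
      fix j assume "j < s"
      moreover have "(d + x + 1) * s \<le> length T * s" "(x + 1) * s \<le> length T * s"
        using x assms by (intro mult_le_mono1, simp)+
      ultimately have "(d + x) * s + j < length T * s" "x * s + j < length T * s" by (auto simp: algebra_simps)
      then show "piece s c T ((d + x) * s + j) = piece s c T (x * s + j) \<longleftrightarrow> S (d * s + (x * s + j)) = S (x * s + j)"
        using S[of "(d + x) * s + j"] S[of "x * s + j"] by (simp add: algebra_simps)
    qed
    finally show "T ! (d + x) = T ! x \<longleftrightarrow> (\<forall>j<s. S (d * s + (x * s + j)) = S (x * s + j))" .
  qed
  also have "\<dots> \<longleftrightarrow> weq S (d * s) 0 (l * s)"
    unfolding weq_def using all_pieces[OF assms(2), of l "\<lambda>y. S (d * s + y) = S y"] by simp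
  finally show ?thesis ..
qed

text \<open>Reversing the sequence of pieces reverses them inside each letter as well. Substituting
  \<open>s - 1 - j\<close> for j absorbs this, so that letters are still compared as wholes.\<close>

lemma match_pieces_rev:
  assumes T: "\<And>x. x < length T \<Longrightarrow> T ! x < 2 ^ (c * s)" and "0 < s" "d + l \<le> length T"
    and S: "\<And>y. y < length T * s \<Longrightarrow> S y = piece s c T (length T * s - 1 - y)"
  shows "weq S (d * s) 0 (l * s) \<longleftrightarrow> (\<forall>x<l. T ! (length T - 1 - (d + x)) = T ! (length T - 1 - x))"
proof -
  let ?n = "length T"
  have idx: "?n * s - 1 - (y * s + j) = (?n - 1 - y) * s + (s - 1 - j)" if "y < ?n" "j < s" for y j
  proof -
    obtain m where m: "?n = y + 1 + m" using \<open>y < ?n\<close> by (metis Suc_eq_plus1 add.commute less_iff_Suc_add add_Suc)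
    obtain i where i: "s = j + 1 + i" using \<open>j < s\<close> by (metis Suc_eq_plus1 add.commute less_iff_Suc_add add_Suc)
    have "?n * s = y * s + s + m * s" using m by (simp add: algebra_simps)
    then show ?thesis using m i by simp
  qed
  have "(\<forall>x<l. T ! (?n - 1 - (d + x)) = T ! (?n - 1 - x)) \<longleftrightarrow> (\<forall>x<l. \<forall>j<s. S (d * s + (x * s + j)) = S (x * s + j))"
  proof (intro all_cong1 imp_cong refl)
    fix x assume x: "x < l"
    have "T ! (?n - 1 - (d + x)) = T ! (?n - 1 - x) \<longleftrightarrow>
       (\<forall>j<s. piece s c T ((?n - 1 - (d + x)) * s + j) = piece s c T ((?n - 1 - x) * s + j))"
      using x assms by (intro nth_eq_pieces) auto
    also have "\<dots> \<longleftrightarrow> (\<forall>j<s. piece s c T ((?n - 1 - (d + x)) * s + (s - 1 - j)) = piece s c T ((?n - 1 - x) * s + (s - 1 - j)))"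
    proof (intro iffI allI impI)
      fix j assume *: "\<forall>j<s. piece s c T ((?n - 1 - (d + x)) * s + (s - 1 - j)) = piece s c T ((?n - 1 - x) * s + (s - 1 - j))" "j < s"
      then have "s - 1 - (s - 1 - j) = j" "s - 1 - j < s" by auto
      then show "piece s c T ((?n - 1 - (d + x)) * s + j) = piece s c T ((?n - 1 - x) * s + j)" using * by metis
    next
      fix j assume *: "\<forall>j<s. piece s c T ((?n - 1 - (d + x)) * s + j) = piece s c T ((?n - 1 - x) * s + j)" "j < s"
      then have "s - 1 - j < s" by auto
      then show "piece s c T ((?n - 1 - (d + x)) * s + (s - 1 - j)) = piece s c T ((?n - 1 - x) * s + (s - 1 - j))"
        using *(1) by blast
    qed
    also have "\<dots> \<longleftrightarrow> (\<forall>j<s. S (d * s + (x * s + j)) = S (x * s + j))"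
    proof (intro all_cong1 imp_cong refl)
      fix j assume j: "j < s"
      have "(d + x + 1) * s \<le> ?n * s" "(x + 1) * s \<le> ?n * s"
        using x assms by (intro mult_le_mono1, simp)+
      then have "(d + x) * s + j < ?n * s" "x * s + j < ?n * s" using j by (auto simp: algebra_simps)
      then show "piece s c T ((?n - 1 - (d + x)) * s + (s - 1 - j)) = piece s c T ((?n - 1 - x) * s + (s - 1 - j))
         \<longleftrightarrow> S (d * s + (x * s + j)) = S (x * s + j)"
      proof -
        have "d * s + (x * s + j) = (d + x) * s + j" by (simp add: algebra_simps)
        moreover have "d + x < ?n" "x < ?n" using x assms(3) by auto
        ultimately show ?thesis
          by (simp only: S[OF \<open>(d + x) * s + j < _\<close>] S[OF \<open>x * s + j < _\<close>] idx j)
      qed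
    qed
    finally show "T ! (?n - 1 - (d + x)) = T ! (?n - 1 - x) \<longleftrightarrow> (\<forall>j<s. S (d * s + (x * s + j)) = S (x * s + j))" .
  qed
  also have "\<dots> \<longleftrightarrow> weq S (d * s) 0 (l * s)"
    unfolding weq_def using all_pieces[OF assms(2), of l "\<lambda>y. S (d * s + y) = S y"] by simp
  finally show ?thesis ..
qed

lemma wp_SqI: "wp w c R s T \<Longrightarrow> (\<And>s' T'. R s' T' \<Longrightarrow> wp w d Q s' T') \<Longrightarrow> wp w (Sq c d) Q s T"
  unfolding wp_Sq_eq by (erule wp_mono)

section \<open>Register layout, windows, and reading a factor in constant time\<close>

text \<open>The arguments of the preprocessing arrive in registers 0, 1 and 2. Registers from
  \<open>RA\<close> to \<open>Rtab\<close> hold base addresses: of the blocks, the windows,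
  \<open>nb\<close>, \<open>pos\<close>, \<open>zb\<close> and the lookup table.\<close>

abbreviation (input) Rn :: nat where "Rn \<equiv> 0"
abbreviation (input) Rb :: nat where "Rb \<equiv> 1"
abbreviation (input) Rw :: nat where "Rw \<equiv> 2"
abbreviation (input) Rk :: nat where "Rk \<equiv> 3"
abbreviation (input) Rc :: nat where "Rc \<equiv> 4"
abbreviation (input) Rs :: nat where "Rs \<equiv> 5"
abbreviation (input) RN :: nat where "RN \<equiv> 6"
abbreviation (input) RNW :: nat where "RNW \<equiv> 7"
abbreviation (input) RM :: nat where "RM \<equiv> 8"
abbreviation (input) Rrho :: nat where "Rrho \<equiv> 9"
abbreviation (input) RA :: nat where "RA \<equiv> 10"
abbreviation (input) RW :: nat where "RW \<equiv> 11"
abbreviation (input) Rnb :: nat where "Rnb \<equiv> 12"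
abbreviation (input) Rpos :: nat where "Rpos \<equiv> 13"
abbreviation (input) Rzb :: nat where "Rzb \<equiv> 14"
abbreviation (input) Rtab :: nat where "Rtab \<equiv> 15"

abbreviation (input) add_exp (infixl "\<oplus>" 65) where "a \<oplus> b \<equiv> Op Add a b"
abbreviation (input) sub_exp (infixl "\<ominus>" 65) where "a \<ominus> b \<equiv> Op Sub a b"
abbreviation (input) mul_exp (infixl "\<otimes>" 70) where "a \<otimes> b \<equiv> Op Mul a b"
abbreviation (input) lt_exp (infix "\<lless>" 50) where "a \<lless> b \<equiv> Op Lt a b"
abbreviation (input) eq_exp (infix "\<doteq>" 50) where "a \<doteq> b \<equiv> Op Eq a b"

lemma bv_bool [simp]: "0 < w \<Longrightarrow> binop_val w Mul (of_bool P) (of_bool Q) = of_bool (P \<and> Q)"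
  by (cases P; cases Q) (simp_all add: binop_val.simps)

lemma bv_shl1: "y < w \<Longrightarrow> binop_val w Shl (Suc 0) y = 2 ^ y"
  by (simp add: binop_val.simps)

text \<open>Windows of the reversed string are stored big-endian, so that they are factors of the packed
  original.\<close>

definition wcode :: "bool \<Rightarrow> nat \<Rightarrow> (nat \<Rightarrow> nat) \<Rightarrow> nat \<Rightarrow> nat \<Rightarrow> nat" where
  "wcode rv c S x t = (if rv then code c (\<lambda>i. S (x + t - 1 - i)) t else code c (\<lambda>i. S (x + i)) t)"

lemma wcode_eq_iff:
  assumes "\<And>x. S x < 2 ^ c"
  shows "wcode rv c S x t = wcode rv c S y t \<longleftrightarrow> weq S x y t"
proof (cases rv)
  case True
  have "(\<forall>i<t. S (x + t - 1 - i) = S (y + t - 1 - i)) \<longleftrightarrow> (\<forall>i<t. S (x + i) = S (y + i))"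
  proof (intro iffI allI impI)
    fix i assume *: "\<forall>i<t. S (x + t - 1 - i) = S (y + t - 1 - i)" "i < t"
    have "t - 1 - i < t" "x + t - 1 - (t - 1 - i) = x + i" "y + t - 1 - (t - 1 - i) = y + i"
      using *(2) by auto
    then show "S (x + i) = S (y + i)" using *(1) by metis
  next
    fix i assume *: "\<forall>i<t. S (x + i) = S (y + i)" "i < t"
    have "t - 1 - i < t" "x + (t - 1 - i) = x + t - 1 - i" "y + (t - 1 - i) = y + t - 1 - i"
      using *(2) by auto
    then show "S (x + t - 1 - i) = S (y + t - 1 - i)" using *(1) by metis
  qed
  then show ?thesis using True assms by (simp add: wcode_def weq_def code_eq_iff)
next
  case False
  then show ?thesis using assms by (simp add: wcode_def weq_def code_eq_iff)
qed

lemma wcode_less: "(\<And>x. S x < 2 ^ c) \<Longrightarrow> wcode rv c S x t < 2 ^ (c * t)"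
  by (simp add: wcode_def code_less)

text \<open>In a window of the reversed string, stored big-endian, offsets count from the other
  end.\<close>

definition subw :: "bool \<Rightarrow> nat \<Rightarrow> nat \<Rightarrow> nat \<Rightarrow> nat \<Rightarrow> nat \<Rightarrow> nat" where
  "subw rv c K y a t = y div 2 ^ (c * (if rv then K - a - t else a)) mod 2 ^ (c * t)"

lemma subw_wcode:
  assumes "\<And>x. S x < 2 ^ c" "a + t \<le> K"
  shows "subw rv c K (wcode rv c S x K) a t = wcode rv c S (x + a) t"
proof (cases rv)
  case True
  have "subw rv c K (wcode rv c S x K) a t = code c (\<lambda>i. S (x + K - 1 - (K - a - t + i))) t"
    using True assms code_factor[of K "\<lambda>i. S (x + K - 1 - i)" c "K - a - t" t]
    by (simp add: subw_def wcode_def)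
  also have "\<dots> = code c (\<lambda>i. S (x + a + t - 1 - i)) t"
  proof (rule code_cong)
    fix i assume "i < t"
    then have "x + K - 1 - (K - a - t + i) = x + a + t - 1 - i" using assms by linarith
    then show "S (x + K - 1 - (K - a - t + i)) = S (x + a + t - 1 - i)" by simp
  qed
  finally show ?thesis using True by (simp add: wcode_def)
next
  case False
  then show ?thesis using assms code_factor[of K "\<lambda>i. S (x + i)" c a t]
    by (simp add: subw_def wcode_def add.assoc)
qed

definition sub_exp' :: "bool \<Rightarrow> exp \<Rightarrow> exp \<Rightarrow> exp \<Rightarrow> exp" where
  "sub_exp' rv y a t = Op Mod (Op Shr y (V Rc \<otimes> (if rv then (Cst 3 \<otimes> V Rk \<ominus> a) \<ominus> t else a)))
     (Op Shl (Cst 1) (V Rc \<otimes> t))"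

text \<open>Windows of three blocks, one starting at every block boundary, make each factor of at
  most \<open>2 * k\<close> letters readable from a single word, since its offset in the first block
  is below k.\<close>

definition ext :: "bool \<Rightarrow> exp \<Rightarrow> exp \<Rightarrow> exp" where
  "ext rv x t = sub_exp' rv (Ld (V RW \<oplus> Op Div x (V Rk))) (Op Mod x (V Rk)) t"

text \<open>Four blocks must fit into a word because a window of the reversed string need not be
  aligned with the blocks of the original and may straddle four of them. \<open>big\<close> keeps
  positions and their sums from overflowing.\<close>

locale params =
  fixes w k c N NW :: nat
  assumes k: "1 \<le> k" "2 * k \<le> N" and c: "1 \<le> c" and kc: "4 * (k * c) \<le> w" and NW: "NW = N div k"
    and big: "6 * N + 20 < 2 ^ w"
begin

definition par :: "st \<Rightarrow> bool" where
  "par s \<longleftrightarrow> fst s Rk = k \<and> fst s Rc = c \<and> fst s RN = N \<and> fst s RNW = NW"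

lemma par_D: "par s \<Longrightarrow> fst s Rk = k" "par s \<Longrightarrow> fst s Rc = c" "par s \<Longrightarrow> fst s RN = N" "par s \<Longrightarrow> fst s RNW = NW"
  by (simp_all add: par_def)

lemma c_mult: "t \<le> 3 * k \<Longrightarrow> c * t < w" "t \<le> 3 * k \<Longrightarrow> c * t < 2 ^ w"
proof -
  assume "t \<le> 3 * k"
  then have "c * t \<le> c * (3 * k)" by (rule mult_le_mono2)
  moreover have "c * (3 * k) = 3 * (k * c)" by simp
  moreover have "1 \<le> k * c" using k c by (metis mult_le_mono mult_1)
  ultimately show "c * t < w" using kc by linarith
  then show "c * t < 2 ^ w" by (meson less_exp less_trans)
qed

lemma ev_sub_exp:
  assumes "par s" "ev w y s = y'" "ev w a s = a'" "ev w t s = t'" "a' + t' \<le> 3 * k"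
  shows "ev w (sub_exp' rv y a t) s = subw rv c (3 * k) y' a' t'"
proof -
  have "3 * k < 2 ^ w" "3 < (2::nat) ^ w" "Suc 0 < 2 ^ w" using big k by linarith+
  moreover have "c * t' < w" "c * t' < 2 ^ w" "c * a' < 2 ^ w" "c * (3 * k - a' - t') < 2 ^ w"
    by (rule c_mult, use assms(5) in linarith)+
  moreover have "3 * k - a' < 2 ^ w" "3 * k - a' - t' < 2 ^ w" "a' \<le> 3 * k" "t' \<le> 3 * k - a'"
    using big k assms(5) by linarith+
  ultimately show ?thesis using assms par_D[OF assms(1)]
    by (simp add: sub_exp'_def subw_def bv_shl1)
qed

definition wins :: "bool \<Rightarrow> (nat \<Rightarrow> nat) \<Rightarrow> st \<Rightarrow> bool" where
  "wins rv S s \<longleftrightarrow> (\<forall>m\<le>NW. snd s (fst s RW + m) = wcode rv c S (m * k) (3 * k)) \<and> fst s RW + NW < 2 ^ w"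

lemma div_le_NW: "x \<le> N \<Longrightarrow> x div k \<le> NW"
  unfolding NW by (rule div_le_mono)

lemma ev_ext:
  assumes "par s" "wins rv S s" "\<And>x. S x < 2 ^ c" "ev w x s = x'" "ev w t s = t'" "x' \<le> N" "t' \<le> 2 * k"
  shows "ev w (ext rv x t) s = wcode rv c S x' t'"
proof -
  have m: "x' div k \<le> NW" "x' mod k < k" using div_le_NW assms(6) k by auto
  then have "fst s RW + x' div k < 2 ^ w" using assms(2) unfolding wins_def by linarith
  then have 1: "ev w (Ld (V RW \<oplus> Op Div x (V Rk))) s = wcode rv c S (x' div k * k) (3 * k)"
    using assms(2,4) m(1) par_D[OF assms(1)] unfolding wins_def by simp
  have 2: "ev w (Op Mod x (V Rk)) s = x' mod k" using assms(4) par_D[OF assms(1)] by simp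
  have "ev w (ext rv x t) s = subw rv c (3 * k) (wcode rv c S (x' div k * k) (3 * k)) (x' mod k) t'"
    unfolding ext_def by (rule ev_sub_exp[OF assms(1) 1 2 assms(5)]) (use m(2) assms(7) in linarith)
  also have "\<dots> = wcode rv c S (x' div k * k + x' mod k) t'"
    by (rule subw_wcode[OF assms(3)]) (use assms(7) m(2) in linarith)
  finally show ?thesis by simp
qed

lemma ev_ext_eq:
  assumes "par s" "wins rv S s" "\<And>x. S x < 2 ^ c" "ev w x s = x'" "ev w y s = y'" "ev w t s = t'"
    "x' \<le> N" "y' \<le> N" "t' \<le> 2 * k"
  shows "ev w (Op Eq (ext rv x t) (ext rv y t)) s = of_bool (weq S x' y' t')"
  using ev_ext[OF assms(1-4,6,7,9)] ev_ext[OF assms(1-3,5,6,8,9)] wcode_eq_iff[OF assms(3)] by simp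

end

lemma wp_shift: "wp w c (\<lambda>s' T'. Q s' (T' + a)) s T \<Longrightarrow> wp w c Q s (T + a)"
  unfolding wp_def by (simp add: add.commute add.left_commute)

section \<open>Counting loops and frame conditions\<close>

definition For :: "nat \<Rightarrow> exp \<Rightarrow> com \<Rightarrow> com" where
  "For r e c = Asg r (Cst 0) ;; Whl (V r \<lless> e) (c ;; Asg r (V r \<oplus> Cst 1))"

lemma mods_For [simp]: "mods (For r e c) = insert r (mods c)"
  by (simp add: For_def)

lemma no_store_For [simp]: "no_store (For r e c) = no_store c"
  by (simp add: For_def)

lemma vars_ok_For [simp]: "vars_ok (For r e c) \<longleftrightarrow> r < tmp \<and> evars e \<subseteq> {..<tmp} \<and> vars_ok c"
  by (auto simp: For_def)

definition frame :: "com \<Rightarrow> st \<Rightarrow> st \<Rightarrow> bool" where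
  "frame c s s' \<longleftrightarrow> (\<forall>x. x \<notin> mods c \<longrightarrow> fst s' x = fst s x) \<and> (no_store c \<longrightarrow> snd s' = snd s)"

lemma frame_reg: "frame c s s' \<Longrightarrow> x \<notin> mods c \<Longrightarrow> fst s' x = fst s x"
  by (simp add: frame_def)

lemma frame_mem: "frame c s s' \<Longrightarrow> no_store c \<Longrightarrow> snd s' = snd s"
  by (simp add: frame_def)

lemma wp_AsgV:
  "ev w e s = v \<Longrightarrow> Q ((fst s)(x := v), snd s) (T + cost e + 1) \<Longrightarrow> wp w (Asg x e) Q s T"
  by simp

lemma wp_Asg_Sq:
  "ev w e s = v \<Longrightarrow> wp w c Q ((fst s)(x := v), snd s) (T + cost e + 1) \<Longrightarrow> wp w (Asg x e ;; c) Q s T"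
  by simp

lemma wp_Sto_Sq: "ev w a s = i \<Longrightarrow> ev w e s = v \<Longrightarrow>
   wp w c Q (fst s, (snd s)(i := v)) (T + cost a + cost e + 1) \<Longrightarrow> wp w (Sto a e ;; c) Q s T"
  by simp

lemma wp_StoV:
  "ev w a s = i \<Longrightarrow> ev w e s = v \<Longrightarrow> Q (fst s, (snd s)(i := v)) (T + cost a + cost e + 1) \<Longrightarrow> wp w (Sto a e) Q s T"
  by simp

lemma wp_frameI: "wp w c Q s T \<Longrightarrow> wp w c (\<lambda>s' T'. Q s' T' \<and> frame c s s') s T"
  unfolding frame_def by (drule wp_frame) (simp add: conj_assoc)

lemma wp_SqF: "wp w c R s T \<Longrightarrow> (\<And>s' T'. R s' T' \<Longrightarrow> frame c s s' \<Longrightarrow> wp w d Q s' T') \<Longrightarrow> wp w (Sq c d) Q s T"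
  by (drule wp_frameI) (erule wp_SqI, blast)

lemma wp_monoF: "wp w c R s T \<Longrightarrow> (\<And>s' T'. R s' T' \<Longrightarrow> frame c s s' \<Longrightarrow> Q s' T') \<Longrightarrow> wp w c Q s T"
  by (drule wp_frameI) (erule wp_mono, blast)

text \<open>\<open>cost e + 9\<close> is the price of test, jumps and increment in one round,
  \<open>cost e + 3\<close> that of the failing test. The invariant sees the time because
  \<open>wp_cand\<close> amortises its cost.\<close>

lemma wp_For_time:
  assumes J0: "J 0 ((fst s)(r := 0), snd s) (T + 2)"
    and L: "L < 2 ^ w" and e: "\<And>s'. frame (For r e c) s s' \<Longrightarrow> ev w e s' = L"
    and body: "\<And>m s' T'. m < L \<Longrightarrow> fst s' r = m \<Longrightarrow> J m s' T' \<Longrightarrow> frame (For r e c) s s' \<Longrightarrow>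
       wp w c (\<lambda>s'' T''. fst s'' r = m \<and> J (Suc m) ((fst s'')(r := Suc m), snd s'') (T'' + cost e + 9)) s' T'"
    and fin: "\<And>s' T'. J L s' T' \<Longrightarrow> fst s' r = L \<Longrightarrow> frame (For r e c) s s' \<Longrightarrow> Q s' (T' + cost e + 3)"
  shows "wp w (For r e c) Q s T"
proof -
  let ?s0 = "((fst s)(r := 0), snd s)"
  let ?I = "\<lambda>s' T'. fst s' r \<le> L \<and> J (fst s' r) s' T'"
  have fr: "frame (For r e c) s s'"
    if "\<forall>x. x \<notin> mods (c ;; Asg r (V r \<oplus> Cst 1)) \<longrightarrow> fst s' x = fst ?s0 x"
      "no_store (c ;; Asg r (V r \<oplus> Cst 1)) \<longrightarrow> snd s' = snd ?s0" for s'
    using that unfolding frame_def by auto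
  have "wp w (Whl (V r \<lless> e) (c ;; Asg r (V r \<oplus> Cst 1))) Q ?s0 (T + 2)"
  proof (rule wp_Whl[where I = ?I and m = "\<lambda>s'. L - fst s' r"])
    show "?I ?s0 (T + 2)" using J0 by simp
  next
    fix s' T' assume I: "?I s' T'" and t: "ev w (V r \<lless> e) s' \<noteq> 0"
      and f: "\<forall>x. x \<notin> mods (c ;; Asg r (V r \<oplus> Cst 1)) \<longrightarrow> fst s' x = fst ?s0 x"
      "no_store (c ;; Asg r (V r \<oplus> Cst 1)) \<longrightarrow> snd s' = snd ?s0"
    let ?m = "fst s' r"
    have m: "?m < L" using t e[OF fr[OF f]] by simp
    have w1: "Suc 0 < 2 ^ w" "Suc ?m < 2 ^ w" using m L by linarith+
    from body[OF m refl conjunct2[OF I] fr[OF f]]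
    have "wp w c (\<lambda>s'' T''. fst s'' r = ?m \<and> J (Suc ?m) ((fst s'')(r := Suc ?m), snd s'') (T'' + cost e + 9)) s' T'" .
    then have "wp w c (\<lambda>s'' T''. fst s'' r = ?m \<and> J (Suc ?m) ((fst s'')(r := Suc ?m), snd s'') (T'' + 4)) s' (T' + (cost e + 5))"
      by (intro wp_shift) (auto elim!: wp_mono simp: add_ac)
    then have "wp w c (wp w (Asg r (V r \<oplus> Cst 1)) (\<lambda>s'' T''. ?I s'' T'' \<and> L - fst s'' r < L - ?m)) s' (T' + (cost e + 5))"
      by (rule wp_mono) (use w1 m in \<open>auto simp: numeral_eq_Suc\<close>)
    then show "wp w (c ;; Asg r (V r \<oplus> Cst 1)) (\<lambda>s'' T''. ?I s'' T'' \<and> L - fst s'' r < L - ?m) s' (T' + cost (V r \<lless> e) + 3)"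
      by (simp add: numeral_eq_Suc)
  next
    fix s' T' assume I: "?I s' T'" and t: "ev w (V r \<lless> e) s' = 0"
      and f: "\<forall>x. x \<notin> mods (c ;; Asg r (V r \<oplus> Cst 1)) \<longrightarrow> fst s' x = fst ?s0 x"
      "no_store (c ;; Asg r (V r \<oplus> Cst 1)) \<longrightarrow> snd s' = snd ?s0"
    have m: "fst s' r = L" using t e[OF fr[OF f]] I by simp
    from fin[of s' T'] m I fr[OF f] show "Q s' (T' + cost (V r \<lless> e) + 1)"
      by (simp add: numeral_eq_Suc)
  qed
  then show ?thesis by (simp add: For_def numeral_eq_Suc)
qed

lemma wp_For:
  assumes J0: "J 0 ((fst s)(r := 0), snd s)"
    and L: "L < 2 ^ w" and e: "\<And>s'. frame (For r e c) s s' \<Longrightarrow> ev w e s' = L"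
    and body: "\<And>m s' T'. m < L \<Longrightarrow> fst s' r = m \<Longrightarrow> J m s' \<Longrightarrow> frame (For r e c) s s' \<Longrightarrow>
       wp w c (\<lambda>s'' T''. fst s'' r = m \<and> J (Suc m) ((fst s'')(r := Suc m), snd s'') \<and> T'' \<le> T' + B) s' T'"
    and fin: "\<And>s' T'. J L s' \<Longrightarrow> fst s' r = L \<Longrightarrow> frame (For r e c) s s' \<Longrightarrow>
       T' \<le> T + (B + cost e + 9) * (L + 1) \<Longrightarrow> Q s' T'"
  shows "wp w (For r e c) Q s T"
proof (rule wp_For_time[where J = "\<lambda>m s' T'. J m s' \<and> T' \<le> T + 2 + (B + cost e + 9) * m", OF _ L e])
  show "J 0 ((fst s)(r := 0), snd s) \<and> T + 2 \<le> T + 2 + (B + cost e + 9) * 0" using J0 by simp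
next
  fix m s' T' assume *: "m < L" "fst s' r = m" "J m s' \<and> T' \<le> T + 2 + (B + cost e + 9) * m" "frame (For r e c) s s'"
  from body[OF *(1,2) conjunct1[OF *(3)] *(4), of T'] show "wp w c (\<lambda>s'' T''. fst s'' r = m \<and>
     J (Suc m) ((fst s'')(r := Suc m), snd s'') \<and> T'' + cost e + 9 \<le> T + 2 + (B + cost e + 9) * Suc m) s' T'"
    by (rule wp_mono) (use *(3) in auto)
next
  fix s' T' assume *: "J L s' \<and> T' \<le> T + 2 + (B + cost e + 9) * L" "fst s' r = L" "frame (For r e c) s s'"
  from fin[OF conjunct1[OF *(1)] *(2,3)] *(1) show "Q s' (T' + cost e + 3)" by simp
qed

section \<open>Windows in both reading directions\<close>

text \<open>\<open>B\<close> carries three blocks of padding in front of the string, so that windows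
  running past the end of the reversed string still read letters of \<open>B\<close>.\<close>

definition fstr :: "bool \<Rightarrow> (nat \<Rightarrow> nat) \<Rightarrow> nat \<Rightarrow> nat \<Rightarrow> nat \<Rightarrow> nat" where
  "fstr rv B k N x = (if rv then B (3 * k + N - 1 - x) else B (3 * k + x))"

text \<open>For the reversed string the window of block m covers the letters of \<open>B\<close>
  from \<open>N - m * k\<close> on, in general not a block boundary: four blocks are assembled and
  the surplus is shifted and masked away. The same loop clears the array \<open>pos\<close>.\<close>

definition P_win :: "bool \<Rightarrow> com" where
  "P_win rv = For 20 (V RNW \<oplus> Cst 1) (
     Asg 21 (if rv then V RN \<ominus> V 20 \<otimes> V Rk else (V 20 \<oplus> Cst 3) \<otimes> V Rk) ;;
     Asg 22 (V RA \<oplus> Op Div (V 21) (V Rk)) ;;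
     Asg 23 (V Rk \<otimes> V Rc) ;;
     Asg 24 (Ld (V 22) \<oplus> Op Shl (Ld (V 22 \<oplus> Cst 1)) (V 23)) ;;
     Asg 24 (V 24 \<oplus> Op Shl (Ld (V 22 \<oplus> Cst 2)) (Cst 2 \<otimes> V 23)) ;;
     Asg 24 (V 24 \<oplus> Op Shl (Ld (V 22 \<oplus> Cst 3)) (Cst 3 \<otimes> V 23)) ;;
     Sto (V RW \<oplus> V 20) (Op Mod (Op Shr (V 24) (V Rc \<otimes> Op Mod (V 21) (V Rk))) (Op Shl (Cst 1) (Cst 3 \<otimes> V 23))) ;;
     Sto (V Rpos \<oplus> V 20) (Cst 0))"

context params
begin

lemma w_pos [simp]: "0 < w" "w \<noteq> 0"
proof -
  have "1 \<le> k * c" using k c by (metis mult_le_mono mult_1)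
  then show "0 < w" "w \<noteq> 0" using kc by linarith+
qed

lemma const_mod [simp]: "2 mod 2 ^ w = (2::nat)" "3 mod 2 ^ w = (3::nat)"
  using big by auto

text \<open>Assembling a window reads blocks up to \<open>NW + 6\<close>: it begins in block
  \<open>NW + 3\<close> at the latest, and three more follow.\<close>

definition blocks :: "(nat \<Rightarrow> nat) \<Rightarrow> st \<Rightarrow> bool" where
  "blocks B s \<longleftrightarrow> (\<forall>q<NW + 7. snd s (fst s RA + q) = code c (\<lambda>i. B (q * k + i)) k) \<and> fst s RA + NW + 7 < 2 ^ w"

lemma NWk: "NW * k \<le> N" "N < NW * k + k" "NW \<le> N"
proof -
  have "N = NW * k + N mod k" "N mod k < k" using k unfolding NW by simp_all
  then show "NW * k \<le> N" "N < NW * k + k" by linarith+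
  show "NW \<le> N" unfolding NW by simp
qed

lemma mk_le: "m \<le> NW \<Longrightarrow> m * k \<le> N"
  using NWk(1) mult_le_mono1[of m NW k] by linarith

lemma pow_kc: "(2::nat) ^ (k * c * 4) \<le> 2 ^ w"
  using kc by (intro power_increasing) auto

lemma win_value:
  assumes B: "\<And>x. B x < 2 ^ c" and m: "m \<le> NW"
    and y: "y = (if rv then N - m * k else (m + 3) * k)"
  defines "q \<equiv> y div k"
  defines "b \<equiv> \<lambda>t. code c (\<lambda>i. B ((q + t) * k + i)) k"
  shows "(b 0 + b 1 * 2 ^ (k * c) + b 2 * 2 ^ (2 * (k * c)) + b 3 * 2 ^ (3 * (k * c))) div 2 ^ (c * (y mod k)) mod 2 ^ (3 * (k * c))
     = wcode rv c (fstr rv B k N) (m * k) (3 * k)" (is ?eq)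
    and "b 0 + b 1 * 2 ^ (k * c) + b 2 * 2 ^ (2 * (k * c)) + b 3 * 2 ^ (3 * (k * c)) < 2 ^ w" (is ?lt)
    and "q \<le> NW + 3"
proof -
  let ?f = "\<lambda>i. B (q * k + i)"
  let ?x = "b 0 + b 1 * 2 ^ (k * c) + b 2 * 2 ^ (2 * (k * c)) + b 3 * 2 ^ (3 * (k * c))"
  have x: "?x = code c ?f (k + (k + (k + k)))"
  proof -
    have e: "(q + 0) * k + i = q * k + i" "(q + 1) * k + i = q * k + (k + i)"
      "(q + 2) * k + i = q * k + (k + (k + i))" "(q + 3) * k + i = q * k + (k + (k + (k + i)))" for i
      by (simp_all add: algebra_simps)
    have p: "2 ^ (2 * (k * c)) = 2 ^ (c * k) * (2::nat) ^ (c * k)"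
      "2 ^ (3 * (k * c)) = 2 ^ (c * k) * (2 ^ (c * k) * (2::nat) ^ (c * k))" "2 ^ (k * c) = (2::nat) ^ (c * k)"
      by (simp_all add: mult.commute flip: power_add)
    show ?thesis unfolding code_add b_def e p by (simp only: distrib_left ac_simps)
  qed
  have "code c ?f (k + (k + (k + k))) < 2 ^ (c * (k + (k + (k + k))))" using B by (intro code_less)
  also have "c * (k + (k + (k + k))) = k * c * 4" by (simp add: algebra_simps)
  finally show ?lt using pow_kc x by linarith
  have "?x div 2 ^ (c * (y mod k)) mod 2 ^ (c * (3 * k)) = code c (\<lambda>i. B (q * k + (y mod k + i))) (3 * k)"
    unfolding x by (rule code_factor) (use B k in \<open>auto simp: less_imp_le\<close>)
  also have "\<dots> = code c (\<lambda>i. B (y + i)) (3 * k)"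
    unfolding q_def by (metis (no_types) add.assoc div_mult_mod_eq)
  also have "\<dots> = wcode rv c (fstr rv B k N) (m * k) (3 * k)"
  proof (cases rv)
    case True
    have "code c (\<lambda>i. B (y + i)) (3 * k) = code c (\<lambda>i. fstr rv B k N (m * k + 3 * k - 1 - i)) (3 * k)"
    proof (rule code_cong)
      fix i assume "i < 3 * k"
      then have "3 * k + N - 1 - (m * k + 3 * k - 1 - i) = y + i"
        using y True mk_le[OF m] by simp
      then show "B (y + i) = fstr rv B k N (m * k + 3 * k - 1 - i)" using True by (simp add: fstr_def)
    qed
    then show ?thesis using True by (simp add: wcode_def)
  next
    case False
    then show ?thesis using y by (simp add: wcode_def fstr_def algebra_simps)
  qed
  finally show ?eq by (simp add: algebra_simps)
  have "y \<le> (NW + 3) * k + (k - 1)"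
  proof -
    have "m * k \<le> NW * k" using m by (intro mult_le_mono1) simp
    moreover have "N \<le> NW * k + (k - 1)" using NWk(2) by linarith
    moreover have "y \<le> N \<or> y = (m + 3) * k" using y by simp
    ultimately show ?thesis using add_mult_distrib[of m 3 k] add_mult_distrib[of NW 3 k] by linarith
  qed
  then have "y div k \<le> ((NW + 3) * k + (k - 1)) div k" by (rule div_le_mono)
  also have "\<dots> = NW + 3" using k by (subst div_mult_self3) simp_all
  finally show "q \<le> NW + 3" unfolding q_def .
qed

lemma wp_win:
  assumes par: "par s" and blocks: "blocks B s" and B: "\<And>x. B x < 2 ^ c"
    and adr: "fst s RA + NW + 7 \<le> fst s RW" "fst s RW + NW < fst s Rpos" "fst s Rpos + NW < 2 ^ w"
  shows "wp w (P_win rv) (\<lambda>s' T'. T' \<le> T + 100 * (NW + 2) \<and> wins rv (fstr rv B k N) s' \<and>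
     (\<forall>m\<le>NW. snd s' (fst s Rpos + m) = 0) \<and>
     (\<forall>a. (a < fst s RW \<or> fst s RW + NW < a) \<longrightarrow> (a < fst s Rpos \<or> fst s Rpos + NW < a) \<longrightarrow> snd s' a = snd s a)) s T"
  unfolding P_win_def
proof (rule wp_For[where L = "NW + 1" and B = 70 and J = "\<lambda>m s'.
     (\<forall>j<m. snd s' (fst s RW + j) = wcode rv c (fstr rv B k N) (j * k) (3 * k) \<and> snd s' (fst s Rpos + j) = 0) \<and>
     (\<forall>a. (a < fst s RW \<or> fst s RW + NW < a) \<longrightarrow> (a < fst s Rpos \<or> fst s Rpos + NW < a) \<longrightarrow> snd s' a = snd s a)"],
     goal_cases)
  case 1
  then show ?case by simp
next
  case 2
  then show ?case using NWk big by linarith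
next
  case (3 s')
  then have "fst s' RNW = NW" using par_D(4)[OF par] by (simp add: frame_reg)
  then show ?case using NWk big by simp
next
  case (4 m s' T')
  have r: "fst s' RNW = NW" "fst s' Rk = k" "fst s' Rc = c" "fst s' RN = N" "fst s' RA = fst s RA"
     "fst s' RW = fst s RW" "fst s' Rpos = fst s Rpos"
    using 4(4) par_D[OF par] by (simp_all add: frame_reg)
  have m: "m \<le> NW" using 4(1) by simp
  note J = 4(3)
  define y where "y = (if rv then N - m * k else (m + 3) * k)"
  note wv = win_value[where B = B, OF B m y_def]
  let ?q = "fst s RA + y div k"
  have A: "snd s' (?q + t) = code c (\<lambda>i. B ((y div k + t) * k + i)) k" if "t \<le> 3" for t
  proof -
    have "y div k + t < NW + 7" using wv(3) that by linarith
    then have "snd s (fst s RA + (y div k + t)) = code c (\<lambda>i. B ((y div k + t) * k + i)) k"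
      using blocks unfolding blocks_def by blast
    moreover have "?q + t < fst s RW" using wv(3) that adr by linarith
    ultimately show ?thesis using J adr by (simp add: add.assoc)
  qed
  define b0 b1 b2 b3 where bd: "b0 = snd s' ?q" "b1 = snd s' (?q + 1)" "b2 = snd s' (?q + 2)" "b3 = snd s' (?q + 3)"
  have b: "b0 + b1 * 2 ^ (k * c) + b2 * 2 ^ (2 * (k * c)) + b3 * 2 ^ (3 * (k * c)) < 2 ^ w"
    "(b0 + b1 * 2 ^ (k * c) + b2 * 2 ^ (2 * (k * c)) + b3 * 2 ^ (3 * (k * c))) div 2 ^ (c * (y mod k)) mod 2 ^ (3 * (k * c))
     = wcode rv c (fstr rv B k N) (m * k) (3 * k)"
  proof -
    have "b0 = code c (\<lambda>i. B ((y div k + 0) * k + i)) k" "b1 = code c (\<lambda>i. B ((y div k + 1) * k + i)) k"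
      "b2 = code c (\<lambda>i. B ((y div k + 2) * k + i)) k" "b3 = code c (\<lambda>i. B ((y div k + 3) * k + i)) k"
      unfolding bd using A[of 0] A[of 1] A[of 2] A[of 3] by simp_all
    then show "b0 + b1 * 2 ^ (k * c) + b2 * 2 ^ (2 * (k * c)) + b3 * 2 ^ (3 * (k * c)) < 2 ^ w"
    "(b0 + b1 * 2 ^ (k * c) + b2 * 2 ^ (2 * (k * c)) + b3 * 2 ^ (3 * (k * c))) div 2 ^ (c * (y mod k)) mod 2 ^ (3 * (k * c))
     = wcode rv c (fstr rv B k N) (m * k) (3 * k)"
      using wv(1,2) by (simp_all only:)
  qed
  have b': "b1 * 2 ^ (k * c) < 2 ^ w" "b2 * 2 ^ (2 * (k * c)) < 2 ^ w" "b3 * 2 ^ (3 * (k * c)) < 2 ^ w"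
    "b0 + b1 * 2 ^ (k * c) < 2 ^ w" "b0 + b1 * 2 ^ (k * c) + b2 * 2 ^ (2 * (k * c)) < 2 ^ w"
    using b(1) by linarith+
  have lt: "1 < (2::nat) ^ w" "2 < (2::nat) ^ w" "3 < (2::nat) ^ w" "m * k < 2 ^ w" "(m + 3) * k < 2 ^ w" "m + 3 < 2 ^ w" "N < 2 ^ w"
     "?q < 2 ^ w" "?q + 1 < 2 ^ w" "?q + 2 < 2 ^ w" "?q + 3 < 2 ^ w" "fst s RW + m < 2 ^ w" "fst s Rpos + m < 2 ^ w"
    using big mk_le[OF m] k NWk m wv(3) blocks adr unfolding blocks_def by (auto simp: add_mult_distrib)
  have kc': "k * c < 2 ^ w" "2 * (k * c) < 2 ^ w" "3 * (k * c) < 2 ^ w" "3 * (k * c) < w" "c * (y mod k) < 2 ^ w"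
  proof -
    have "1 \<le> k * c" using k c by (metis mult_le_mono mult_1)
    then show "k * c < 2 ^ w" "2 * (k * c) < 2 ^ w" "3 * (k * c) < 2 ^ w" "3 * (k * c) < w"
      using kc less_exp[of w] by linarith+
    have "y mod k < k" using k by simp
    then show "c * (y mod k) < 2 ^ w" by (intro c_mult) simp
  qed
  have y: "y = (if rv then N - m * k else (m + 3) * k)" "m * k \<le> N" using y_def mk_le[OF m] by auto
  have ev21: "ev w (if rv then V RN \<ominus> V 20 \<otimes> V Rk else (V 20 \<oplus> Cst 3) \<otimes> V Rk) s' = y"
    using r 4(2) lt y by simp
  have bt: "snd s' ?q = b0" "snd s' (Suc ?q) = b1" "snd s' (Suc (Suc ?q)) = b2" "snd s' (?q + 3) = b3"
    by (simp_all add: bd)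
  show ?case
    apply (rule wp_Asg_Sq[where v = y], rule ev21)
    apply (rule wp_Asg_Sq[where v = ?q], simp add: r lt)
    apply (rule wp_Asg_Sq[where v = "k * c"], simp add: r kc')
    apply (rule wp_Asg_Sq[where v = "b0 + b1 * 2 ^ (k * c)"], use lt b' in \<open>simp add: bt\<close>)
    apply (rule wp_Asg_Sq[where v = "b0 + b1 * 2 ^ (k * c) + b2 * 2 ^ (2 * (k * c))"],
        use lt kc' b' in \<open>simp add: bt\<close>)
    apply (rule wp_Asg_Sq[where v = "b0 + b1 * 2 ^ (k * c) + b2 * 2 ^ (2 * (k * c)) + b3 * 2 ^ (3 * (k * c))"],
        use lt kc' b' b(1) in \<open>simp add: bt\<close>)
    apply (rule wp_Sto_Sq[where i = "fst s RW + m" and v = "wcode rv c (fstr rv B k N) (m * k) (3 * k)"],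
        simp add: r lt 4(2), simp add: r kc' bv_shl1 b(2))
    apply (rule wp_StoV[where i = "fst s Rpos + m" and v = 0], simp add: r lt 4(2), simp)
    using J adr m by (auto simp: 4(2) less_Suc_eq)
next
  case (5 s' T')
  have "wins rv (fstr rv B k N) s'"
    using 5(1,3) adr unfolding wins_def by (auto simp: frame_reg less_Suc_eq_le)
  moreover have "T' \<le> T + 100 * (NW + 2)" using 5(4) by simp
  ultimately show ?case using 5(1) by simp
qed

end

lemma cost_sub_exp' [simp]: "cost (sub_exp' rv y a t) = cost y + cost a + cost t + 8 + (if rv then cost t + 5 else 0)"
  by (simp add: sub_exp'_def)

lemma cost_ext [simp]: "cost (ext rv x t) = 2 * cost x + cost t + 15 + (if rv then cost t + 5 else 0)"
  by (simp add: ext_def)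

lemma evars_sub_exp' [simp]: "evars (sub_exp' rv y a t) \<subseteq> A \<longleftrightarrow>
    evars y \<subseteq> A \<and> evars a \<subseteq> A \<and> evars t \<subseteq> A \<and> Rc \<in> A \<and> (rv \<longrightarrow> Rk \<in> A)"
  by (auto simp: sub_exp'_def)

lemma evars_ext [simp]: "evars (ext rv x t) \<subseteq> A \<longleftrightarrow>
    evars x \<subseteq> A \<and> evars t \<subseteq> A \<and> Rc \<in> A \<and> Rk \<in> A \<and> RW \<in> A"
  by (auto simp: ext_def)

section \<open>Prefix period, period runs, first violation and lookup table\<close>

definition P_rho :: "bool \<Rightarrow> com" where
  "P_rho rv = Asg Rrho (Cst 1) ;;
     Whl ((V Rrho \<lless> V Rk \<oplus> Cst 1) \<otimes>
          ((ext rv (V Rrho) (Cst 2 \<otimes> V Rk \<ominus> V Rrho) \<doteq> ext rv (Cst 0) (Cst 2 \<otimes> V Rk \<ominus> V Rrho)) \<doteq> Cst 0))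
       (Asg Rrho (V Rrho \<oplus> Cst 1))"

definition P_nb :: "bool \<Rightarrow> com" where
  "P_nb rv = Sto (V Rnb \<oplus> V RNW) (V RNW) ;; Asg 20 (V RNW) ;;
     Whl (Cst 2 \<lless> V 20) (
       Asg 20 (V 20 \<ominus> Cst 1) ;;
       Cond (ext rv (V 20 \<otimes> V Rk) (V Rk) \<doteq> ext rv (V 20 \<otimes> V Rk \<ominus> V Rrho) (V Rk))
         (Sto (V Rnb \<oplus> V 20) (Ld (V Rnb \<oplus> V 20 \<oplus> Cst 1)))
         (Sto (V Rnb \<oplus> V 20) (V 20)))"

text \<open>The entry of \<open>nb\<close> for block 2 gives the block of the first violation, or
  the final partial block; from its start at most k comparisons of single letters remain. The last
  increment includes the violating letter.\<close>

definition P_M :: "bool \<Rightarrow> com" where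
  "P_M rv = Cond (V Rrho \<lless> V Rk \<oplus> Cst 1)
     (Asg RM (Ld (V Rnb \<oplus> Cst 2) \<otimes> V Rk) ;;
      Whl ((V RM \<lless> V RN) \<otimes> (ext rv (V RM) (Cst 1) \<doteq> ext rv (V RM \<ominus> V Rrho) (Cst 1)))
        (Asg RM (V RM \<oplus> Cst 1)) ;;
      Asg RM (V RM \<oplus> Cst 1))
     (Asg RM (Cst 2 \<otimes> V Rk))"

text \<open>Entry y is the first offset below k at which the last \<open>2 * k\<close> letters of
  the prefix of length \<open>M\<close> occur in window y, and k if there is none. One offset per
  window is enough by \<open>v_sparse\<close> when \<open>M\<close> is at most \<open>N\<close>;
  otherwise there are no candidates.\<close>

definition P_tab :: "bool \<Rightarrow> com" where
  "P_tab rv = Asg 16 (ext rv (V RM \<ominus> Cst 2 \<otimes> V Rk) (Cst 2 \<otimes> V Rk)) ;;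
     For 20 (Op Shl (Cst 1) (Cst 3 \<otimes> (V Rk \<otimes> V Rc))) (
       Asg 21 (Cst 0) ;;
       Whl ((V 21 \<lless> V Rk) \<otimes> ((sub_exp' rv (V 20) (V 21) (Cst 2 \<otimes> V Rk) \<doteq> V 16) \<doteq> Cst 0))
         (Asg 21 (V 21 \<oplus> Cst 1)) ;;
       Sto (V Rtab \<oplus> V 20) (V 21))"

context params
begin

lemma par_upd [simp]: "x \<noteq> Rk \<Longrightarrow> x \<noteq> Rc \<Longrightarrow> x \<noteq> RN \<Longrightarrow> x \<noteq> RNW \<Longrightarrow> par (\<sigma>(x := v), \<mu>) \<longleftrightarrow> par (\<sigma>, \<mu>)"
  by (simp add: par_def)

lemma par_fst [simp]: "par (fst s, \<mu>) \<longleftrightarrow> par s"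
  by (simp add: par_def)

lemma par_cong: "par s \<Longrightarrow> fst s' Rk = fst s Rk \<Longrightarrow> fst s' Rc = fst s Rc \<Longrightarrow> fst s' RN = fst s RN \<Longrightarrow>
    fst s' RNW = fst s RNW \<Longrightarrow> par s'"
  by (simp add: par_def)

lemma wins_upd [simp]: "x \<noteq> RW \<Longrightarrow> wins rv S (\<sigma>(x := v), \<mu>) \<longleftrightarrow> wins rv S (\<sigma>, \<mu>)"
  by (simp add: wins_def)

lemma wins_fst [simp]: "wins rv S (fst s, snd s) \<longleftrightarrow> wins rv S s"
  by (simp add: wins_def)

lemma wins_cong: "wins rv S s \<Longrightarrow> fst s' RW = fst s RW \<Longrightarrow>
    (\<And>m. m \<le> NW \<Longrightarrow> snd s' (fst s RW + m) = snd s (fst s RW + m)) \<Longrightarrow> wins rv S s'"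
  by (simp add: wins_def)

lemma sizes: "k < 2 ^ w" "2 * k < 2 ^ w" "3 * k < 2 ^ w" "Suc k < 2 ^ w" "N < 2 ^ w" "Suc N < 2 ^ w" "NW < 2 ^ w" "Suc NW < 2 ^ w"
  "2 \<le> NW" "k \<le> N" "0 < k"
proof -
  show "2 \<le> NW" using div_le_mono[OF k(2), of k] k(1) unfolding NW by simp
qed (use big k NWk in linarith)+

definition rho_ok :: "(nat \<Rightarrow> nat) \<Rightarrow> nat \<Rightarrow> bool" where
  "rho_ok S rho \<longleftrightarrow> 1 \<le> rho \<and> rho \<le> k + 1 \<and> (rho \<le> k \<longrightarrow> weq S rho 0 (2 * k - rho)) \<and>
     (\<forall>q. 1 \<le> q \<longrightarrow> q < rho \<longrightarrow> \<not> weq S q 0 (2 * k - q))"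

lemma wp_rho:
  assumes par: "par s" and wins: "wins rv S s" and S: "\<And>x. S x < 2 ^ c"
  shows "wp w (P_rho rv) (\<lambda>s' T'. rho_ok S (fst s' Rrho) \<and> T' \<le> T + 100 * (k + 2)) s T"
  unfolding P_rho_def
proof (rule wp_Asg_Sq[where v = 1], simp, rule wp_Whl[where m = "\<lambda>s'. k + 1 - fst s' Rrho" and I = "\<lambda>s' T'.
     1 \<le> fst s' Rrho \<and> fst s' Rrho \<le> k + 1 \<and> (\<forall>q. 1 \<le> q \<longrightarrow> q < fst s' Rrho \<longrightarrow> \<not> weq S q 0 (2 * k - q)) \<and>
     T' \<le> T + 80 * fst s' Rrho"], goal_cases)
  case 1
  then show ?case by simp
next
  case (2 s' T')
  have ps: "par s'" "wins rv S s'" using 2(3,4) par wins by (auto elim!: par_cong wins_cong)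
  define r where "r = fst s' Rrho"
  have r: "1 \<le> r" "r \<le> k + 1" using 2(1) by (simp_all add: r_def)
  have e: "ev w (Cst 2 \<otimes> V Rk \<ominus> V Rrho) s' = 2 * k - r"
    using r sizes par_D[OF ps(1)] by (simp add: r_def)
  have x: "ev w (ext rv (V Rrho) (Cst 2 \<otimes> V Rk \<ominus> V Rrho) \<doteq> ext rv (Cst 0) (Cst 2 \<otimes> V Rk \<ominus> V Rrho)) s'
     = of_bool (weq S r 0 (2 * k - r))"
    by (rule ev_ext_eq[OF ps S _ _ e]) (use r sizes k in \<open>simp_all add: r_def\<close>)
  have c: "r < k + 1" "\<not> weq S r 0 (2 * k - r)"
    using 2(2) sizes par_D[OF ps(1)] unfolding ev.simps(3)[of w Mul] ev.simps(3)[of w Eq "ext _ _ _ \<doteq> _"] x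
    by (auto simp: r_def[symmetric])
  have "r + 1 < 2 ^ w" using c sizes by linarith
  then show ?case
    using 2(1) c sizes by (intro wp_AsgV[where v = "r + 1"]) (auto simp: r_def less_Suc_eq)
next
  case (3 s' T')
  have ps: "par s'" "wins rv S s'" using 3(3,4) par wins by (auto elim!: par_cong wins_cong)
  define r where "r = fst s' Rrho"
  have r: "1 \<le> r" "r \<le> k + 1" using 3(1) by (simp_all add: r_def)
  have e: "ev w (Cst 2 \<otimes> V Rk \<ominus> V Rrho) s' = 2 * k - r"
    using r sizes par_D[OF ps(1)] by (simp add: r_def)
  have x: "ev w (ext rv (V Rrho) (Cst 2 \<otimes> V Rk \<ominus> V Rrho) \<doteq> ext rv (Cst 0) (Cst 2 \<otimes> V Rk \<ominus> V Rrho)) s'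
     = of_bool (weq S r 0 (2 * k - r))"
    by (rule ev_ext_eq[OF ps S _ _ e]) (use r sizes k in \<open>simp_all add: r_def\<close>)
  have "\<not> (r < k + 1 \<and> \<not> weq S r 0 (2 * k - r))"
    using 3(2) sizes par_D[OF ps(1)] unfolding ev.simps(3)[of w Mul] ev.simps(3)[of w Eq "ext _ _ _ \<doteq> _"] x
    by (auto simp: r_def[symmetric])
  then show ?case using 3(1) r unfolding rho_ok_def by (auto simp: r_def[symmetric])
qed

definition nb_ok :: "(nat \<Rightarrow> nat) \<Rightarrow> nat \<Rightarrow> nat \<Rightarrow> nat \<Rightarrow> bool" where
  "nb_ok S rho j v \<longleftrightarrow> j \<le> v \<and> v \<le> NW \<and> (\<forall>x. j * k \<le> x \<longrightarrow> x < v * k \<longrightarrow> S x = S (x - rho)) \<and>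
     (v < NW \<longrightarrow> (\<exists>x. v * k \<le> x \<and> x < v * k + k \<and> S x \<noteq> S (x - rho)))"

lemma weq_good: "r \<le> a \<Longrightarrow> weq S a (a - r) k \<longleftrightarrow> (\<forall>x. a \<le> x \<longrightarrow> x < a + k \<longrightarrow> S x = S (x - r))"
proof
  assume *: "r \<le> a" "weq S a (a - r) k"
  show "\<forall>x. a \<le> x \<longrightarrow> x < a + k \<longrightarrow> S x = S (x - r)"
  proof (intro allI impI)
    fix x assume x: "a \<le> x" "x < a + k"
    then have "a + (x - a) = x" "a - r + (x - a) = x - r" using *(1) by auto
    then show "S x = S (x - r)" using weqD[OF *(2), of "x - a"] x by simp
  qed
next
  assume *: "r \<le> a" "\<forall>x. a \<le> x \<longrightarrow> x < a + k \<longrightarrow> S x = S (x - r)"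
  show "weq S a (a - r) k" unfolding weq_def
  proof (intro allI impI)
    fix i assume "i < k"
    then have "S (a + i) = S (a + i - r)" using *(2) by simp
    then show "S (a + i) = S (a - r + i)" using *(1) by simp
  qed
qed

lemma nb_ok_step:
  assumes "nb_ok S rho (Suc j) v" "2 \<le> j" "j < NW" "1 \<le> rho" "rho \<le> k + 1"
  shows "nb_ok S rho j (if weq S (j * k) (j * k - rho) k then v else j)"
proof -
  have "2 * k \<le> j * k" using assms by (intro mult_le_mono1)
  then have "rho \<le> j * k" using assms sizes by linarith
  note g = weq_good[OF this, of S]
  show ?thesis
  proof (cases "weq S (j * k) (j * k - rho) k")
    case True
    have "S x = S (x - rho)" if "j * k \<le> x" "x < v * k" for x
      using that g True assms(1) unfolding nb_ok_def by (cases "x < j * k + k") auto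
    then show ?thesis using True assms(1) unfolding nb_ok_def by auto
  next
    case False
    then show ?thesis using g assms(3) unfolding nb_ok_def by auto
  qed
qed

lemma wp_nb:
  assumes par: "par s" and wins: "wins rv S s" and S: "\<And>x. S x < 2 ^ c"
    and rho: "1 \<le> fst s Rrho" "fst s Rrho \<le> k + 1"
    and adr: "fst s RW + NW < fst s Rnb" "fst s Rnb + NW < 2 ^ w"
  shows "wp w (P_nb rv) (\<lambda>s' T'. (\<forall>j. 2 \<le> j \<longrightarrow> j \<le> NW \<longrightarrow> nb_ok S (fst s Rrho) j (snd s' (fst s Rnb + j))) \<and>
     (\<forall>a. a < fst s Rnb \<or> fst s Rnb + NW < a \<longrightarrow> snd s' a = snd s a) \<and> T' \<le> T + 100 * (NW + 2)) s T"
  unfolding P_nb_def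
proof (rule wp_Sto_Sq[where i = "fst s Rnb + NW" and v = NW], use adr par_D[OF par] in simp, use par_D[OF par] in simp,
    rule wp_Asg_Sq[where v = NW], use par_D[OF par] in simp,
    rule wp_Whl[where m = "\<lambda>s'. fst s' 20" and I = "\<lambda>s' T'. 2 \<le> fst s' 20 \<and> fst s' 20 \<le> NW \<and>
      (\<forall>j. fst s' 20 \<le> j \<longrightarrow> j \<le> NW \<longrightarrow> nb_ok S (fst s Rrho) j (snd s' (fst s Rnb + j))) \<and>
      (\<forall>a. a < fst s Rnb \<or> fst s Rnb + NW < a \<longrightarrow> snd s' a = snd s a) \<and>
      T' + 100 * fst s' 20 \<le> T + 100 * (NW + 1)"], goal_cases)
  case 1
  then show ?case using sizes by (auto simp: nb_ok_def)
next
  case (2 s' T')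
  define rho where "rho = fst s Rrho"
  have r: "fst s' Rrho = rho" "fst s' Rnb = fst s Rnb" "fst s' RW = fst s RW" using 2(3) by (simp_all add: rho_def)
  have p: "par s'" using 2(3) by (auto intro: par_cong[OF par])
  have wn: "wins rv S s'" by (rule wins_cong[OF wins]) (use r 2(1) adr in auto)
  have "2 < fst s' 20" using 2(1,2) by (simp split: if_splits)
  then obtain m where m: "fst s' 20 = Suc m" "2 \<le> m" "m < NW" using 2(1) by (cases "fst s' 20") auto
  define s1 where "s1 = ((fst s')(20 := m), snd s')"
  have ps: "par s1" "wins rv S s1" using p wn by (simp_all add: s1_def)
  have mk: "m * k \<le> N" "m * k < 2 ^ w" "2 * k \<le> m * k"
  proof -
    show 1: "m * k \<le> N" by (rule mk_le) (use m in simp)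
    then show "m * k < 2 ^ w" using sizes by linarith
    show "2 * k \<le> m * k" using m by (intro mult_le_mono1) simp
  qed
  have rho': "1 \<le> rho" "rho \<le> k + 1" "rho \<le> m * k" using rho mk sizes k unfolding rho_def by linarith+
  have x: "ev w (ext rv (V 20 \<otimes> V Rk) (V Rk) \<doteq> ext rv (V 20 \<otimes> V Rk \<ominus> V Rrho) (V Rk)) s1
     = of_bool (weq S (m * k) (m * k - rho) k)"
    by (rule ev_ext_eq[OF ps S]) (use mk rho' par_D[OF ps(1)] in \<open>simp_all add: s1_def r\<close>)
  let ?v = "snd s' (fst s Rnb + Suc m)"
  have "\<forall>j. fst s' 20 \<le> j \<longrightarrow> j \<le> NW \<longrightarrow> nb_ok S (fst s Rrho) j (snd s' (fst s Rnb + j))"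
    using 2(1) by blast
  then have J: "nb_ok S rho (Suc m) ?v" using m unfolding rho_def by (metis Suc_leI order_refl)
  have step: "nb_ok S rho m (if weq S (m * k) (m * k - rho) k then ?v else m)"
    by (rule nb_ok_step) (use J m rho' in simp_all)
  have post: "2 \<le> m \<and> m \<le> NW \<and>
      (\<forall>j. m \<le> j \<longrightarrow> j \<le> NW \<longrightarrow> nb_ok S rho j (((snd s')(fst s Rnb + m := u)) (fst s Rnb + j))) \<and>
      (\<forall>a. a < fst s Rnb \<or> fst s Rnb + NW < a \<longrightarrow> ((snd s')(fst s Rnb + m := u)) a = snd s a)"
    if "nb_ok S rho m u" for u
  proof (intro conjI allI impI)
    fix j assume "m \<le> j" "j \<le> NW"
    then show "nb_ok S rho j (((snd s')(fst s Rnb + m := u)) (fst s Rnb + j))"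
      using that 2(1) m by (cases "j = m") (simp_all add: rho_def)
  qed (use 2(1) m in auto)
  have bs: "fst s Rnb + m < 2 ^ w" "Suc (fst s Rnb + m) < 2 ^ w" "Suc m < 2 ^ w" using adr m sizes by linarith+
  have "wp w (Cond (ext rv (V 20 \<otimes> V Rk) (V Rk) \<doteq> ext rv (V 20 \<otimes> V Rk \<ominus> V Rrho) (V Rk))
         (Sto (V Rnb \<oplus> V 20) (Ld (V Rnb \<oplus> V 20 \<oplus> Cst 1)))
         (Sto (V Rnb \<oplus> V 20) (V 20))) (\<lambda>s'' T''. (2 \<le> fst s'' 20 \<and> fst s'' 20 \<le> NW \<and>
      (\<forall>j. fst s'' 20 \<le> j \<longrightarrow> j \<le> NW \<longrightarrow> nb_ok S (fst s Rrho) j (snd s'' (fst s Rnb + j))) \<and>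
      (\<forall>a. a < fst s Rnb \<or> fst s Rnb + NW < a \<longrightarrow> snd s'' a = snd s a) \<and>
      T'' + 100 * fst s'' 20 \<le> T + 100 * (NW + 1)) \<and> fst s'' 20 < fst s' 20) s1 (T' + cost (Cst 2 \<lless> V 20) + 3 + cost (V 20 \<ominus> Cst 1) + 1)"
  proof (cases "weq S (m * k) (m * k - rho) k")
    case True
    show ?thesis
      apply (rule wp_Cond)
       apply (rule wp_StoV[where i = "fst s Rnb + m" and v = ?v])
      using bs m apply (simp add: s1_def r)
      using bs m apply (simp add: s1_def r)
      using post[of ?v] step True 2(1) m apply (simp add: s1_def rho_def)
      using x True by simp
  next
    case False
    show ?thesis
      apply (rule wp_Cond)
      using x False apply simp
      apply (rule wp_StoV[where i = "fst s Rnb + m" and v = "m"])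
      using bs m apply (simp add: s1_def r)
      using bs m apply (simp add: s1_def r)
      using post[of "m"] step False 2(1) m by (simp add: s1_def rho_def)
  qed
  then show ?case
    unfolding s1_def by (rule wp_Asg_Sq[rotated]) (use bs m in simp)
next
  case (3 s' T')
  then show ?case by (simp split: if_splits)
qed

end

context params
begin

definition M_ok :: "(nat \<Rightarrow> nat) \<Rightarrow> nat \<Rightarrow> nat \<Rightarrow> bool" where
  "M_ok S rho M \<longleftrightarrow> (rho = k + 1 \<longrightarrow> M = 2 * k) \<and> (rho \<le> k \<longrightarrow> 2 * k < M \<and> M \<le> N + 1 \<and>
     (\<forall>x. rho \<le> x \<longrightarrow> x + 1 < M \<longrightarrow> S x = S (x - rho)) \<and> (M \<le> N \<longrightarrow> S (M - 1) \<noteq> S (M - 1 - rho)))"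

lemma M_ok_le: "M_ok S rho M \<Longrightarrow> rho \<le> k + 1 \<Longrightarrow> 2 * k \<le> M \<and> M \<le> N + 1"
  using k unfolding M_ok_def by (cases "rho = k + 1") auto

lemma wp_M:
  assumes par: "par s" and wins: "wins rv S s" and S: "\<And>x. S x < 2 ^ c"
    and rho: "rho_ok S (fst s Rrho)"
    and nb: "nb_ok S (fst s Rrho) 2 (snd s (fst s Rnb + 2))" and adr: "fst s Rnb + NW < 2 ^ w"
  shows "wp w (P_M rv) (\<lambda>s' T'. M_ok S (fst s Rrho) (fst s' RM) \<and> T' \<le> T + 200 * (k + 2)) s T"
  unfolding P_M_def
proof (rule wp_Cond, goal_cases)
  case 1
  define r where "r = fst s Rrho"
  define v where "v = snd s (fst s Rnb + 2)"
  have rk: "1 \<le> r" "r \<le> k" "weq S r 0 (2 * k - r)"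
    using 1 rho sizes par_D[OF par] unfolding rho_ok_def r_def by (simp_all split: if_splits)
  have v: "2 \<le> v" "v \<le> NW" "\<And>x. 2 * k \<le> x \<Longrightarrow> x < v * k \<Longrightarrow> S x = S (x - r)"
    "v < NW \<Longrightarrow> \<exists>x. v * k \<le> x \<and> x < v * k + k \<and> S x \<noteq> S (x - r)"
    using nb unfolding nb_ok_def v_def r_def by auto
  have vk: "v * k \<le> N" "v * k < 2 ^ w" "2 * k \<le> v * k"
    using mk_le[OF v(2)] sizes v(1) by (auto intro: mult_le_mono1)
  have low: "S x = S (x - r)" if "r \<le> x" "x < 2 * k" for x
    using weqD[OF rk(3), of "x - r"] that by simp
  let ?I = "\<lambda>s' T'. v * k \<le> fst s' RM \<and> fst s' RM \<le> N \<and> (\<forall>x. 2 * k \<le> x \<longrightarrow> x < fst s' RM \<longrightarrow> S x = S (x - r)) \<and>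
      T' + 100 * (v * k) \<le> T + 40 + 100 * fst s' RM"
  have loop: "wp w (Whl ((V RM \<lless> V RN) \<otimes> (ext rv (V RM) (Cst 1) \<doteq> ext rv (V RM \<ominus> V Rrho) (Cst 1)))
        (Asg RM (V RM \<oplus> Cst 1))) (\<lambda>s' T'. (v * k \<le> fst s' RM \<and> fst s' RM \<le> N \<and> (\<forall>x. 2 * k \<le> x \<longrightarrow> x < fst s' RM \<longrightarrow> S x = S (x - r)) \<and>
      T' + 100 * (v * k) \<le> T + 150 + 100 * fst s' RM) \<and> (fst s' RM < N \<longrightarrow> S (fst s' RM) \<noteq> S (fst s' RM - r)))
        ((fst s)(RM := v * k), snd s)
        (T + cost (V Rrho \<lless> V Rk \<oplus> Cst 1) + 3 + cost (Ld (V Rnb \<oplus> Cst 2) \<otimes> V Rk) + 1)"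
  proof (rule wp_Whl[where I = ?I and m = "\<lambda>s'. N - fst s' RM"], goal_cases)
    case 1
    then show ?case using v vk by simp
  next
    case (2 s' T')
    define E where "E = fst s' RM"
    have p: "par s'" "wins rv S s'" using 2(3,4) by (auto intro: par_cong[OF par] wins_cong[OF wins])
    have r': "fst s' Rrho = r" using 2(3) by (simp add: r_def)
    have E: "v * k \<le> E" "E \<le> N" "r \<le> E" "2 * k \<le> E" using 2(1) rk vk unfolding E_def by linarith+
    have x: "ev w (ext rv (V RM) (Cst 1) \<doteq> ext rv (V RM \<ominus> V Rrho) (Cst 1)) s' = of_bool (weq S E (E - r) 1)"
      by (rule ev_ext_eq[OF p S]) (use E r' sizes k in \<open>simp_all add: E_def[symmetric]\<close>)
    have cc: "E < N" "S E = S (E - r)"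
      using 2(2) par_D[OF p(1)] unfolding ev.simps(3)[of w Mul] x by (auto simp: E_def[symmetric] weq_def)
    then show ?case
      using 2(1) sizes by (intro wp_AsgV[where v = "E + 1"]) (auto simp: E_def[symmetric] less_Suc_eq)
  next
    case (3 s' T')
    define E where "E = fst s' RM"
    have p: "par s'" "wins rv S s'" using 3(3,4) by (auto intro: par_cong[OF par] wins_cong[OF wins])
    have r': "fst s' Rrho = r" using 3(3) by (simp add: r_def)
    have E: "v * k \<le> E" "E \<le> N" "r \<le> E" "2 * k \<le> E" using 3(1) rk vk unfolding E_def by linarith+
    have x: "ev w (ext rv (V RM) (Cst 1) \<doteq> ext rv (V RM \<ominus> V Rrho) (Cst 1)) s' = of_bool (weq S E (E - r) 1)"
      by (rule ev_ext_eq[OF p S]) (use E r' sizes k in \<open>simp_all add: E_def[symmetric]\<close>)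
    have "\<not> (E < N \<and> S E = S (E - r))"
      using 3(2) par_D[OF p(1)] unfolding ev.simps(3)[of w Mul] x by (auto simp: E_def[symmetric] weq_def)
    then show ?case using 3(1) by (auto simp: E_def[symmetric])
  qed
  show ?case
  proof (rule wp_Asg_Sq[where v = "v * k"], goal_cases)
    case 1
    then show ?case using adr vk par_D[OF par] sizes by (simp add: v_def)
  next
    case 2
    show ?case
    proof (rule wp_Sq, rule wp_mono[OF loop], goal_cases)
      case (1 s' T')
      define E where "E = fst s' RM"
      have E: "v * k \<le> E" "E \<le> N" "\<And>x. 2 * k \<le> x \<Longrightarrow> x < E \<Longrightarrow> S x = S (x - r)"
        "E < N \<Longrightarrow> S E \<noteq> S (E - r)" "T' + 100 * (v * k) \<le> T + 150 + 100 * E"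
        using 1 by (simp_all add: E_def)
      have "E \<le> v * k + k"
      proof (cases "v < NW")
        case True
        then obtain x where "v * k \<le> x" "x < v * k + k" "S x \<noteq> S (x - r)" using v(4) by blast
        moreover from this have "\<not> x < E" using E(3)[of x] vk(3) by linarith
        ultimately show ?thesis by linarith
      next
        case False
        then have "v = NW" using v(2) by simp
        then show ?thesis using NWk E by simp
      qed
      then have T': "T' + 4 \<le> T + 200 * (k + 2)" using E(5) by simp
      have "S x = S (x - r)" if "r \<le> x" "x + 1 < E + 1" for x
        using that low[of x] E(3)[of x] by (cases "x < 2 * k") simp_all
      moreover have "r \<noteq> k + 1" "2 * k < E + 1" "E + 1 \<le> N + 1" using rk(2) E(1,2) vk(3) by linarith+
      moreover have "E + 1 \<le> N \<longrightarrow> S (E + 1 - 1) \<noteq> S (E + 1 - 1 - r)" using E(4) by simp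
      ultimately have "M_ok S r (E + 1)" unfolding M_ok_def by blast
      then show ?case
        using T' E(2) sizes by (intro wp_AsgV[where v = "E + 1"]) (simp_all add: E_def r_def)
    qed
  qed
next
  case 2
  have "fst s Rrho = k + 1"
    using 2 rho sizes par_D[OF par] unfolding rho_ok_def by (simp split: if_splits)
  then show ?case
    using par_D[OF par] sizes by (intro wp_AsgV[where v = "2 * k"]) (simp_all add: M_ok_def)
qed

lemma wp_tab:
  assumes par: "par s" and wins: "wins rv S s" and S: "\<And>x. S x < 2 ^ c"
    and M: "2 * k \<le> fst s RM" "fst s RM \<le> N + 1"
    and adr: "fst s Rtab + 2 ^ (3 * (k * c)) \<le> 2 ^ w"
  defines "v \<equiv> wcode rv c S (fst s RM - 2 * k) (2 * k)"
  shows "wp w (P_tab rv) (\<lambda>s' T'.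
     (\<forall>y<2 ^ (3 * (k * c)). let a = snd s' (fst s Rtab + y) in a \<le> k \<and>
        (a < k \<longrightarrow> subw rv c (3 * k) y a (2 * k) = v) \<and> (\<forall>a'<a. subw rv c (3 * k) y a' (2 * k) \<noteq> v)) \<and>
     (\<forall>a. a < fst s Rtab \<or> fst s Rtab + 2 ^ (3 * (k * c)) \<le> a \<longrightarrow> snd s' a = snd s a) \<and>
     T' \<le> T + 200 * (k + 2) * (2 ^ (3 * (k * c)) + 1)) s T"
proof -
  let ?K = "2 ^ (3 * (k * c)) :: nat"
  have kc1: "1 \<le> k * c" using k c by (metis mult_le_mono mult_1)
  have kc': "k * c < 2 ^ w" "3 * (k * c) < 2 ^ w" "3 * (k * c) < w"
    using kc kc1 less_exp[of w] by linarith+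
  have K: "?K < 2 ^ w" using kc'(3) by simp
  have ev16: "ev w (ext rv (V RM \<ominus> Cst 2 \<otimes> V Rk) (Cst 2 \<otimes> V Rk)) s = v"
    unfolding v_def by (rule ev_ext[OF par wins S]) (use M sizes k par_D[OF par] in simp_all)
  show ?thesis
    unfolding P_tab_def
  proof (rule wp_Asg_Sq[OF ev16], rule wp_For[where L = ?K and B = "130 * (k + 2)" and J = "\<lambda>m s'.
     (\<forall>y<m. let a = snd s' (fst s Rtab + y) in a \<le> k \<and>
        (a < k \<longrightarrow> subw rv c (3 * k) y a (2 * k) = v) \<and> (\<forall>a'<a. subw rv c (3 * k) y a' (2 * k) \<noteq> v)) \<and>
     (\<forall>a. a < fst s Rtab \<or> fst s Rtab + ?K \<le> a \<longrightarrow> snd s' a = snd s a)"], goal_cases)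
    case 1
    then show ?case by simp
  next
    case 2
    show ?case by (rule K)
  next
    case (3 s')
    then have "fst s' Rk = k" "fst s' Rc = c" using par_D[OF par] by (simp_all add: frame_reg)
    then show ?case using kc' by (simp add: bv_shl1)
  next
    case (4 m s' T')
    have r: "fst s' Rtab = fst s Rtab" "fst s' 16 = v" using 4(4) by (simp_all add: frame_reg)
    have p: "par s'" by (rule par_cong[OF par]) (use 4(4) in \<open>simp_all add: frame_reg\<close>)
    let ?g = "\<lambda>a. subw rv c (3 * k) m a (2 * k) = v"
    show ?case
    proof (rule wp_Asg_Sq[where v = 0], simp, rule wp_Sq,
        rule wp_Whl[where m = "\<lambda>s''. k - fst s'' 21" and I = "\<lambda>s'' T''. snd s'' = snd s' \<and> fst s'' 21 \<le> k \<and>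
          (\<forall>a'<fst s'' 21. \<not> ?g a') \<and> T'' \<le> T' + 2 + 100 * fst s'' 21"], goal_cases)
      case 1
      then show ?case by simp
    next
      case (2 s2 T2)
      have p2: "par s2" "fst s2 20 = m" "fst s2 16 = v" using 2(3) 4(2) r by (auto intro: par_cong[OF p])
      define a where "a = fst s2 21"
      have a: "a \<le> k" using 2(1) by (simp add: a_def)
      have x: "ev w (sub_exp' rv (V 20) (V 21) (Cst 2 \<otimes> V Rk)) s2 = subw rv c (3 * k) m a (2 * k)"
        by (rule ev_sub_exp[OF p2(1)]) (use a p2 sizes par_D[OF p2(1)] in \<open>simp_all add: a_def\<close>)
      have cc: "a < k" "\<not> ?g a"
        using 2(2) x p2 par_D[OF p2(1)] by (auto simp: a_def[symmetric])
      then show ?case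
        using 2(1) sizes by (intro wp_AsgV[where v = "a + 1"]) (auto simp: a_def[symmetric] less_Suc_eq)
    next
      case (3 s2 T2)
      have p2: "par s2" "fst s2 20 = m" "fst s2 16 = v" "fst s2 Rtab = fst s Rtab" using 3(3) 4(2) r by (auto intro: par_cong[OF p])
      define a where "a = fst s2 21"
      have a: "a \<le> k" using 3(1) by (simp add: a_def)
      have x: "ev w (sub_exp' rv (V 20) (V 21) (Cst 2 \<otimes> V Rk)) s2 = subw rv c (3 * k) m a (2 * k)"
        by (rule ev_sub_exp[OF p2(1)]) (use a p2 sizes par_D[OF p2(1)] in \<open>simp_all add: a_def\<close>)
      have cc: "a < k \<longrightarrow> ?g a"
        using 3(2) x p2 par_D[OF p2(1)] by (auto simp: a_def[symmetric])
      have tm: "fst s Rtab + m < 2 ^ w" using adr 4(1) by linarith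
      have J: "let a = ((snd s2)(fst s Rtab + m := a)) (fst s Rtab + y) in a \<le> k \<and>
        (a < k \<longrightarrow> subw rv c (3 * k) y a (2 * k) = v) \<and> (\<forall>a'<a. subw rv c (3 * k) y a' (2 * k) \<noteq> v)"
        if "y < Suc m" for y
        using that 4(3) 3(1) cc a by (cases "y = m") (simp_all add: Let_def a_def)
      have T2: "T2 + 60 \<le> T' + 130 * (k + 2)" using 3(1) a by (simp add: a_def[symmetric])
      show ?case
        apply (rule wp_StoV[where i = "fst s Rtab + m" and v = a])
        using p2 tm apply simp
        apply (simp add: a_def)
        using J 4(1,3) 3(1) p2 T2 by simp
    qed
  next
    case (5 s' T')
    have "T' \<le> T + 200 * (k + 2) * (?K + 1)"
      using 5(4) by (rule le_trans) (simp add: algebra_simps)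
    then show ?case using 5(1) by simp
  qed
qed

end

section \<open>The block-wise Z-algorithm on the candidates\<close>

definition P_z :: "bool \<Rightarrow> com" where
  "P_z rv = Whl ((V 23 \<oplus> V 24 \<otimes> V Rk \<oplus> V Rk \<lless> V RN \<oplus> Cst 1) \<otimes>
      (ext rv (V 23 \<oplus> V 24 \<otimes> V Rk) (V Rk) \<doteq> ext rv (V 24 \<otimes> V Rk) (V Rk)))
      (Asg 24 (V 24 \<oplus> Cst 1))"

definition P_box :: com where
  "P_box = Asg 24 (Cst 0) ;; Asg 25 (Cst 1) ;; Asg 28 (V 17 \<oplus> V 18 \<otimes> V Rk) ;;
     Cond (V 23 \<lless> V 28)
       (Asg 24 (Op Div (V 28 \<ominus> V 23) (V Rk)) ;; Asg 26 (V 23 \<ominus> V 17) ;; Asg 29 (Op Div (V 26) (V Rk)) ;;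
        Cond ((Ld (V Rpos \<oplus> V 29) \<doteq> V 26) \<otimes>
              (V 26 \<oplus> Ld (V Rzb \<oplus> V 29) \<otimes> V Rk \<oplus> V Rk \<lless> V 18 \<otimes> V Rk \<oplus> Cst 1))
          (Asg 24 (Ld (V Rzb \<oplus> V 29)) ;; Asg 25 (Cst 0)) Skip) Skip"

definition P_ins :: "bool \<Rightarrow> com" where
  "P_ins rv = P_box ;; Cond (V 25) (P_z rv ;; Asg 17 (V 23) ;; Asg 18 (V 24)) Skip ;;
     Asg 29 (Op Div (V 23) (V Rk)) ;; Sto (V Rpos \<oplus> V 29) (V 23) ;; Sto (V Rzb \<oplus> V 29) (V 24)"

text \<open>The table tells where in the first block of a window the trailing \<open>2 * k\<close>
  letters begin; register 27, the number of letters before them, converts this into the candidate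
  position. The tests are those of \<open>cand_check\<close>; the constant 2 is its 1 plus one for
  the strict comparison.\<close>

definition P_cand :: "bool \<Rightarrow> com" where
  "P_cand rv = Asg 17 (Cst 0) ;; Asg 18 (Cst 0) ;; Asg 27 (V RM \<ominus> Cst 2 \<otimes> V Rk) ;;
     For 20 (V RNW \<oplus> Cst 1) (
       Asg 21 (Ld (V Rtab \<oplus> Ld (V RW \<oplus> V 20))) ;; Asg 22 (V 20 \<otimes> V Rk \<oplus> V 21) ;;
       Cond ((V 21 \<lless> V Rk) \<otimes> ((V 27 \<lless> V 22) \<otimes> (V 22 \<oplus> Cst 2 \<otimes> V Rk \<lless> V RN \<oplus> Cst 1)))
         (Asg 23 (V 22 \<ominus> V 27) ;;
          Cond ((ext rv (V 23) (Cst 2 \<otimes> V Rk) \<doteq> ext rv (Cst 0) (Cst 2 \<otimes> V Rk)) \<otimes>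
                (V 23 \<oplus> V RM \<lless> Ld (V Rnb \<oplus> (Op Div (V 23) (V Rk) \<oplus> Cst 2)) \<otimes> V Rk \<oplus> V Rk \<oplus> Cst 2))
            (P_ins rv) Skip)
         Skip)"

lemma mods_P_ins [simp]: "mods (P_ins rv) = {17, 18, 24, 25, 26, 28, 29}"
  by (auto simp: P_ins_def P_box_def P_z_def)

context params
begin

lemma block_stringI:
  assumes "rho_ok S rho" "\<And>j. 2 \<le> j \<Longrightarrow> j \<le> NW \<Longrightarrow> nb_ok S rho j (nb j)" "M_ok S rho M"
  shows "block_string S N k NW rho M nb"
proof
  show "1 \<le> k" "2 * k \<le> N" "NW = N div k" using k NW by simp_all
  show "1 \<le> rho" "rho \<le> k + 1" "rho \<le> k \<Longrightarrow> weq S rho 0 (2 * k - rho)"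
    "\<And>q. 1 \<le> q \<Longrightarrow> q < rho \<Longrightarrow> \<not> weq S q 0 (2 * k - q)"
    using assms(1) unfolding rho_ok_def by blast+
  show "rho = k + 1 \<Longrightarrow> M = 2 * k" "rho \<le> k \<Longrightarrow> 2 * k < M \<and> M \<le> N + 1"
    "\<And>x. rho \<le> k \<Longrightarrow> rho \<le> x \<Longrightarrow> x + 1 < M \<Longrightarrow> S x = S (x - rho)"
    "rho \<le> k \<Longrightarrow> M \<le> N \<Longrightarrow> S (M - 1) \<noteq> S (M - 1 - rho)"
    using assms(3) unfolding M_ok_def by blast+
  fix m assume "2 \<le> m" "m \<le> NW"
  note b = assms(2)[OF this, unfolded nb_ok_def]
  show "m \<le> nb m \<and> nb m \<le> NW" using b by blast
  show "nb m < NW \<Longrightarrow> \<exists>x. nb m * k \<le> x \<and> x < nb m * k + k \<and> S x \<noteq> S (x - rho)" using b by blast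
  show "\<And>x. m * k \<le> x \<Longrightarrow> x < nb m * k \<Longrightarrow> S x = S (x - rho)" using b by blast
qed

text \<open>Each block gained costs at most 150 steps, and the 1 pays for the comparison that
  fails.\<close>

lemma wp_z:
  assumes bs: "block_string S N k NW rho M nb"
    and par: "par s" and wins: "wins rv S s" and S: "\<And>x. S x < 2 ^ c"
    and p: "fst s 23 = p" and z0: "weq S p 0 (fst s 24 * k)" "p + fst s 24 * k \<le> N"
  shows "wp w (P_z rv) (\<lambda>s' T'. block_string.zb_ok S N k p (fst s' 24) \<and> fst s 24 \<le> fst s' 24 \<and>
     T' + 150 * fst s 24 \<le> T + 150 * (fst s' 24 + 1)) s T"
proof -
  interpret B: block_string S N k NW rho M nb by (rule bs)
  have x: "ev w ((V 23 \<oplus> V 24 \<otimes> V Rk \<oplus> V Rk \<lless> V RN \<oplus> Cst 1) \<otimes>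
      (ext rv (V 23 \<oplus> V 24 \<otimes> V Rk) (V Rk) \<doteq> ext rv (V 24 \<otimes> V Rk) (V Rk))) s'
      = of_bool (p + z * k + k \<le> N \<and> weq S (p + z * k) (z * k) k)"
    if ps: "par s'" "wins rv S s'" "fst s' 23 = p" "fst s' 24 = z" "p + z * k \<le> N" for s' z
  proof -
    have b: "z * k < 2 ^ w" "p + z * k < 2 ^ w" "p + z * k + k < 2 ^ w" using ps(5) sizes big by linarith+
    have 1: "ev w (V 23 \<oplus> V 24 \<otimes> V Rk \<oplus> V Rk \<lless> V RN \<oplus> Cst 1) s' = of_bool (p + z * k + k \<le> N)"
      using b ps par_D[OF ps(1)] sizes by (simp add: less_Suc_eq_le)
    have 2: "ev w (ext rv (V 23 \<oplus> V 24 \<otimes> V Rk) (V Rk) \<doteq> ext rv (V 24 \<otimes> V Rk) (V Rk)) s'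
      = of_bool (weq S (p + z * k) (z * k) k)"
      by (rule ev_ext_eq[OF ps(1,2) S]) (use b ps par_D[OF ps(1)] in simp_all)
    show ?thesis unfolding ev.simps(3)[of w Mul] 1 2 by simp
  qed
  show ?thesis
    unfolding P_z_def
  proof (rule wp_Whl[where m = "\<lambda>s'. N + 1 - fst s' 24" and I = "\<lambda>s' T'. weq S p 0 (fst s' 24 * k) \<and>
      p + fst s' 24 * k \<le> N \<and> fst s 24 \<le> fst s' 24 \<and> T' + 150 * fst s 24 \<le> T + 150 * fst s' 24"], goal_cases)
    case 1
    then show ?case using z0 by simp
  next
    case (2 s' T')
    define z where "z = fst s' 24"
    have ps: "par s'" "wins rv S s'" "fst s' 23 = p" "fst s' 24 = z" "p + z * k \<le> N"
      using 2(1,3,4) p by (auto simp: z_def intro: par_cong[OF par] wins_cong[OF wins])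
    have cc: "p + z * k + k \<le> N" "weq S (p + z * k) (z * k) k" using 2(2)[unfolded x[OF ps]] by simp_all
    have "weq S p 0 (z * k)" using 2(1) by (simp add: z_def)
    from weq_append[OF this, of k] cc have "weq S p 0 (Suc z * k)" by (simp add: add.commute)
    moreover have "z * 1 \<le> z * k" using k by (intro mult_le_mono2)
    then have "z < N" using cc(1) k by linarith
    ultimately show ?case
      using 2(1) cc sizes by (intro wp_AsgV[where v = "Suc z"]) (simp_all add: z_def)
  next
    case (3 s' T')
    define z where "z = fst s' 24"
    have ps: "par s'" "wins rv S s'" "fst s' 23 = p" "fst s' 24 = z" "p + z * k \<le> N"
      using 3(1,3,4) p by (auto simp: z_def intro: par_cong[OF par] wins_cong[OF wins])
    have n: "\<not> (p + z * k + k \<le> N \<and> weq S (p + z * k) (z * k) k)" using 3(2)[unfolded x[OF ps]] by simp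
    have "\<not> (p + z * k + k \<le> N \<and> weq S p 0 (z * k + k))"
      using n weq_shift[of S p 0 "z * k + k" "z * k" k] by auto
    then have "B.zb_ok p z" unfolding B.zb_ok_def using 3(1) by (simp add: z_def)
    then show ?case using 3(1) by (simp add: z_def)
  qed
qed

text \<open>What makes the amortisation work: a value that is not final reaches to within one block
  of the end of the box, so the comparisons that follow rescan at most one block.\<close>

lemma wp_box:
  assumes bs: "block_string S N k NW rho M nb"
    and par: "par s" and M: "fst s RM = M"
    and lst: "block_string.list_ok S N k NW M (\<lambda>e. snd s (fst s Rpos + e)) (\<lambda>e. snd s (fst s Rzb + e)) b"
    and p: "fst s 23 = p" "block_string.cand S N M p" "p + (M - 2 * k) < b + k"
    and box: "fst s 17 = l" "fst s 18 = zl"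
      "l = 0 \<and> zl = 0 \<or> block_string.cand S N M l \<and> block_string.zb_ok S N k l zl \<and> l < p"
    and adr: "fst s Rpos + NW < 2 ^ w" "fst s Rzb + NW < 2 ^ w"
  shows "wp w P_box (\<lambda>s' T'. T' \<le> T + 100 \<and>
     (fst s' 25 = 0 \<and> block_string.zb_ok S N k p (fst s' 24) \<or>
      fst s' 25 = 1 \<and> weq S p 0 (fst s' 24 * k) \<and> p + fst s' 24 * k \<le> N \<and>
        l + zl * k \<le> p + fst s' 24 * k + k)) s T"
proof -
  interpret B: block_string S N k NW rho M nb by (rule bs)
  have pN: "p \<le> N" "1 \<le> p" using p(2) unfolding B.cand_def by auto
  have r: "l + zl * k \<le> N" using box(3) unfolding B.zb_ok_def by auto
  have lt: "zl * k < 2 ^ w" "l + zl * k < 2 ^ w" "p < 2 ^ w" "zl * k + 1 < 2 ^ w" "l < 2 ^ w" using r pN sizes by linarith+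
  show ?thesis
    unfolding P_box_def
  proof (rule wp_Asg_Sq[where v = 0], simp, rule wp_Asg_Sq[where v = 1], simp,
      rule wp_Asg_Sq[where v = "l + zl * k"], use lt box par_D[OF par] in simp, rule wp_Cond, goal_cases)
    case 1
    then have pr: "p < l + zl * k" using p by (simp split: if_splits)
    then have l: "B.cand l" "B.zb_ok l zl" "l < p" using box(3) by auto
    define q where "q = p - l"
    define z0 where "z0 = (l + zl * k - p) div k"
    have qN: "q \<le> N" "1 \<le> q" "p = l + q" using pN l(3) by (simp_all add: q_def)
    have qk: "q div k \<le> NW" using div_le_NW[OF qN(1)] .
    define pos where "pos = (\<lambda>e. snd s (fst s Rpos + e))"
    define zb where "zb = (\<lambda>e. snd s (fst s Rzb + e))"
    note lst = lst[folded pos_def zb_def]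
    have bd: "fst s Rpos + q div k < 2 ^ w" "fst s Rzb + q div k < 2 ^ w" using adr qk by linarith+
    have ok: "B.zb_ok q (zb (q div k))" if "pos (q div k) = q"
      using B.list_okD(3)[OF lst qk] that qN by simp
    have cnd: "ev w ((Ld (V Rpos \<oplus> V 29) \<doteq> V 26) \<otimes>
              (V 26 \<oplus> Ld (V Rzb \<oplus> V 29) \<otimes> V Rk \<oplus> V Rk \<lless> V 18 \<otimes> V Rk \<oplus> Cst 1)) s'
       = of_bool (pos (q div k) = q \<and> q + zb (q div k) * k + k \<le> zl * k)"
      if s': "fst s' Rpos = fst s Rpos" "fst s' Rzb = fst s Rzb" "fst s' 29 = q div k" "fst s' 26 = q"
        "fst s' Rk = k" "fst s' 18 = zl" "snd s' = snd s" for s'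
    proof (cases "pos (q div k) = q")
      case True
      have "q + zb (q div k) * k \<le> N" using ok[OF True] unfolding B.zb_ok_def by simp
      then have b2: "zb (q div k) * k < 2 ^ w" "q + zb (q div k) * k < 2 ^ w" "q + zb (q div k) * k + k < 2 ^ w"
        using sizes big by linarith+
      then show ?thesis using s' bd lt True by (simp add: pos_def zb_def less_Suc_eq_le)
    next
      case False
      then have "ev w (Ld (V Rpos \<oplus> V 29) \<doteq> V 26) s' = of_bool False" using s' bd by (simp add: pos_def)
      then show ?thesis unfolding ev.simps(3)[of w Mul] using False by (simp add: binop_val.simps(3))
    qed
    have start: "weq S p 0 (z0 * k)" if "\<not> (pos (q div k) = q \<and> q + zb (q div k) * k + k \<le> zl * k)"
      unfolding z0_def
    proof (rule B.z_start[OF l(2,3) pr p(2)], fold q_def, intro impI)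
      assume c: "B.cand q"
      have "q < p" using l pN qN unfolding B.cand_def by linarith
      \<comment> \<open>Candidates are at least k apart, so the earlier candidate \<open>q\<close>
        lies before the sweep frontier and is already recorded.\<close>
      then have "q + k \<le> p" using c p(2) unfolding B.cand_def by (intro B.u_sparse) auto
      then have "q + (M - 2 * k) < b" using p(3) by linarith
      then have "pos (q div k) = q" by (rule B.list_ok_pos[OF lst c])
      then show "\<exists>z. B.zb_ok q z \<and> \<not> q + z * k + k \<le> zl * k" using ok that by blast
    qed
    have z0: "p + z0 * k \<le> l + zl * k" "l + zl * k \<le> p + z0 * k + k"
    proof -
      have "l + zl * k - p = z0 * k + (l + zl * k - p) mod k" "(l + zl * k - p) mod k < k"
        using k by (simp_all add: z0_def)
      then show "p + z0 * k \<le> l + zl * k" "l + zl * k \<le> p + z0 * k + k" using pr by linarith+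
    qed
    have copy: "B.zb_ok p (zb (q div k))" if "pos (q div k) = q" "q + zb (q div k) * k + k \<le> zl * k"
      using B.z_copy[OF l(2,3)] ok[OF that(1)] that(2) unfolding q_def by blast
    show ?case
      apply (rule wp_Asg_Sq[where v = z0])
      using par_D[OF par] p(1) pr lt apply (simp add: z0_def)
      apply (rule wp_Asg_Sq[where v = q])
      using box p(1) l lt apply (simp add: q_def)
      apply (rule wp_Asg_Sq[where v = "q div k"])
      using par_D[OF par] apply simp
    proof (rule wp_Cond, goal_cases)
      case 1
      then have "pos (q div k) = q \<and> q + zb (q div k) * k + k \<le> zl * k"
        by (subst (asm) cnd) (use box par_D[OF par] in simp_all)
      then show ?case
        using copy bd by (intro wp_Asg_Sq[where v = "zb (q div k)"] wp_AsgV[where v = 0]) (simp_all add: zb_def)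
    next
      case 2
      then have "\<not> (pos (q div k) = q \<and> q + zb (q div k) * k + k \<le> zl * k)"
        by (subst (asm) cnd) (use box par_D[OF par] in simp_all)
      then show ?case using start z0 r by simp
    qed
  next
    case 2
    then have "\<not> p < l + zl * k" using p by (simp split: if_splits)
    then show ?case using pN by (simp add: weq_def)
  qed
qed

text \<open>The cost is amortised against the right end \<open>l + zl * k\<close> of the box.\<close>

lemma wp_ins:
  assumes bs: "block_string S N k NW rho M nb"
    and par: "par s" and wins: "wins rv S s" and S: "\<And>x. S x < 2 ^ c" and M: "fst s RM = M"
    and lst: "block_string.list_ok S N k NW M (\<lambda>e. snd s (fst s Rpos + e)) (\<lambda>e. snd s (fst s Rzb + e)) b"
    and p: "fst s 23 = p" "block_string.cand S N M p" "p + (M - 2 * k) < b + k"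
    and box: "fst s 17 = l" "fst s 18 = zl"
      "l = 0 \<and> zl = 0 \<or> block_string.cand S N M l \<and> block_string.zb_ok S N k l zl \<and> l < p"
    and adr: "fst s Rpos + NW < 2 ^ w" "fst s Rzb + NW < 2 ^ w"
  shows "wp w (P_ins rv) (\<lambda>s' T'. (\<exists>z. block_string.zb_ok S N k p z \<and>
       snd s' = (snd s)(fst s Rpos + p div k := p, fst s Rzb + p div k := z)) \<and>
     (fst s' 17 = l \<and> fst s' 18 = zl \<or> fst s' 17 = p \<and> block_string.zb_ok S N k p (fst s' 18)) \<and>
     T' * k + 150 * (l + zl * k) \<le> T * k + 600 * k + 150 * (fst s' 17 + fst s' 18 * k)) s T"
  unfolding P_ins_def
proof (rule wp_SqF, rule wp_box[OF bs par M lst p box adr], goal_cases)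
  case (1 s1 T1)
  interpret B: block_string S N k NW rho M nb by (rule bs)
  have f: "\<And>x. x \<notin> {24, 25, 26, 28, 29} \<Longrightarrow> fst s1 x = fst s x" "snd s1 = snd s"
    using 1(2) unfolding frame_def by (auto simp: P_box_def)
  have par1: "par s1" "wins rv S s1" using f by (auto intro: par_cong[OF par] wins_cong[OF wins])
  have pk: "p div k \<le> NW" using p(2) unfolding B.cand_def by (intro div_le_NW) simp
  have bd: "fst s Rpos + p div k < 2 ^ w" "fst s Rzb + p div k < 2 ^ w" using adr pk by linarith+
  show ?case
  proof (rule wp_SqF[where R = "\<lambda>s' T'. B.zb_ok p (fst s' 24) \<and> fst s' 23 = p \<and> snd s' = snd s \<and>
     fst s' Rpos = fst s Rpos \<and> fst s' Rzb = fst s Rzb \<and> fst s' Rk = k \<and>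
     (fst s' 17 = l \<and> fst s' 18 = zl \<or> fst s' 17 = p \<and> fst s' 18 = fst s' 24) \<and>
     T' * k + 150 * (l + zl * k) \<le> T * k + 500 * k + 150 * (fst s' 17 + fst s' 18 * k)"], goal_cases)
    case 1
    show ?case
    proof (rule wp_Cond, goal_cases)
      case 1
      then have e: "weq S p 0 (fst s1 24 * k)" "p + fst s1 24 * k \<le> N" "l + zl * k \<le> p + fst s1 24 * k + k" "T1 \<le> T + 100"
        using \<open>T1 \<le> T + 100 \<and> _\<close> by auto
      have p1: "fst s1 23 = p" using f p by simp
      show ?case
      proof (rule wp_SqF, rule wp_z[OF bs par1 S p1 e(1,2)], goal_cases)
        case (1 s2 T2)
        have f2: "\<And>x. x \<noteq> 24 \<Longrightarrow> fst s2 x = fst s1 x" "snd s2 = snd s1"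
          using 1(2) unfolding frame_def by (auto simp: P_z_def)
        define z where "z = fst s2 24"
        \<comment> \<open>Times are multiplied by k because the right end of the box is measured in
          letters, whereas the scan pays per block.\<close>
        have t: "(T2 + 10) * k + 150 * (l + zl * k) \<le> T * k + 500 * k + 150 * (p + z * k)"
        proof -
          have "T2 + 10 + 150 * fst s1 24 \<le> T + 300 + 150 * z" using 1(1) e(4) by (simp add: z_def)
          then have "(T2 + 10 + 150 * fst s1 24) * k \<le> (T + 300 + 150 * z) * k" by (rule mult_le_mono1)
          moreover have "150 * (l + zl * k) \<le> 150 * (p + fst s1 24 * k + k)" using e(3) by (rule mult_le_mono2)
          ultimately show ?thesis by (simp add: algebra_simps)
        qed
        moreover have "(T2 + 4) * k \<le> (T2 + 10) * k" by (rule mult_le_mono1) simp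
        ultimately have "(T2 + 4) * k + 150 * (l + zl * k) \<le> T * k + 500 * k + 150 * (p + z * k)" by linarith
        then show ?case
          using 1(1) f f2 p par_D[OF par] by (simp add: z_def add_mult_distrib)
      qed
    next
      case 2
      then have z: "B.zb_ok p (fst s1 24)" and "T1 + 2 \<le> T + 500" using \<open>T1 \<le> T + 100 \<and> _\<close> by auto
      then have "(T1 + 2) * k \<le> (T + 500) * k" by (intro mult_le_mono1)
      then show ?case using z f p box par_D[OF par] by (simp add: add_mult_distrib)
    qed
  next
    case (2 s2 T2)
    have t: "(T2 + 12) * k + 150 * (l + zl * k) \<le> T * k + 600 * k + 150 * (fst s2 17 + fst s2 18 * k)"
      using 2(1) by (simp add: add_mult_distrib)
    show ?case
      apply (rule wp_Asg_Sq[where v = "p div k"])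
      using 2(1) apply simp
      apply (rule wp_Sto_Sq[where i = "fst s Rpos + p div k" and v = p])
      using 2(1) bd apply simp
      using 2(1) apply simp
      apply (rule wp_StoV[where i = "fst s Rzb + p div k" and v = "fst s2 24"])
      using 2(1) bd apply simp
      apply simp
      using 2(1) t by (auto simp: add.commute)
  qed
qed

end

context params
begin

definition tab_ok :: "bool \<Rightarrow> nat \<Rightarrow> (nat \<Rightarrow> nat) \<Rightarrow> bool" where
  "tab_ok rv v tab \<longleftrightarrow> (\<forall>y<2 ^ (3 * (k * c)). let a = tab y in a \<le> k \<and>
     (a < k \<longrightarrow> subw rv c (3 * k) y a (2 * k) = v) \<and> (\<forall>a'<a. subw rv c (3 * k) y a' (2 * k) \<noteq> v))"

lemma tab_okD:
  assumes tab: "tab_ok rv (wcode rv c S x0 (2 * k)) tab" and S: "\<And>x. S x < 2 ^ c"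
    and a: "a = tab (wcode rv c S x (3 * k))"
  shows "a \<le> k" "a < k \<Longrightarrow> weq S (x + a) x0 (2 * k)" "\<And>a'. a' < a \<Longrightarrow> \<not> weq S (x + a') x0 (2 * k)"
proof -
  have "wcode rv c S x (3 * k) < 2 ^ (3 * (k * c))"
    using wcode_less[where S = S and c = c and rv = rv and x = x and t = "3 * k", OF S] by (simp add: mult_ac)
  note t = tab[unfolded tab_ok_def, rule_format, OF this, folded a, unfolded Let_def]
  show ak: "a \<le> k" using t by blast
  have e: "subw rv c (3 * k) (wcode rv c S x (3 * k)) a' (2 * k) = wcode rv c S x0 (2 * k) \<longleftrightarrow> weq S (x + a') x0 (2 * k)"
    if "a' \<le> k" for a'
    using subw_wcode[where S = S and c = c and a = a' and t = "2 * k" and K = "3 * k" and rv = rv and x = x, OF S] that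
      wcode_eq_iff[where S = S and c = c, OF S] by simp
  show "weq S (x + a) x0 (2 * k)" if "a < k" using t e[OF ak] that by blast
  show "\<not> weq S (x + a') x0 (2 * k)" if "a' < a" for a' using t e[of a'] ak that by simp
qed

text \<open>By \<open>v_sparse\<close>, the first occurrence that the table reports is the only one
  that can be the end of a candidate in this range; the remaining conditions are those of
  \<open>cand_check\<close>.\<close>

lemma cand_iff:
  assumes bs: "block_string S N k NW rho M nb"
    and a: "a \<le> k" "a < k \<Longrightarrow> weq S (x + a) (M - 2 * k) (2 * k)"
      "\<And>a'. a' < a \<Longrightarrow> \<not> weq S (x + a') (M - 2 * k) (2 * k)"
  shows "block_string.cand S N M q \<and> x \<le> q + (M - 2 * k) \<and> q + (M - 2 * k) < x + k \<longleftrightarrow>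
    a < k \<and> M - 2 * k < x + a \<and> x + a + 2 * k \<le> N \<and> q = x + a - (M - 2 * k) \<and>
    weq S q 0 (2 * k) \<and> q + M \<le> nb (q div k + 2) * k + k + 1" (is "?L \<longleftrightarrow> ?R")
proof -
  interpret B: block_string S N k NW rho M nb by (rule bs)
  have M: "2 * k \<le> M" by (rule B.M_ge)
  show ?thesis
  proof
    assume L: ?L
    then have q: "1 \<le> q" "q + M \<le> N" "weq S q 0 M" unfolding B.cand_def by auto
    define a' where "a' = q + (M - 2 * k) - x"
    have a': "a' < k" "q + (M - 2 * k) = x + a'" using L by (auto simp: a'_def)
    have v: "weq S (x + a') (M - 2 * k) (2 * k)" using B.u_v[OF q(3)] a' by simp
    then have "a \<le> a'" using a(3) not_less by blast
    then have "a < k" using a' by simp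
    have "a = a'"
    proof (rule ccontr)
      assume "a \<noteq> a'"
      then show False using B.v_sparse[of "x + a" "x + a'"] a(2)[OF \<open>a < k\<close>] v \<open>a \<le> a'\<close> a' q by auto
    qed
    then have e: "x + a = q + (M - 2 * k)" using a' by simp
    have "M \<le> N" using q by simp
    have "weq S q 0 (2 * k) \<and> q + M \<le> nb (q div k + 2) * k + k + 1"
      using B.cand_check[OF \<open>M \<le> N\<close> q(2) B.u_v[OF q(3)]] q(3) by blast
    moreover have "M - 2 * k < x + a" "x + a + 2 * k \<le> N" "q = x + a - (M - 2 * k)"
      using e q M by linarith+
    ultimately show ?R using \<open>a < k\<close> by blast
  next
    assume R: ?R
    then have e: "x + a = q + (M - 2 * k)" "1 \<le> q" by auto
    have "q + M \<le> N" "M \<le> N" using e R M by linarith+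
    have "weq S (q + (M - 2 * k)) (M - 2 * k) (2 * k)" using a(2) R unfolding e(1)[symmetric] by blast
    then have "weq S q 0 M" using B.cand_check[OF \<open>M \<le> N\<close> \<open>q + M \<le> N\<close>] R by blast
    then have "B.cand q" using e(2) \<open>q + M \<le> N\<close> unfolding B.cand_def by blast
    moreover have "x \<le> q + (M - 2 * k)" "q + (M - 2 * k) < x + k" using e(1) R by linarith+
    ultimately show ?L by blast
  qed
qed

lemma wp_cand:
  assumes bs: "block_string S N k NW rho M (\<lambda>m. snd s (fst s Rnb + m))"
    and par: "par s" and wins: "wins rv S s" and S: "\<And>x. S x < 2 ^ c"
    and M: "fst s RM = M" "M \<le> N + 1"
    and tab: "tab_ok rv (wcode rv c S (M - 2 * k) (2 * k)) (\<lambda>y. snd s (fst s Rtab + y))"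
    and pos0: "\<And>m. m \<le> NW \<Longrightarrow> snd s (fst s Rpos + m) = 0"
    and adr: "fst s RW + NW < fst s Rnb" "fst s Rnb + NW < fst s Rpos" "fst s Rpos + NW < fst s Rzb"
      "fst s Rzb + NW < fst s Rtab" "fst s Rtab + 2 ^ (3 * (k * c)) \<le> 2 ^ w"
  shows "wp w (P_cand rv) (\<lambda>s' T'.
     block_string.list_ok S N k NW M (\<lambda>e. snd s' (fst s Rpos + e)) (\<lambda>e. snd s' (fst s Rzb + e)) ((NW + 1) * k) \<and>
     (\<forall>a. (a < fst s Rpos \<or> fst s Rpos + NW < a) \<longrightarrow> (a < fst s Rzb \<or> fst s Rzb + NW < a) \<longrightarrow> snd s' a = snd s a) \<and>
     T' \<le> T + 2000 * (NW + 2)) s T"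
proof -
  define nb where "nb = (\<lambda>m. snd s (fst s Rnb + m))"
  note bs = bs[folded nb_def]
  interpret B: block_string S N k NW rho M nb by (rule bs)
  let ?pos = "\<lambda>s'. (\<lambda>e. snd s' (fst s Rpos + e))" and ?zb = "\<lambda>s'. (\<lambda>e. snd s' (fst s Rzb + e))"
  define mm where "mm = M - 2 * k"
  have M2: "2 * k \<le> M" by (rule B.M_ge)
  have mm: "mm < 2 ^ w" "mm + 2 * k = M" "M < 2 ^ w" using M M2 sizes big by (simp_all add: mm_def)
  \<comment> \<open>In the time bound, multiplied by k, every block swept pays a fixed amount, and
    explicit comparisons are charged to the right end of the Z-box. Zeros encode the empty box
    before the first candidate.\<close>
  let ?J = "\<lambda>m s' T'. B.list_ok (?pos s') (?zb s') (m * k) \<and>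
     (\<forall>a. (a < fst s Rpos \<or> fst s Rpos + NW < a) \<longrightarrow> (a < fst s Rzb \<or> fst s Rzb + NW < a) \<longrightarrow> snd s' a = snd s a) \<and>
     (fst s' 17 = 0 \<and> fst s' 18 = 0 \<or> B.cand (fst s' 17) \<and> B.zb_ok (fst s' 17) (fst s' 18) \<and> fst s' 17 + mm < m * k) \<and>
     T' * k \<le> T * k + 20 * k + 1500 * (m * k) + 150 * (fst s' 17 + fst s' 18 * k)"
  show ?thesis
    unfolding P_cand_def
  proof (rule wp_Asg_Sq[where v = 0], simp, rule wp_Asg_Sq[where v = 0], simp,
      rule wp_Asg_Sq[where v = mm], use M M2 sizes par_D[OF par] in \<open>simp add: mm_def\<close>,
      rule wp_For_time[where L = "NW + 1" and J = ?J], goal_cases)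
    case 1
    have "T * k + 20 * k = (T + 20) * k" by (simp add: add_mult_distrib)
    moreover have "(T + 12) * k \<le> (T + 20) * k" by (rule mult_le_mono1) simp
    ultimately show ?case using pos0 by (simp add: B.list_ok_def add_mult_distrib)
  next
    case 2
    then show ?case using sizes by simp
  next
    case (3 s')
    then have "fst s' RNW = NW" using par_D[OF par] by (simp add: frame_reg)
    then show ?case using sizes by simp
  next
    case (4 m s' T')
    have r: "fst s' RW = fst s RW" "fst s' Rnb = fst s Rnb" "fst s' Rpos = fst s Rpos" "fst s' Rzb = fst s Rzb"
      "fst s' Rtab = fst s Rtab" "fst s' RM = M" "fst s' 27 = mm"
      using 4(4) M by (simp_all add: frame_reg)
    have p: "par s'" by (rule par_cong[OF par]) (use 4(4) in \<open>simp_all add: frame_reg\<close>)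
    have m: "m \<le> NW" "fst s' 20 = m" using 4(1,2) by simp_all
    have memW: "snd s' (fst s RW + j) = snd s (fst s RW + j)" if "j \<le> NW" for j
      using 4(3) adr that by simp
    have memnb: "snd s' (fst s Rnb + j) = nb j" if "j \<le> NW" for j
      using 4(3) adr that by (simp add: nb_def)
    have memT: "snd s' (fst s Rtab + y) = snd s (fst s Rtab + y)" for y
      using 4(3) adr by simp
    have wn: "wins rv S s'" by (rule wins_cong[OF wins]) (use r memW in simp_all)
    define W where "W = wcode rv c S (m * k) (3 * k)"
    have W: "snd s' (fst s RW + m) = W" "W < 2 ^ (3 * (k * c))"
      using wn m r wcode_less[where S = S and c = c and rv = rv and x = "m * k" and t = "3 * k", OF S] unfolding wins_def W_def by (simp_all add: mult_ac)
    define a where "a = snd s (fst s Rtab + W)"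
    note ta = tab_okD[where S = S and x = "m * k" and a = a, OF tab S, folded W_def, OF a_def]
    note ci = cand_iff[OF bs, where x = "m * k" and a = a, OF ta]
    have mk: "m * k \<le> N" using mk_le[OF m(1)] .
    have lt: "fst s RW + m < 2 ^ w" "fst s Rtab + W < 2 ^ w" "m * k < 2 ^ w" "m * k + a < 2 ^ w" "m * k + a + 2 * k < 2 ^ w"
      using adr W m mk ta(1) sizes big by linarith+
    define s1 where "s1 = ((fst s')(21 := a, 22 := m * k + a), snd s')"
    let ?c1 = "a < k \<and> mm < m * k + a \<and> m * k + a + 2 * k \<le> N"
    have c1: "ev w ((V 21 \<lless> V Rk) \<otimes> ((V 27 \<lless> V 22) \<otimes> (V 22 \<oplus> Cst 2 \<otimes> V Rk \<lless> V RN \<oplus> Cst 1))) s1 = of_bool ?c1"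
    proof -
      have 1: "ev w (V 21 \<lless> V Rk) s1 = of_bool (a < k)" "ev w (V 27 \<lless> V 22) s1 = of_bool (mm < m * k + a)"
        "ev w (V 22 \<oplus> Cst 2 \<otimes> V Rk \<lless> V RN \<oplus> Cst 1) s1 = of_bool (m * k + a + 2 * k \<le> N)"
        using r par_D[OF p] lt sizes by (simp_all add: s1_def less_Suc_eq_le)
      show ?thesis unfolding ev.simps(3)[of w Mul] 1 by simp
    qed
    let ?Q = "\<lambda>s'' T''. fst s'' 20 = m \<and> ?J (Suc m) ((fst s'')(20 := Suc m), snd s'') (T'' + cost (V RNW \<oplus> Cst 1) + 9)"
    have skip: "?Q s2 T2" if s2: "snd s2 = snd s'" "fst s2 20 = m" "fst s2 17 = fst s' 17" "fst s2 18 = fst s' 18"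
      and no: "\<And>q. B.cand q \<Longrightarrow> m * k \<le> q + mm \<Longrightarrow> q + mm < m * k + k \<Longrightarrow> False" and T2: "T2 \<le> T' + 1000" for s2 :: st and T2
    proof -
      have "B.list_ok (?pos s') (?zb s') (Suc m * k)"
        by (rule B.list_ok_extend[OF conjunct1[OF 4(3)]]) (use no in \<open>auto simp: mm_def add.commute\<close>)
      moreover have "(T2 + 12) * k \<le> (T' + 1500) * k" using T2 by (intro mult_le_mono1) simp
      then have "(T2 + 12) * k \<le> T * k + 20 * k + 1500 * (Suc m * k) + 150 * (fst s' 17 + fst s' 18 * k)"
        using conjunct2[OF conjunct2[OF conjunct2[OF 4(3)]]] by (simp add: add_mult_distrib)
      moreover have "fst s' 17 + mm < Suc m * k" if "fst s' 17 + mm < m * k" using that by simp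
      then have "fst s' 17 = 0 \<and> fst s' 18 = 0 \<or> B.cand (fst s' 17) \<and> B.zb_ok (fst s' 17) (fst s' 18) \<and> fst s' 17 + mm < Suc m * k"
        using 4(3) by blast
      moreover note conjunct1[OF conjunct2[OF 4(3)]]
      moreover have "cost (V RNW \<oplus> Cst 1) + 9 = 12" by simp
      ultimately show ?thesis using s2 by (simp only: fst_conv snd_conv fun_upd_apply add.assoc) simp
    qed
    have "wp w (Cond ((V 21 \<lless> V Rk) \<otimes> ((V 27 \<lless> V 22) \<otimes> (V 22 \<oplus> Cst 2 \<otimes> V Rk \<lless> V RN \<oplus> Cst 1)))
         (Asg 23 (V 22 \<ominus> V 27) ;;
          Cond ((ext rv (V 23) (Cst 2 \<otimes> V Rk) \<doteq> ext rv (Cst 0) (Cst 2 \<otimes> V Rk)) \<otimes>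
                (V 23 \<oplus> V RM \<lless> Ld (V Rnb \<oplus> (Op Div (V 23) (V Rk) \<oplus> Cst 2)) \<otimes> V Rk \<oplus> V Rk \<oplus> Cst 2))
            (P_ins rv) Skip)
         Skip) ?Q s1 (T' + cost (Ld (V Rtab \<oplus> Ld (V RW \<oplus> V 20))) + 1 + cost (V 20 \<otimes> V Rk \<oplus> V 21) + 1)"
    proof (rule wp_Cond, goal_cases)
      case 2
      have "\<not> ?c1" using 2[unfolded c1] by simp
      then have "\<not> (B.cand q \<and> m * k \<le> q + mm \<and> q + mm < m * k + k)" for q
        using ci[of q] unfolding mm_def by blast
      then show ?case unfolding wp_Skip_eq by (intro skip) (auto simp: s1_def m)
    next
      case 1
      have cc: "a < k" "mm < m * k + a" "m * k + a + 2 * k \<le> N" using 1[unfolded c1] by simp_all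
      define q where "q = m * k + a - mm"
      have q: "1 \<le> q" "q + mm = m * k + a" "q + M \<le> N" using cc mm by (simp_all add: q_def)
      define s2 where "s2 = ((fst s1)(23 := q), snd s1)"
      have p2: "par s2" "wins rv S s2" using p wn by (simp_all add: s2_def s1_def)
      have "q + 2 * k \<le> N" using q mm by linarith
      note qd = B.next_block_le[OF this]
      let ?c2 = "weq S q 0 (2 * k) \<and> q + M \<le> nb (q div k + 2) * k + k + 1"
      have c2: "ev w ((ext rv (V 23) (Cst 2 \<otimes> V Rk) \<doteq> ext rv (Cst 0) (Cst 2 \<otimes> V Rk)) \<otimes>
                (V 23 \<oplus> V RM \<lless> Ld (V Rnb \<oplus> (Op Div (V 23) (V Rk) \<oplus> Cst 2)) \<otimes> V Rk \<oplus> V Rk \<oplus> Cst 2)) s2 = of_bool ?c2"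
      proof -
        have 1: "ev w (ext rv (V 23) (Cst 2 \<otimes> V Rk) \<doteq> ext rv (Cst 0) (Cst 2 \<otimes> V Rk)) s2 = of_bool (weq S q 0 (2 * k))"
          by (rule ev_ext_eq[OF p2 S]) (use par_D[OF p2(1)] q sizes in \<open>simp_all add: s2_def\<close>)
        have n: "snd s' (fst s Rnb + (q div k + 2)) = nb (q div k + 2)" using memnb[OF qd] .
        have nN: "nb (q div k + 2) * k \<le> N" using B.nb[OF _ qd] by (intro mk_le) simp
        have b: "fst s Rnb + (q div k + 2) < 2 ^ w" "q div k + 2 < 2 ^ w" "nb (q div k + 2) * k < 2 ^ w"
          "nb (q div k + 2) * k + k < 2 ^ w" "nb (q div k + 2) * k + k + 2 < 2 ^ w" "q + M < 2 ^ w"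
          using adr qd nN sizes big q by linarith+
        have 2: "ev w (V 23 \<oplus> V RM \<lless> Ld (V Rnb \<oplus> (Op Div (V 23) (V Rk) \<oplus> Cst 2)) \<otimes> V Rk \<oplus> V Rk \<oplus> Cst 2) s2
           = of_bool (q + M < nb (q div k + 2) * k + k + 2)"
          using r b n par_D[OF p] by (simp add: s2_def s1_def)
        show ?thesis unfolding ev.simps(3)[of w Mul] 1 2 by (simp add: less_Suc_eq_le)
      qed
      show ?case
        apply (rule wp_Asg_Sq[where v = q])
        using r cc lt apply (simp add: s1_def q_def)
        unfolding s2_def[symmetric]
      proof (rule wp_Cond, goal_cases)
        case 2
        have "\<not> ?c2" using 2[unfolded c2] by simp
        then have "\<not> (B.cand q' \<and> m * k \<le> q' + mm \<and> q' + mm < m * k + k)" for q'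
          using ci[of q'] q_def unfolding mm_def by blast
        then show ?case unfolding wp_Skip_eq by (intro skip) (auto simp: s1_def s2_def m)
      next
        case 1
        have "?c2" using 1[unfolded c2] by simp
        then have cq: "B.cand q" using ci[of q] cc q unfolding mm_def by (metis q_def mm_def)
        have uniq: "q' = q" if "B.cand q'" "q' + mm < Suc m * k" "m * k \<le> q' + mm" for q'
          using ci[of q'] that unfolding mm_def[symmetric] by (simp add: q_def add.commute)
        note L = 4(3)[THEN conjunct1]
        have lq: "fst s' 17 < q" if "fst s' 17 + mm < m * k" using that q by linarith
        have bx: "fst s' 17 = 0 \<and> fst s' 18 = 0 \<or> B.cand (fst s' 17) \<and> B.zb_ok (fst s' 17) (fst s' 18) \<and> fst s' 17 < q"
          using 4(3) lq by blast
        show ?case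
        proof (rule wp_monoF, rule wp_ins[OF bs p2 S, where b = "m * k" and p = q and l = "fst s' 17" and zl = "fst s' 18"], goal_cases)
          case (11 s3 T3)
          obtain z where z: "B.zb_ok q z" "snd s3 = (snd s2)(fst s2 Rpos + q div k := q, fst s2 Rzb + q div k := z)"
            using 11(1) by blast
          have qk: "q div k \<le> NW" using qd by simp
          have mem3: "snd s3 = (snd s')(fst s Rpos + q div k := q, fst s Rzb + q div k := z)"
            using z(2) r by (simp add: s2_def s1_def)
          have "B.list_ok ((?pos s')(q div k := q)) ((?zb s')(q div k := z)) (Suc m * k)"
            by (rule B.list_ok_insert[OF L cq z(1)]) (use q cc uniq in \<open>simp_all add: mm_def[symmetric]\<close>)
          then have l3: "B.list_ok (?pos s3) (?zb s3) (Suc m * k)"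
          proof -
            assume l: "B.list_ok ((?pos s')(q div k := q)) ((?zb s')(q div k := z)) (Suc m * k)"
            have e: "?pos s3 e = ((?pos s')(q div k := q)) e" "?zb s3 e = ((?zb s')(q div k := z)) e" if "e \<le> NW" for e
              using mem3 that qk adr by auto
            have dk: "q' div k \<le> NW" if "B.cand q'" for q' using that unfolding B.cand_def by (intro div_le_NW) simp
            show ?thesis using l e dk unfolding B.list_ok_def by metis
          qed
          have fr3: "\<forall>a. (a < fst s Rpos \<or> fst s Rpos + NW < a) \<longrightarrow> (a < fst s Rzb \<or> fst s Rzb + NW < a) \<longrightarrow> snd s3 a = snd s a"
            using 4(3) mem3 qk by auto
          have r3: "fst s3 20 = m" using frame_reg[OF 11(2)] m by (simp add: s2_def s1_def)
          have b3: "fst s3 17 = 0 \<and> fst s3 18 = 0 \<or> B.cand (fst s3 17) \<and> B.zb_ok (fst s3 17) (fst s3 18) \<and> fst s3 17 + mm < Suc m * k"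
            using 11(1) 4(3) cq q cc by auto
          have t3: "(12 + T3) * k \<le> T * k + 20 * k + 1500 * (Suc m * k) + 150 * (fst s3 17 + fst s3 18 * k)"
            using 11(1) 4(3) by (simp add: add_mult_distrib split: if_splits)
          show ?case using l3 fr3 r3 b3 t3 by simp
        qed (use r L bx q cc cq adr m in \<open>simp_all add: s2_def s1_def mm_def\<close>)
      qed
    qed
    note C = this[unfolded s1_def]
    show ?case
    proof (rule wp_Asg_Sq[where v = a], goal_cases)
      case 1
      show ?case using r m W lt by (simp add: a_def memT)
    next
      case 2
      show ?case
      proof (rule wp_Asg_Sq[where v = "m * k + a"], goal_cases)
        case 1
        show ?case using par_D[OF p] r m lt by simp
      next
        case 2
        show ?case using C by (simp only: fst_conv snd_conv)
      qed
    qed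
  next
    case (5 s' T')
    \<comment> \<open>The box never leaves the string, so the charged part is linear in
      \<open>N\<close>, and dividing by k gives a bound linear in the number of blocks.\<close>
    have "fst s' 17 + fst s' 18 * k \<le> N" using 5(1) unfolding B.zb_ok_def by auto
    then have "T' * k + 10 * k \<le> T * k + 30 * k + 1500 * ((NW + 1) * k) + 150 * (NW * k + k)"
      using 5(1) NWk by auto
    also have "\<dots> = (T + 30 + 1500 * (NW + 1) + 150 * (NW + 1)) * k" by (simp add: algebra_simps)
    finally have "(T' + 10) * k \<le> (T + 30 + 1500 * (NW + 1) + 150 * (NW + 1)) * k" by (simp add: algebra_simps)
    then have "T' + 10 \<le> T + 30 + 1500 * (NW + 1) + 150 * (NW + 1)" using k by simp
    then show ?case using 5(1) by simp
  qed
qed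

end

section \<open>Building the structure and performing one test\<close>

definition P_build :: "bool \<Rightarrow> com" where
  "P_build rv = P_win rv ;; P_rho rv ;; P_nb rv ;; P_M rv ;; P_tab rv ;; P_cand rv"

text \<open>The shift is in register 30, the length in 31, the answer in 32. Up to
  \<open>2 * k\<close> letters are compared directly; lengths below \<open>M\<close> follow
  \<open>mid_query\<close>, all others \<open>long_query\<close>.\<close>

definition P_occ :: "bool \<Rightarrow> com" where
  "P_occ rv = Cond (V 31 \<lless> Cst 2 \<otimes> V Rk \<oplus> Cst 1)
     (Asg 32 (ext rv (V 30) (V 31) \<doteq> ext rv (Cst 0) (V 31)))
     (Cond (V 31 \<lless> V RM)
       (Asg 32 ((ext rv (V 30) (Cst 2 \<otimes> V Rk) \<doteq> ext rv (Cst 0) (Cst 2 \<otimes> V Rk)) \<otimes>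
          ((V 30 \<oplus> V 31 \<lless> Ld (V Rnb \<oplus> (Op Div (V 30) (V Rk) \<oplus> Cst 2)) \<otimes> V Rk \<oplus> V Rk \<oplus> Cst 1) \<otimes>
           (ext rv (V 30 \<oplus> V 31 \<ominus> V Rk) (V Rk) \<doteq> ext rv (V 31 \<ominus> V Rk) (V Rk)))))
       (Cond (Ld (V Rpos \<oplus> Op Div (V 30) (V Rk)) \<doteq> V 30)
         (Asg 32 ((V 31 \<lless> Ld (V Rzb \<oplus> Op Div (V 30) (V Rk)) \<otimes> V Rk \<oplus> V Rk \<oplus> Cst 1) \<otimes>
           (ext rv (V 30 \<oplus> V 31 \<ominus> V Rk) (V Rk) \<doteq> ext rv (V 31 \<ominus> V Rk) (V Rk))))
         (Asg 32 (Cst 0))))"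

lemma mods_P_build: "mods (P_build rv) = {Rrho, RM, 16, 17, 18, 20, 21, 22, 23, 24, 25, 26, 27, 28, 29}"
  by (auto simp: P_build_def P_win_def P_rho_def P_nb_def P_M_def P_tab_def P_cand_def)

lemma mods_P_occ [simp]: "mods (P_occ rv) = {32}" and no_store_P_occ [simp]: "no_store (P_occ rv)"
  by (simp_all add: P_occ_def)

lemma block_string_cong:
  assumes bs: "block_string S N k NW rho M nb" and eq: "\<And>m. m \<le> NW \<Longrightarrow> nb' m = nb m"
  shows "block_string S N k NW rho M nb'"
  using bs unfolding block_string_def by (simp add: eq) metis

context params
begin

text \<open>\<open>rho\<close> is existential because \<open>M\<close> and \<open>nb\<close>
  summarise all that a test has to know of it.\<close>

definition ds_ok :: "bool \<Rightarrow> (nat \<Rightarrow> nat) \<Rightarrow> st \<Rightarrow> bool" where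
  "ds_ok rv S s \<longleftrightarrow> par s \<and> wins rv S s \<and> fst s RM \<le> N + 1 \<and>
     fst s Rnb + NW < 2 ^ w \<and> fst s Rpos + NW < 2 ^ w \<and> fst s Rzb + NW < 2 ^ w \<and>
     (\<exists>rho. block_string S N k NW rho (fst s RM) (\<lambda>m. snd s (fst s Rnb + m))) \<and>
     block_string.list_ok S N k NW (fst s RM) (\<lambda>e. snd s (fst s Rpos + e)) (\<lambda>e. snd s (fst s Rzb + e)) ((NW + 1) * k)"

lemma list_ok_cong:
  assumes bs: "block_string S N k NW rho M nb"
    and l: "block_string.list_ok S N k NW M pos zb b"
    and eq: "\<And>e. e \<le> NW \<Longrightarrow> pos' e = pos e" "\<And>e. e \<le> NW \<Longrightarrow> zb' e = zb e"
  shows "block_string.list_ok S N k NW M pos' zb' b"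
proof -
  interpret B: block_string S N k NW rho M nb by (rule bs)
  have dk: "q div k \<le> NW" if "B.cand q" for q using that unfolding B.cand_def by (intro div_le_NW) simp
  show ?thesis using l eq dk unfolding B.list_ok_def by metis
qed

text \<open>Transfers a finished structure to later states, in which scratch registers have changed,
  the registers above have been reloaded, or cells outside the arrays have been written.\<close>

lemma ds_ok_cong:
  assumes ds: "ds_ok rv S s"
    and r: "\<And>x. x \<in> {Rk, Rc, RN, RNW, RM, RW, Rnb, Rpos, Rzb} \<Longrightarrow> fst s' x = fst s x"
    and m: "\<And>j. j \<le> NW \<Longrightarrow> snd s' (fst s RW + j) = snd s (fst s RW + j)"
      "\<And>j. j \<le> NW \<Longrightarrow> snd s' (fst s Rnb + j) = snd s (fst s Rnb + j)"
      "\<And>j. j \<le> NW \<Longrightarrow> snd s' (fst s Rpos + j) = snd s (fst s Rpos + j)"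
      "\<And>j. j \<le> NW \<Longrightarrow> snd s' (fst s Rzb + j) = snd s (fst s Rzb + j)"
  shows "ds_ok rv S s'"
proof -
  obtain rho where bs: "block_string S N k NW rho (fst s RM) (\<lambda>m. snd s (fst s Rnb + m))"
    using ds unfolding ds_ok_def by blast
  have rr: "fst s' Rk = fst s Rk" "fst s' Rc = fst s Rc" "fst s' RN = fst s RN" "fst s' RNW = fst s RNW"
    "fst s' RM = fst s RM" "fst s' RW = fst s RW" "fst s' Rnb = fst s Rnb" "fst s' Rpos = fst s Rpos" "fst s' Rzb = fst s Rzb"
    by (simp_all add: r)
  have "par s'" by (rule par_cong[of s]) (use ds rr in \<open>simp_all add: ds_ok_def\<close>)
  moreover have "wins rv S s'" by (rule wins_cong[of _ _ s]) (use ds rr m in \<open>simp_all add: ds_ok_def\<close>)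
  moreover have "block_string S N k NW rho (fst s' RM) (\<lambda>m. snd s' (fst s' Rnb + m))"
    using block_string_cong[OF bs, of "\<lambda>m. snd s' (fst s Rnb + m)"] m(2) rr by simp
  moreover have "block_string.list_ok S N k NW (fst s' RM) (\<lambda>e. snd s' (fst s' Rpos + e)) (\<lambda>e. snd s' (fst s' Rzb + e)) ((NW + 1) * k)"
    unfolding rr by (rule list_ok_cong[OF bs]) (use ds m in \<open>auto simp: ds_ok_def\<close>)
  ultimately show ?thesis using ds rr unfolding ds_ok_def by auto
qed

lemma wp_occ:
  assumes ds: "ds_ok rv S s" and S: "\<And>x. S x < 2 ^ c"
    and d: "fst s 30 = d" "fst s 31 = l" "1 \<le> d" "d + l \<le> N"
  shows "wp w (P_occ rv) (\<lambda>s' T'. fst s' 32 = of_bool (weq S d 0 l) \<and> T' \<le> T + 500) s T"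
proof -
  obtain rho where bs: "block_string S N k NW rho (fst s RM) (\<lambda>m. snd s (fst s Rnb + m))"
    using ds unfolding ds_ok_def by blast
  interpret B: block_string S N k NW rho "fst s RM" "\<lambda>m. snd s (fst s Rnb + m)" by (rule bs)
  have p: "par s" "wins rv S s" and M: "fst s RM \<le> N + 1"
    and bd: "fst s Rnb + NW < 2 ^ w" "fst s Rpos + NW < 2 ^ w" "fst s Rzb + NW < 2 ^ w"
    and lst: "B.list_ok (\<lambda>e. snd s (fst s Rpos + e)) (\<lambda>e. snd s (fst s Rzb + e)) ((NW + 1) * k)"
    using ds unfolding ds_ok_def by auto
  note pr = par_D[OF p(1)]
  have M2: "2 * k \<le> fst s RM" by (rule B.M_ge)
  have lt: "d + l < 2 ^ w" "2 * k + 1 < 2 ^ w" using d sizes big by linarith+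
  have last: "ev w (ext rv (V 30 \<oplus> V 31 \<ominus> V Rk) (V Rk) \<doteq> ext rv (V 31 \<ominus> V Rk) (V Rk)) s
     = of_bool (weq S (d + l - k) (l - k) k)" if "2 * k < l"
    by (rule ev_ext_eq[OF p S]) (use that pr d lt sizes in simp_all)
  show ?thesis
    unfolding P_occ_def
  proof (rule wp_Cond, goal_cases)
    case 1
    then have l: "l \<le> 2 * k" using pr d lt sizes by (simp split: if_splits)
    have e: "ev w (ext rv (V 30) (V 31) \<doteq> ext rv (Cst 0) (V 31)) s = of_bool (weq S d 0 l)"
      by (rule ev_ext_eq[OF p S]) (use l d in simp_all)
    show ?case by (rule wp_AsgV[OF e]) simp
  next
    case 2
    then have l: "2 * k < l" using pr d lt sizes by (simp split: if_splits)
    note lst' = last[OF l]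
    show ?case
    proof (rule wp_Cond, goal_cases)
      case 1
      then have lM: "l < fst s RM" using d by (simp split: if_splits)
      have qd: "d div k + 2 \<le> NW" by (rule B.next_block_le) (use l d in linarith)
      have nN: "snd s (fst s Rnb + (d div k + 2)) * k \<le> N" using B.nb[OF _ qd] by (intro mk_le) simp
      have 1: "ev w (ext rv (V 30) (Cst 2 \<otimes> V Rk) \<doteq> ext rv (Cst 0) (Cst 2 \<otimes> V Rk)) s = of_bool (weq S d 0 (2 * k))"
        by (rule ev_ext_eq[OF p S]) (use pr d sizes in simp_all)
      have b: "fst s Rnb + (d div k + 2) < 2 ^ w" "d div k + 2 < 2 ^ w" "snd s (fst s Rnb + (d div k + 2)) * k < 2 ^ w"
          "snd s (fst s Rnb + (d div k + 2)) * k + k < 2 ^ w" "snd s (fst s Rnb + (d div k + 2)) * k + k + 1 < 2 ^ w"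
        using bd qd nN sizes big by linarith+
      have 2: "ev w (V 30 \<oplus> V 31 \<lless> Ld (V Rnb \<oplus> (Op Div (V 30) (V Rk) \<oplus> Cst 2)) \<otimes> V Rk \<oplus> V Rk \<oplus> Cst 1) s
        = of_bool (d + l \<le> snd s (fst s Rnb + (d div k + 2)) * k + k)"
        using pr d lt b by (simp add: less_Suc_eq_le)
      have e: "ev w ((ext rv (V 30) (Cst 2 \<otimes> V Rk) \<doteq> ext rv (Cst 0) (Cst 2 \<otimes> V Rk)) \<otimes>
          ((V 30 \<oplus> V 31 \<lless> Ld (V Rnb \<oplus> (Op Div (V 30) (V Rk) \<oplus> Cst 2)) \<otimes> V Rk \<oplus> V Rk \<oplus> Cst 1) \<otimes>
           (ext rv (V 30 \<oplus> V 31 \<ominus> V Rk) (V Rk) \<doteq> ext rv (V 31 \<ominus> V Rk) (V Rk)))) s = of_bool (weq S d 0 l)"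
        unfolding ev.simps(3)[of w Mul] 1 2 lst' B.mid_query[OF l lM d(4)] by simp
      show ?case by (rule wp_AsgV[OF e]) simp
    next
      case 2
      then have lM: "fst s RM \<le> l" using d by (simp split: if_splits)
      have dk: "d div k \<le> NW" using d by (intro div_le_NW) simp
      have NN: "N \<le> (NW + 1) * k" using NWk by simp
      note lq = B.long_query[OF lst NN d(3) lM d(4)]
      have b: "fst s Rpos + d div k < 2 ^ w" "fst s Rzb + d div k < 2 ^ w" using bd dk by linarith+
      show ?case
      proof (rule wp_Cond, goal_cases)
        case 1
        then have ps: "snd s (fst s Rpos + d div k) = d" using pr d b by (simp split: if_splits)
        define z where "z = snd s (fst s Rzb + d div k)"
        have "B.zb_ok d z" using B.list_okD(3)[OF lst dk] ps d by (simp add: z_def)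
        then have "z * k \<le> N" unfolding B.zb_ok_def by simp
        then have b2: "z * k < 2 ^ w" "z * k + k < 2 ^ w" "z * k + k + 1 < 2 ^ w" using sizes big by linarith+
        have 1: "ev w (V 31 \<lless> Ld (V Rzb \<oplus> Op Div (V 30) (V Rk)) \<otimes> V Rk \<oplus> V Rk \<oplus> Cst 1) s = of_bool (l \<le> z * k + k)"
          using pr d b b2 by (simp add: less_Suc_eq_le z_def)
        have e: "ev w ((V 31 \<lless> Ld (V Rzb \<oplus> Op Div (V 30) (V Rk)) \<otimes> V Rk \<oplus> V Rk \<oplus> Cst 1) \<otimes>
           (ext rv (V 30 \<oplus> V 31 \<ominus> V Rk) (V Rk) \<doteq> ext rv (V 31 \<ominus> V Rk) (V Rk))) s = of_bool (weq S d 0 l)"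
          unfolding ev.simps(3)[of w Mul] 1 lst' lq using ps by (simp add: z_def)
        show ?case by (rule wp_AsgV[OF e]) simp
      next
        case 2
        then have ps: "snd s (fst s Rpos + d div k) \<noteq> d" using pr d b by (simp split: if_splits)
        then have "\<not> weq S d 0 l" using lq by simp
        then show ?case by (intro wp_AsgV[where v = 0]) simp_all
      qed
    qed
  qed
qed

lemma fstr_less: "(\<And>x. B x < 2 ^ c) \<Longrightarrow> fstr rv B k N x < 2 ^ c"
  by (simp add: fstr_def)

lemma wp_build:
  assumes par: "par s" and blocks: "blocks B s" and B: "\<And>x. B x < 2 ^ c"
    and adr: "fst s RA + NW + 7 \<le> fst s RW" "fst s RW + NW < fst s Rnb" "fst s Rnb + NW < fst s Rpos"
      "fst s Rpos + NW < fst s Rzb" "fst s Rzb + NW < fst s Rtab" "fst s Rtab + 2 ^ (3 * (k * c)) \<le> 2 ^ w"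
  shows "wp w (P_build rv) (\<lambda>s' T'. ds_ok rv (fstr rv B k N) s' \<and>
     (\<forall>a<fst s RW. snd s' a = snd s a) \<and>
     T' \<le> T + 3000 * (NW + 2) + 200 * (k + 2) * (2 ^ (3 * (k * c)) + 1) + 400 * (k + 2)) s T"
proof -
  let ?S = "fstr rv B k N"
  have S: "\<And>x. ?S x < 2 ^ c" using B by (rule fstr_less)
  have b2: "fst s Rpos + NW < 2 ^ w" "fst s Rnb + NW < 2 ^ w" "fst s Rzb + NW < 2 ^ w" using adr by linarith+
  have "fst s RW + NW < fst s Rpos" using adr by linarith
  note win = wp_win[OF par blocks B adr(1) this b2(1)]
  show ?thesis
    unfolding P_build_def
  proof (rule wp_SqF, rule win, goal_cases)
    case (1 s1 T1)
        note g1 = 1(1)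
    note r1 = frame_reg[OF 1(2)]
    have q1: "fst s1 Rnb = fst s Rnb" "fst s1 Rpos = fst s Rpos" "fst s1 Rzb = fst s Rzb" "fst s1 RW = fst s RW" "fst s1 Rtab = fst s Rtab"
      by (simp_all add: r1 P_win_def)
    have p1: "par s1" by (rule par_cong[OF par]) (simp_all add: r1 P_win_def)
    have w1: "wins rv ?S s1" using 1(1) by blast
    show ?case
    proof (rule wp_SqF, rule wp_rho[OF p1 w1 S], goal_cases)
      case (1 s2 T2)
        note g2 = 1(1)
      note r2 = frame_reg[OF 1(2)]
      have q2: "fst s2 Rnb = fst s Rnb" "fst s2 Rpos = fst s Rpos" "fst s2 Rzb = fst s Rzb" "fst s2 RW = fst s RW" "fst s2 Rtab = fst s Rtab"
        by (simp_all add: r2 P_rho_def q1)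
      have m2: "snd s2 = snd s1" using frame_mem[OF 1(2)] by (simp add: P_rho_def)
      have p2: "par s2" by (rule par_cong[OF p1]) (simp_all add: r2 P_rho_def)
      have w2: "wins rv ?S s2" by (rule wins_cong[OF w1]) (simp_all add: r2 P_rho_def m2)
      have rho2: "1 \<le> fst s2 Rrho" "fst s2 Rrho \<le> k + 1" using 1(1) unfolding rho_ok_def by auto
      show ?case
      proof (rule wp_SqF, rule wp_nb[OF p2 w2 S rho2], use q2 adr in simp, use q2 b2 in simp, goal_cases)
        case (1 s3 T3)
        note g3 = 1(1)
        note r3 = frame_reg[OF 1(2)]
        have q3: "fst s3 Rnb = fst s Rnb" "fst s3 Rpos = fst s Rpos" "fst s3 Rzb = fst s Rzb" "fst s3 RW = fst s RW" "fst s3 Rtab = fst s Rtab"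
          "fst s3 Rrho = fst s2 Rrho"
          by (simp_all add: r3 P_nb_def q2)
        have p3: "par s3" by (rule par_cong[OF p2]) (simp_all add: r3 P_nb_def)
        have w3: "wins rv ?S s3" by (rule wins_cong[OF w2]) (use 1(1) adr in \<open>simp_all add: q3 q2\<close>)
        have rho3: "rho_ok ?S (fst s3 Rrho)" using g2 q3 by simp
        have nb3: "nb_ok ?S (fst s3 Rrho) j (snd s3 (fst s Rnb + j))" if "2 \<le> j" "j \<le> NW" for j
          using 1(1) that q2 q3 by simp
        have nb32: "nb_ok ?S (fst s3 Rrho) 2 (snd s3 (fst s3 Rnb + 2))" using nb3[of 2] sizes q3 by simp
        show ?case
        proof (rule wp_SqF, rule wp_M[OF p3 w3 S rho3 nb32], use q3 b2 in simp, goal_cases)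
          case (1 s4 T4)
        note g4 = 1(1)
          note r4 = frame_reg[OF 1(2)]
          have q4: "fst s4 Rnb = fst s Rnb" "fst s4 Rpos = fst s Rpos" "fst s4 Rzb = fst s Rzb" "fst s4 RW = fst s RW" "fst s4 Rtab = fst s Rtab"
            "fst s4 Rrho = fst s3 Rrho"
            by (simp_all add: r4 P_M_def q3)
          have m4: "snd s4 = snd s3" using frame_mem[OF 1(2)] by (simp add: P_M_def)
          have p4: "par s4" by (rule par_cong[OF p3]) (simp_all add: r4 P_M_def)
          have w4: "wins rv ?S s4" by (rule wins_cong[OF w3]) (simp_all add: r4 P_M_def m4)
          have M4: "M_ok ?S (fst s3 Rrho) (fst s4 RM)" using 1(1) by blast
          have Mb: "2 * k \<le> fst s4 RM" "fst s4 RM \<le> N + 1"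
            using M_ok_le[OF M4] rho2 q3 by simp_all
          show ?case
          proof (rule wp_SqF, rule wp_tab[OF p4 w4 S Mb], use q4 adr in simp, goal_cases)
            case (1 s5 T5)
        note g5 = 1(1)
            note r5 = frame_reg[OF 1(2)]
            have q5: "fst s5 Rnb = fst s Rnb" "fst s5 Rpos = fst s Rpos" "fst s5 Rzb = fst s Rzb" "fst s5 RW = fst s RW" "fst s5 Rtab = fst s Rtab"
              "fst s5 RM = fst s4 RM"
              by (simp_all add: r5 P_tab_def q4)
            have m5: "snd s5 a = snd s4 a" if "a < fst s Rtab" for a using 1(1) that q4 by simp
            have p5: "par s5" by (rule par_cong[OF p4]) (simp_all add: r5 P_tab_def)
            have w5: "wins rv ?S s5" by (rule wins_cong[OF w4]) (use m5 adr in \<open>simp_all add: q5 q4\<close>)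
            have t5: "tab_ok rv (wcode rv c ?S (fst s4 RM - 2 * k) (2 * k)) (\<lambda>y. snd s5 (fst s5 Rtab + y))"
              unfolding tab_ok_def using 1(1) q5 q4 by simp
            have bs: "block_string ?S N k NW (fst s3 Rrho) (fst s4 RM) (\<lambda>m. snd s5 (fst s5 Rnb + m))"
              by (rule block_stringI[OF rho3 _ M4]) (use nb3 m5 m4 q5 adr in simp)
            have z5: "snd s5 (fst s5 Rpos + m) = 0" if "m \<le> NW" for m
            proof -
              have "snd s5 (fst s Rpos + m) = snd s3 (fst s Rpos + m)" using m5 m4 adr that by simp
              also have "\<dots> = snd s1 (fst s Rpos + m)"
                using g3 m2 q2 adr that by simp
              also have "\<dots> = 0" using g1 that by blast
              finally show ?thesis using q5 by simp
            qed
            show ?case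
            proof (rule wp_monoF, rule wp_cand[OF bs p5 w5 S q5(6) Mb(2) t5 z5], goal_cases)
              case (7 s6 T6)
              note r6 = frame_reg[OF 7(2)]
              have q6: "fst s6 Rnb = fst s Rnb" "fst s6 Rpos = fst s Rpos" "fst s6 Rzb = fst s Rzb" "fst s6 RW = fst s RW"
                "fst s6 RM = fst s4 RM"
                by (simp_all add: r6 P_cand_def q5)
              have m6: "snd s6 a = snd s5 a" if "a < fst s Rpos" for a using 7(1) that q5 adr by simp
              have p6: "par s6" by (rule par_cong[OF p5]) (simp_all add: r6 P_cand_def)
              have w6: "wins rv ?S s6" by (rule wins_cong[OF w5]) (use m6 adr in \<open>simp_all add: q6 q5\<close>)
              have bs6: "block_string ?S N k NW (fst s3 Rrho) (fst s6 RM) (\<lambda>m. snd s6 (fst s6 Rnb + m))"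
                unfolding q6 by (rule block_string_cong[OF bs]) (use m6 adr q5 in simp)
              have "ds_ok rv ?S s6"
                unfolding ds_ok_def using p6 w6 bs6 Mb b2 7(1) q5 q6 by auto
              moreover have "snd s6 a = snd s a" if "a < fst s RW" for a
              proof -
                have "snd s6 a = snd s5 a" using m6 that adr by simp
                also have "\<dots> = snd s3 a" using m5 m4 that adr by simp
                also have "\<dots> = snd s2 a" using g3 q2 that adr by simp
                also have "\<dots> = snd s a" using g1 m2 that adr by simp
                finally show ?thesis .
              qed
              moreover have "T6 \<le> T + 3000 * (NW + 2) + 200 * (k + 2) * (2 ^ (3 * (k * c)) + 1) + 400 * (k + 2)"
                using g1 g2 g3 g4 g5 7(1) by linarith
              ultimately show ?case by blast
            qed (use q5 adr in simp_all)
          qed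
        qed
      qed
    qed
  qed
qed

end

section \<open>Cutting the packed input into blocks\<close>

text \<open>Registers 40 and 41 form the bit position in the input, 42 counts the pieces of a
  letter. The last piece of a letter may be shorter than c bits; it is read with its true length,
  kept in 44, and thereby padded with zeros. The three zero blocks are the padding that
  \<open>fstr\<close> expects.\<close>

definition P_pack :: com where
  "P_pack = Sto (V RA) (Cst 0) ;; Sto (V RA \<oplus> Cst 1) (Cst 0) ;; Sto (V RA \<oplus> Cst 2) (Cst 0) ;;
     Asg 40 (Cst 0) ;; Asg 41 (Cst 0) ;; Asg 42 (Cst 0) ;;
     For 20 (V RNW \<oplus> Cst 4) (
       Cond (V 42 \<oplus> Cst 1 \<doteq> V Rs) (Asg 43 (V 44) ;; Asg 42 (Cst 0)) (Asg 43 (V Rc) ;; Asg 42 (V 42 \<oplus> Cst 1)) ;;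
       Sto (V RA \<oplus> (V 20 \<oplus> Cst 3))
         (Op Mod (Op Shr (Ld (V 40)) (V 41) \<oplus> Op Shl (Ld (V 40 \<oplus> Cst 1)) (V Rw \<ominus> V 41)) (Op Shl (Cst 1) (V 43))) ;;
       Asg 41 (V 41 \<oplus> V 43) ;;
       Cond (V 41 \<lless> V Rw) Skip (Asg 41 (V 41 \<ominus> V Rw) ;; Asg 40 (V 40 \<oplus> Cst 1)))"

locale packed = params w k c N NW for w k c N NW :: nat +
  fixes n b sp :: nat and T :: "nat list"
  assumes len: "length T = n" and letters: "\<And>x. x < n \<Longrightarrow> T ! x < 2 ^ b"
    and sp: "1 \<le> sp" "c * (sp - 1) < b" "b \<le> c * sp" "sp = 1 \<and> c = b \<or> k = 1"
    and N: "N = n * sp"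
begin

text \<open>Block \<open>m\<close> consists of \<open>blen m\<close> bits, starting at bit \<open>bpos m\<close> of the input.\<close>

definition bpos :: "nat \<Rightarrow> nat" where
  "bpos m = m div sp * (b * k) + m mod sp * c"

definition blen :: "nat \<Rightarrow> nat" where
  "blen m = (if Suc (m mod sp) = sp then (b - c * (sp - 1)) * k else c)"

lemma bpos_Suc: "bpos (Suc m) = bpos m + blen m"
proof (cases "Suc (m mod sp) = sp")
  case True
  then have e: "Suc m mod sp = 0" "Suc m div sp = Suc (m div sp)" "m mod sp = sp - 1"
    by (auto simp: mod_Suc div_Suc)
  have "(sp - 1) * c + (b - c * (sp - 1)) * k = b * k"
    using sp by (auto simp: mult.commute)
  then show ?thesis using True e unfolding bpos_def blen_def by (simp add: add.assoc)
next
  case False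
  then have e: "Suc m mod sp = Suc (m mod sp)" "Suc m div sp = m div sp"
    by (auto simp: mod_Suc div_Suc)
  then show ?thesis using False unfolding bpos_def blen_def by simp
qed

lemma blen_le: "blen m \<le> c * k"
proof -
  have "b - c * (sp - 1) \<le> c" using sp by (cases sp) auto
  then show ?thesis unfolding blen_def using k by simp
qed

text \<open>A block with content starts inside the input; when letters are cut, this rests on the
  last piece being nonempty, \<open>c * (sp - 1) < b\<close>.\<close>

lemma bpos_less:
  assumes "m * k < N" shows "bpos m < n * b"
proof (cases "k = 1")
  case True
  then have "m div sp < n" using assms N by (simp add: less_mult_imp_div_less)
  then have "(m div sp + 1) * b \<le> n * b" by (intro mult_le_mono1) simp
  moreover have "m mod sp * c \<le> c * (sp - 1)"
  proof -
    have "m mod sp \<le> sp - 1" using sp(1) mod_less_divisor[of sp m] by linarith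
    then show ?thesis by (simp add: mult.commute)
  qed
  moreover have "bpos m = m div sp * b + m mod sp * c" unfolding bpos_def using True by simp
  moreover have "(m div sp + 1) * b = m div sp * b + b" by simp
  ultimately show ?thesis using sp(2) by linarith
next
  case False
  then have "sp = 1" "c = b" using sp(4) by auto
  then show ?thesis using assms N c unfolding bpos_def by (simp add: mult_ac)
qed

text \<open>Either a block is a single piece of a letter, or it holds k whole letters. In the first
  case a short last piece agrees with its c-bit reading, because the letter has no bits above
  b.\<close>

lemma piece_block:
  assumes U: "\<And>x. x < n \<Longrightarrow> U div 2 ^ (b * x) mod 2 ^ b = T ! x" and i: "m * k + i < N" "i < k"
  shows "U div 2 ^ bpos m mod 2 ^ blen m div 2 ^ (c * i) mod 2 ^ c = piece sp c T (m * k + i)"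
proof (cases "k = 1")
  case True
  define y j where "y = m div sp" and "j = m mod sp"
  have i0: "i = 0" using i True by simp
  have y: "y < n" using i N True by (simp add: y_def less_mult_imp_div_less)
  have j: "j < sp" using sp by (simp add: j_def)
  have cj: "c * j \<le> b"
  proof -
    have "c * j \<le> c * (sp - 1)" using j by (intro mult_le_mono2) simp
    then show ?thesis using sp by linarith
  qed
  have "U div 2 ^ (b * y) mod 2 ^ b div 2 ^ (c * j) = U div 2 ^ (b * y) div 2 ^ (c * j) mod 2 ^ (b - c * j)"
    by (rule mod_div_pow[OF cj])
  also have "U div 2 ^ (b * y) div 2 ^ (c * j) = U div 2 ^ bpos m"
  proof -
    have "bpos m = b * y + c * j" unfolding bpos_def y_def j_def using True by (simp add: mult.commute)
    then show ?thesis by (simp add: power_add div_mult2_eq)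
  qed
  finally have e: "T ! y div 2 ^ (c * j) = U div 2 ^ bpos m mod 2 ^ (b - c * j)" using U[OF y] by simp
  have "blen m \<le> c" using blen_le[of m] True by simp
  have "U div 2 ^ bpos m mod 2 ^ blen m mod 2 ^ c = U div 2 ^ bpos m mod 2 ^ (b - c * j) mod 2 ^ c"
  proof (cases "Suc j = sp")
    case True
    then show ?thesis using \<open>k = 1\<close> unfolding blen_def j_def[symmetric] by auto
  next
    case False
    then have "c * Suc j \<le> c * (sp - 1)" using j by (intro mult_le_mono2) simp
    then have "c \<le> b - c * j" using sp(2) by simp
    then show ?thesis using False unfolding blen_def j_def[symmetric] by (simp add: mod_mod_pow)
  qed
  then show ?thesis using e True i0 unfolding piece_def by (simp add: y_def j_def)
next
  case False
  then have s: "sp = 1" "c = b" using sp(4) by auto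
  have "b * i + b \<le> b * k" using i(2) by (metis Suc_leI mult_Suc_right mult_le_mono2 add.commute)
  then have "U div 2 ^ (m * (b * k)) mod 2 ^ (b * k) div 2 ^ (b * i) mod 2 ^ b
     = U div 2 ^ (m * (b * k)) div 2 ^ (b * i) mod 2 ^ b" by (rule mod_div_mod)
  also have "\<dots> = U div 2 ^ (b * (m * k + i)) mod 2 ^ b"
    by (simp add: div_mult2_eq[symmetric] power_add[symmetric] algebra_simps)
  also have "\<dots> = T ! (m * k + i)" using U i N s by simp
  finally show ?thesis using s letters[of "m * k + i"] i N
    unfolding bpos_def blen_def piece_def by simp
qed

lemma wp_pack:
  assumes par: "par s" and r: "fst s Rs = sp" "fst s Rw = w" "fst s 44 = (b - c * (sp - 1)) * k" "fst s RA = H"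
    and H: "H + NW + 7 < 2 ^ w" "n * b + 2 * w \<le> w * H"
    and mem: "\<And>a. snd s a < 2 ^ w" "\<And>q. q * w < n * b \<Longrightarrow> snd s q = packed_word w b T q"
    and spw: "sp < 2 ^ w"
  shows "wp w P_pack (\<lambda>s' t'. (\<exists>B. blocks B s' \<and> (\<forall>x. B x < 2 ^ c) \<and> (\<forall>x<N. B (3 * k + x) = piece sp c T x)) \<and>
     t' \<le> t + 200 * (NW + 6)) s t"
proof -
  define Vs where "Vs = code w (snd s) H"
  have Vs: "Vs div 2 ^ (b * x) mod 2 ^ b = T ! x" if "x < n" for x
    unfolding Vs_def by (rule code_packed_prefix[OF len letters mem(1) _ _ that])
      (use mem(2) H len in \<open>auto simp: packed_word_code\<close>)
  have kcw: "c * k < w" "1 < w"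
  proof -
    have "1 \<le> k * c" using k c by (metis mult_le_mono mult_1)
    then show "c * k < w" "1 < w" using kc mult.commute[of c k] by linarith+
  qed
  have w2: "w < 2 ^ w" by (rule less_exp)
  have ww: "2 * w \<le> 2 ^ w"
  proof -
    have "w \<le> 2 ^ (w - 1)" using less_exp[of "w - 1"] kcw(2) by linarith
    then have "2 * w \<le> 2 * 2 ^ (w - 1)" by (rule mult_le_mono2)
    also have "\<dots> = 2 ^ w" using kcw(2) by (metis One_nat_def Suc_pred less_trans power_Suc zero_less_one)
    finally show ?thesis .
  qed
  \<comment> \<open>Blocks beyond the end of the string may contain garbage, as the memory there is
    arbitrary; only their size is controlled.\<close>
  let ?J = "\<lambda>m s'. fst s' 41 < w \<and> w * fst s' 40 + fst s' 41 = bpos m \<and> fst s' 40 \<le> m \<and> fst s' 42 = m mod sp \<and>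
     (\<forall>a<H. snd s' a = snd s a) \<and> (\<forall>j<m + 3. snd s' (H + j) < 2 ^ (c * k)) \<and>
     (\<forall>j<m. \<forall>i<k. j * k + i < N \<longrightarrow> snd s' (H + 3 + j) div 2 ^ (c * i) mod 2 ^ c = piece sp c T (j * k + i))"
  show ?thesis
    unfolding P_pack_def
  proof (rule wp_Sto_Sq[where i = H and v = 0], use r in simp, simp,
      rule wp_Sto_Sq[where i = "H + 1" and v = 0], use r H in simp, simp,
      rule wp_Sto_Sq[where i = "H + 2" and v = 0], use r H in simp, simp,
      rule wp_Asg_Sq[where v = 0], simp, rule wp_Asg_Sq[where v = 0], simp, rule wp_Asg_Sq[where v = 0], simp,
      rule wp_For[where L = "NW + 4" and J = ?J and B = 100], goal_cases)
    case 1
    have "snd s' (H + j) < 2 ^ (c * k)" if "j < 3" "snd s' = (snd s)(H := 0, H + 1 := 0, H + 2 := 0)" for s' :: st and j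
      using that by (auto simp: less_Suc_eq numeral_3_eq_3)
    then show ?case using kcw by (simp add: bpos_def)
  next
    case 2
    then show ?case using sizes big NWk by linarith
  next
    case (3 s')
    then have "fst s' RNW = NW" using par_D[OF par] by (simp add: frame_reg)
    moreover have "(4::nat) < 2 ^ w" "NW + 4 < 2 ^ w" using big NWk by linarith+
    ultimately show ?case by simp
  next
    case (4 m s' t')
    have r': "fst s' Rs = sp" "fst s' Rw = w" "fst s' 44 = (b - c * (sp - 1)) * k" "fst s' RA = H" "fst s' Rc = c"
      using 4(4) r par_D[OF par] by (simp_all add: frame_reg)
    define q off where "q = fst s' 40" and "off = fst s' 41"
    note J = 4(3)[folded q_def off_def]
    have m: "m < NW + 4" "fst s' 20 = m" using 4(1,2) by simp_all
    have bl: "blen m \<le> c * k" "blen m < w" using blen_le[of m] kcw by linarith+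
    have lt: "H + (m + 3) < 2 ^ w" "m + 3 < 2 ^ w" "q + 1 < 2 ^ w" "off + blen m < 2 ^ w" "off + blen m < 2 * w" "w - off < 2 ^ w"
      "m mod sp + 1 < 2 ^ w" "(3::nat) < 2 ^ w"
      using J m H bl ww w2 big sizes spw mod_less_divisor[of sp m] sp(1) by linarith+
    define v where "v = (snd s' q div 2 ^ off + snd s' (q + 1) * 2 ^ (w - off)) mod 2 ^ blen m"
    have v: "v < 2 ^ (c * k)"
    proof -
      have "v < 2 ^ blen m" by (simp add: v_def)
      also have "\<dots> \<le> 2 ^ (c * k)" using bl by (intro power_increasing) auto
      finally show ?thesis .
    qed
    have vp: "v div 2 ^ (c * i) mod 2 ^ c = piece sp c T (m * k + i)" if i: "i < k" "m * k + i < N" for i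
    proof -
      have "bpos m < n * b" using i by (intro bpos_less) simp
      \<comment> \<open>The two words of slack in \<open>H\<close> ensure that \<open>q + 1\<close>
        is below \<open>H\<close>, where nothing has been overwritten.\<close>
      then have "w * q < n * b" using J by linarith
      then have "w * (q + 2) < w * H" using H(2) by simp
      then have "q + 2 < H" unfolding mult_less_cancel1 by blast
      then have q: "q + 1 < H" by simp
      have "v = Vs div 2 ^ (w * q + off) mod 2 ^ blen m"
        unfolding v_def Vs_def using J q stream_read[OF mem(1) q, of "blen m" off] bl by simp
      also have "w * q + off = bpos m" using J by simp
      finally show ?thesis using piece_block[OF Vs i(2,1)] by simp
    qed
    have val: "ev w (Op Mod (Op Shr (Ld (V 40)) (V 41) \<oplus> Op Shl (Ld (V 40 \<oplus> Cst 1)) (V Rw \<ominus> V 41)) (Op Shl (Cst 1) (V 43))) s1 = v"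
      if s1: "fst s1 40 = q" "fst s1 41 = off" "fst s1 43 = blen m" "fst s1 Rw = w" "snd s1 = snd s'" for s1
    proof -
      let ?x = "snd s' q div 2 ^ off" and ?y = "snd s' (q + 1) * 2 ^ (w - off)"
      \<comment> \<open>The left shift may overflow; this is harmless because only the low
        \<open>blen m\<close> bits are kept, fewer than w.\<close>
      have "(?x + ?y mod 2 ^ w) mod 2 ^ w mod 2 ^ blen m = (?x + ?y) mod 2 ^ w mod 2 ^ blen m" by (simp add: mod_simps)
      also have "\<dots> = v" using bl unfolding v_def by (simp add: mod_mod_pow)
      finally show ?thesis using s1 lt J bl w2 by (simp add: bv_shl1 binop_val.simps(1,9))
    qed
    have post: "?J (Suc m) s3" if s3: "fst s3 41 < w" "w * fst s3 40 + fst s3 41 = bpos m + blen m" "fst s3 40 \<le> Suc q"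
        "fst s3 42 = Suc m mod sp" "snd s3 = (snd s')(H + (m + 3) := v)" for s3 :: st
    proof -
      have "snd s3 a = snd s a" if "a < H" for a using J s3 that by simp
      moreover have "snd s3 (H + j) < 2 ^ (c * k)" if "j < Suc m + 3" for j
        using J s3 that v by (cases "j = m + 3") simp_all
      moreover have "snd s3 (H + 3 + j) div 2 ^ (c * i) mod 2 ^ c = piece sp c T (j * k + i)"
        if "j < Suc m" "i < k" "j * k + i < N" for i j
        using J s3 that vp by (cases "j = m") simp_all
      moreover have "fst s3 40 \<le> Suc m" using s3 J by linarith
      ultimately show ?thesis using s3 bpos_Suc[of m] by simp
    qed
    show ?case
    proof (rule wp_SqI[where R = "\<lambda>s1 t1. fst s1 40 = q \<and> fst s1 41 = off \<and> fst s1 43 = blen m \<and> fst s1 42 = Suc m mod sp \<and>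
        fst s1 20 = m \<and> fst s1 Rw = w \<and> fst s1 RA = H \<and> snd s1 = snd s' \<and> t1 \<le> t' + 20"], goal_cases)
      case 1
      show ?case
      proof (rule wp_Cond, goal_cases)
        case 1
        then have "Suc (m mod sp) = sp" using J r' lt by (simp split: if_splits)
        then show ?case using r' m J by (simp add: blen_def mod_Suc q_def off_def)
      next
        case 2
        then have "Suc (m mod sp) \<noteq> sp" using J r' lt by (simp split: if_splits)
        then show ?case using r' m J lt by (simp add: blen_def mod_Suc q_def off_def)
      qed
    next
      case (2 s1 t1)
      show ?case
      proof (rule wp_Sto_Sq[where i = "H + (m + 3)" and v = v], use 2 lt in simp, rule val, use 2 in simp, use 2 in simp, use 2 in simp, use 2 in simp, use 2 in simp, goal_cases)
        case 1
        have s1: "fst s1 40 = q" "fst s1 41 = off" "fst s1 43 = blen m" "fst s1 42 = Suc m mod sp"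
          "fst s1 20 = m" "fst s1 Rw = w" "t1 \<le> t' + 20" using 2 by auto
        let ?\<mu> = "(snd s')(H + (m + 3) := v)"
        have m1: "snd s1 = snd s'" using 2 by blast
        show ?case
        proof (rule wp_Asg_Sq[where v = "off + blen m"], use s1 lt in simp, rule wp_Cond, goal_cases)
          case 1
          then have "off + blen m < w" using s1 by (simp split: if_splits)
          then have "?J (Suc m) ((fst s1)(41 := off + blen m, 20 := Suc m), ?\<mu>)"
            using J s1 by (intro post) simp_all
          then show ?case unfolding wp_Skip_eq using s1 m1 by simp
        next
          case 2
          then have o: "w \<le> off + blen m" using s1 by (simp split: if_splits)
          have "?J (Suc m) ((fst s1)(41 := off + blen m - w, 40 := Suc q, 20 := Suc m), ?\<mu>)"
          proof (rule post)
            have "w * Suc q = w + w * q" by simp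
            then have "w * Suc q + (off + blen m - w) = bpos m + blen m" using J o by linarith
            then show "w * fst ((fst s1)(41 := off + blen m - w, 40 := Suc q, 20 := Suc m), ?\<mu>) 40 +
              fst ((fst s1)(41 := off + blen m - w, 40 := Suc q, 20 := Suc m), ?\<mu>) 41 = bpos m + blen m" by simp
          qed (use s1 o lt in simp_all)
          then show ?case using s1 m1 o lt
            by (intro wp_Asg_Sq[where v = "off + blen m - w"] wp_AsgV[where v = "Suc q"]) simp_all
        qed
      qed
    qed
  next
    case (5 s' t')
    have rA: "fst s' RA = H" using 5(3) r by (simp add: frame_reg)
    define B where "B = (\<lambda>y. if y < (NW + 7) * k then snd s' (H + y div k) div 2 ^ (c * (y mod k)) mod 2 ^ c else 0)"
    have "blocks B s'"
      unfolding blocks_def rA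
    proof (intro conjI allI impI)
      fix q assume q: "q < NW + 7"
      have "B (q * k + i) = snd s' (H + q) div 2 ^ (c * i) mod 2 ^ c" if "i < k" for i
      proof -
        have "q * k + i < (q + 1) * k" "(q + 1) * k \<le> (NW + 7) * k" using that q by (simp, intro mult_le_mono1) simp
        then show ?thesis using that by (simp add: B_def)
      qed
      then have "code c (\<lambda>i. B (q * k + i)) k = code c (\<lambda>i. snd s' (H + q) div 2 ^ (c * i) mod 2 ^ c) k"
        by (intro code_cong)
      also have "\<dots> = snd s' (H + q)" by (rule digits_code) (use 5(1) q in simp)
      finally show "snd s' (H + q) = code c (\<lambda>i. B (q * k + i)) k" by simp
    qed (use H in simp)
    moreover have "\<forall>x. B x < 2 ^ c" by (simp add: B_def)
    moreover have "B (3 * k + x) = piece sp c T x" if "x < N" for x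
    proof -
      have "x < NW * k + k" using that NWk by linarith
      then have l: "3 * k + x < (NW + 7) * k" "x div k < NW + 4"
        by (simp add: add_mult_distrib, intro less_mult_imp_div_less) (simp add: add_mult_distrib)
      have "(3 * k + x) div k = 3 + x div k" "(3 * k + x) mod k = x mod k" using k by simp_all
      then have "B (3 * k + x) = snd s' (H + 3 + x div k) div 2 ^ (c * (x mod k)) mod 2 ^ c"
        using l(1) by (simp add: B_def add.assoc)
      also have "\<dots> = piece sp c T (x div k * k + x mod k)"
        using 5(1) l(2) k that by (auto simp: Suc_le_eq)
      finally show ?thesis by simp
    qed
    ultimately show ?case using 5(4) by auto
  qed
qed

end

section \<open>Choice of the parameters and their size estimates\<close>

text \<open>Repeated halving leaves in register 50 the binary logarithm of n, rounded down. Register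
  53 is the distance between consecutive arrays.\<close>

definition P_par :: com where
  "P_par = Asg 50 (Cst 0) ;; Asg 51 (V Rn) ;;
     Whl (Cst 1 \<lless> V 51) (Asg 51 (Op Div (V 51) (Cst 2)) ;; Asg 50 (V 50 \<oplus> Cst 1)) ;;
     Asg 52 (Op Div (V 50) (Cst 8)) ;; Cond (V 52) Skip (Asg 52 (Cst 1)) ;;
     Cond (V Rb \<lless> V 52 \<oplus> Cst 1)
       (Asg Rs (Cst 1) ;; Asg Rc (V Rb) ;; Asg Rk (Op Div (V 52) (V Rb)))
       (Asg Rs (Op Div (V Rb \<oplus> V 52 \<ominus> Cst 1) (V 52)) ;; Asg Rc (V 52) ;; Asg Rk (Cst 1)) ;;
     Asg RN (V Rn \<otimes> V Rs) ;; Asg RNW (Op Div (V RN) (V Rk)) ;;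
     Asg 44 ((V Rb \<ominus> V Rc \<otimes> (V Rs \<ominus> Cst 1)) \<otimes> V Rk) ;;
     Asg RA ((Op Div (V Rn) (V Rw) \<oplus> Cst 1) \<otimes> V Rb \<oplus> Cst 16) ;; Asg 53 (V RNW \<oplus> Cst 8)"

text \<open>The number of bits that a block may have, about an eighth of the logarithm of n. Three
  blocks then index a table of about n to the power 3/8 entries, cheap enough even at k steps per
  entry. The default 1 serves small n.\<close>

definition k0_of :: "nat \<Rightarrow> nat" where
  "k0_of L = (if L div 8 = 0 then 1 else L div 8)"

definition s_of :: "nat \<Rightarrow> nat \<Rightarrow> nat" where
  "s_of L b = (if b \<le> k0_of L then 1 else (b + k0_of L - 1) div k0_of L)"

definition c_of :: "nat \<Rightarrow> nat \<Rightarrow> nat" where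
  "c_of L b = (if b \<le> k0_of L then b else k0_of L)"

definition k_of :: "nat \<Rightarrow> nat \<Rightarrow> nat" where
  "k_of L b = (if b \<le> k0_of L then k0_of L div b else 1)"

text \<open>Bounds the number of input words without forming the product of n and b, which may
  overflow. The 16 provides room for the header cells 0 to 10 and the two words of slack needed for
  reading.\<close>

definition H_of :: "nat \<Rightarrow> nat \<Rightarrow> nat \<Rightarrow> nat" where
  "H_of w n b = (n div w + 1) * b + 16"

lemma ceil_div_bounds:
  fixes b k0 :: nat
  assumes "1 \<le> k0" "1 \<le> b"
  shows "k0 * ((b + k0 - 1) div k0 - 1) < b" "b \<le> k0 * ((b + k0 - 1) div k0)"
    "k0 * ((b + k0 - 1) div k0) \<le> b + k0 - 1" "1 \<le> (b + k0 - 1) div k0"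
proof -
  define t where "t = (b + k0 - 1) div k0"
  have t: "k0 * t + (b + k0 - 1) mod k0 = b + k0 - 1" "(b + k0 - 1) mod k0 < k0"
    using assms by (simp_all add: t_def)
  have "k0 * 1 \<le> b + k0 - 1" using assms by simp
  then have t1: "1 \<le> t" using div_le_mono[of "k0" "b + k0 - 1" k0] assms by (simp add: t_def)
  show "1 \<le> (b + k0 - 1) div k0" using t1 by (simp add: t_def)
  show "k0 * ((b + k0 - 1) div k0) \<le> b + k0 - 1" by simp
  show "b \<le> k0 * ((b + k0 - 1) div k0)" using t assms unfolding t_def by linarith
  have "k0 * (t - 1) + k0 = k0 * t" using t1 by (cases t) auto
  then show "k0 * ((b + k0 - 1) div k0 - 1) < b" using t assms unfolding t_def by linarith
qed

locale sizes_ok =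
  fixes e n b L w :: nat
  assumes n: "2 \<le> n" and L: "2 ^ L \<le> n" "n < 2 * 2 ^ L" and b: "1 \<le> b" "b \<le> e * (L + 1) + 1"
    and w: "2000 * (e + 1) * n \<le> 2 ^ w"
begin

abbreviation "k0 \<equiv> k0_of L"
abbreviation "sp \<equiv> s_of L b"
abbreviation "c \<equiv> c_of L b"
abbreviation "k \<equiv> k_of L b"
abbreviation "H \<equiv> H_of w n b"
abbreviation "N \<equiv> n * sp"
abbreviation "NW \<equiv> N div k"

lemma k0: "1 \<le> k0" "L + 1 \<le> 16 * k0" "k0 = 1 \<or> 8 * k0 \<le> L"
  unfolding k0_of_def by auto

lemma nw: "2000 * n \<le> 2 ^ w" "(2::nat) ^ 5 \<le> 2 ^ w"
proof -
  have "2000 * n \<le> 2000 * (e + 1) * n" by simp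
  then show "2000 * n \<le> 2 ^ w" using w by linarith
  then show "(2::nat) ^ 5 \<le> 2 ^ w" using n by simp
qed

lemma w5: "5 \<le> w"
  using nw(2) by (subst (asm) power_increasing_iff) auto

lemma L_le: "L \<le> w" "L + 1 \<le> n"
proof -
  have "(2::nat) ^ L \<le> 2 ^ w" using L nw by linarith
  then show "L \<le> w" by (subst (asm) power_increasing_iff) auto
  have "L < 2 ^ L" by (rule less_exp)
  then show "L + 1 \<le> n" using L by linarith
qed

lemma kc: "k * c \<le> k0" "1 \<le> k" "1 \<le> c" "4 * (k * c) \<le> w" "k \<le> k0"
proof -
  show 1: "k * c \<le> k0" unfolding k_of_def c_of_def by simp
  show 2: "1 \<le> k" "1 \<le> c" using k0 b div_le_mono[of b k0 b] unfolding k_of_def c_of_def by auto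
  have "4 * k0 \<le> w" using k0(3) w5 L_le by linarith
  then show "4 * (k * c) \<le> w" using 1 by linarith
  show "k \<le> k0" using 1 mult_le_mono2[OF 2(2), of k] by linarith
qed

lemma sp: "1 \<le> sp" "c * (sp - 1) < b" "b \<le> c * sp" "sp = 1 \<and> c = b \<or> k = 1" "sp \<le> 16 * e + 1"
proof -
  note d = ceil_div_bounds[OF k0(1) b(1)]
  show "1 \<le> sp" "c * (sp - 1) < b" "b \<le> c * sp" "sp = 1 \<and> c = b \<or> k = 1"
    using d b unfolding s_of_def c_of_def k_of_def by auto
  have "b \<le> (16 * e + 1) * k0"
  proof -
    have "e * (L + 1) \<le> e * (16 * k0)" using k0(2) by (rule mult_le_mono2)
    then show ?thesis using b(2) k0(1) by (simp add: algebra_simps)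
  qed
  then have "b + k0 - 1 \<le> (16 * e + 1) * k0 + (k0 - 1)" by simp
  then have "(b + k0 - 1) div k0 \<le> ((16 * e + 1) * k0 + (k0 - 1)) div k0" by (rule div_le_mono)
  also have "\<dots> = 16 * e + 1" using k0 by (subst div_mult_self3) simp_all
  finally show "sp \<le> 16 * e + 1" unfolding s_of_def by simp
qed

lemma N_le: "N \<le> (16 * e + 1) * n" "n \<le> N" "NW \<le> N" "2 * k \<le> N"
proof -
  show "N \<le> (16 * e + 1) * n" using mult_le_mono2[OF sp(5), of n] by (simp only: mult.commute)
  show nN: "n \<le> N" using mult_le_mono2[OF sp(1), of n] by simp
  show "NW \<le> N" by simp
  have "2 * k0 \<le> n" using k0(3) n L_le by linarith
  then show "2 * k \<le> N" using kc(5) nN by linarith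
qed

lemma b_le: "b \<le> (e + 1) * (L + 1)" "b \<le> (e + 1) * n"
proof -
  show "b \<le> (e + 1) * (L + 1)" using b(2) by simp
  also have "\<dots> \<le> (e + 1) * n" using L_le(2) by (rule mult_le_mono2)
  finally show "b \<le> (e + 1) * n" .
qed

lemma H_le: "H \<le> (3 * e + 11) * n" "n * b + 2 * w \<le> w * H" "16 \<le> H"
proof -
  have "n div w * b \<le> n div w * ((e + 1) * (2 * w))"
  proof (rule mult_le_mono2)
    have "(e + 1) * (L + 1) \<le> (e + 1) * (2 * w)" using L_le w5 by (intro mult_le_mono2) linarith
    then show "b \<le> (e + 1) * (2 * w)" using b_le by linarith
  qed
  also have "\<dots> = 2 * (e + 1) * (n div w * w)" by (simp add: algebra_simps)
  also have "\<dots> \<le> 2 * (e + 1) * n" by (intro mult_le_mono2) simp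
  finally have "n div w * b \<le> 2 * (e + 1) * n" .
  then show "H \<le> (3 * e + 11) * n" using b_le n unfolding H_of_def by (simp add: algebra_simps)
  have "n \<le> (n div w + 1) * w"
  proof -
    have "n = n div w * w + n mod w" "n mod w < w" using w5 by simp_all
    then show ?thesis using add_mult_distrib[of "n div w" 1 w] by linarith
  qed
  then have "n * b \<le> (n div w + 1) * w * b" by (rule mult_le_mono1)
  then show "n * b + 2 * w \<le> w * H" unfolding H_of_def by (simp add: algebra_simps)
  show "16 \<le> H" unfolding H_of_def by simp
qed

lemma pow_le: "2 ^ (3 * (k * c)) \<le> 4 * n"
proof -
  have "(2::nat) ^ (3 * (k * c)) \<le> 2 ^ (3 * k0)" using kc(1) by (intro power_increasing) auto
  also have "\<dots> \<le> 4 * n"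
  proof (cases "k0 = 1")
    case True then show ?thesis using n by simp
  next
    case False
    then have "3 * k0 \<le> L" using k0 by linarith
    then have "(2::nat) ^ (3 * k0) \<le> 2 ^ L" by (intro power_increasing) auto
    then show ?thesis using L by linarith
  qed
  finally show ?thesis .
qed

text \<open>Here the factor \<open>2000 * (e + 1)\<close> of the word-size assumption is spent: the
  last address, table included, and the quantities computed with stay below
  \<open>2 ^ w\<close>.\<close>

lemma total: "H + 9 * (NW + 8) + 2 ^ (3 * (k * c)) < 2 ^ w" "6 * N + 20 < 2 ^ w" "4 * N + 4 * n + 100 < 2 ^ w"
  "b + k0 < 2 ^ w" "b * k < 2 ^ w" "sp < 2 ^ w" "c * sp < 2 ^ w"
proof -
  have p: "2000 * (e * n) + 2000 * n \<le> 2 ^ w" using w by (simp add: algebra_simps)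
  have H: "H \<le> 3 * (e * n) + 11 * n" using H_le by (simp add: algebra_simps)
  have N: "N \<le> 16 * (e * n) + n" "NW \<le> N" using N_le by (simp_all add: algebra_simps)
  have bn: "b \<le> e * n + n" using b_le by (simp add: algebra_simps)
  have lin: "h + 9 * (nw + 8) + x < W"
    if "2000 * y + 2000 * n \<le> W" "h \<le> 3 * y + 11 * n" "nn \<le> 16 * y + n" "nw \<le> nn" "x \<le> 4 * n" for h nw x W nn y :: nat
  proof -
    have 1: "nw \<le> 16 * y + n" using that(3,4) by (rule order_trans[rotated])
    have 2: "9 * nw \<le> 9 * (16 * y + n)" using 1 by (rule mult_le_mono2)
    have "h + 9 * (nw + 8) + x = h + 9 * nw + 72 + x" by simp
    also have "\<dots> \<le> (3 * y + 11 * n) + 9 * (16 * y + n) + 72 + 4 * n" using 2 that(2,5) by (intro add_le_mono) simp_all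
    also have "\<dots> < 2000 * y + 2000 * n" using n by simp
    finally show ?thesis using that(1) by simp
  qed
  show "H + 9 * (NW + 8) + 2 ^ (3 * (k * c)) < 2 ^ w" by (rule lin[OF p H N pow_le])
  show "6 * N + 20 < 2 ^ w" "4 * N + 4 * n + 100 < 2 ^ w" using p N(1) n by simp_all
  have k0n: "k0 \<le> n" using k0 L_le n by linarith
  show "b + k0 < 2 ^ w" using bn k0n p n by linarith
  have bk: "b * k \<le> b + k0"
    unfolding k_of_def by (auto intro: trans_le_add2 times_div_less_eq_dividend)
  then show "b * k < 2 ^ w" using bn k0n p n by linarith
  have spn: "sp \<le> N" using n by simp
  then show "sp < 2 ^ w" using p N n by linarith
  have "k0 * ((b + k0 - 1) div k0) \<le> b + k0"
    using ceil_div_bounds(3)[OF k0(1) b(1)] by linarith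
  then have "c * sp \<le> b + k0" unfolding c_of_def s_of_def by auto
  then show "c * sp < 2 ^ w" using bn k0n p n by linarith
qed

text \<open>Rounding at most doubles the ideal number of \<open>n * b / k0\<close> blocks, and
  replacing \<open>k0\<close> by the logarithm costs a factor 16. All such bounds are multiplied by
  \<open>L + 1\<close>, which postpones division to the reals.\<close>

lemma cost_NW: "NW * (L + 1) \<le> 32 * (n * b)"
proof -
  have Nk: "NW * k \<le> N" by simp
  have "NW * k0 \<le> 2 * (n * b)"
  proof (cases "b \<le> k0")
    case True
    have "k0 = k * b + k0 mod b" "k0 mod b < b" using b True by (simp_all add: k_of_def)
    moreover have "b \<le> k * b" using kc(2) by simp
    ultimately have "k0 \<le> 2 * (k * b)" by linarith
    then have "NW * k0 \<le> NW * (2 * (k * b))" by (rule mult_le_mono2)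
    also have "\<dots> = 2 * (NW * k * b)" by simp
    also have "\<dots> \<le> 2 * (N * b)" using Nk by (intro mult_le_mono2 mult_le_mono1)
    finally show ?thesis using True by (simp add: s_of_def)
  next
    case False
    have "k0 * sp \<le> b + k0 - 1" using ceil_div_bounds(3)[OF k0(1) b(1)] False by (simp add: s_of_def)
    then have "sp * k0 \<le> 2 * b" using False by (simp add: mult.commute)
    then have "n * (sp * k0) \<le> n * (2 * b)" by (rule mult_le_mono2)
    then show ?thesis using False by (simp add: k_of_def mult_ac)
  qed
  then have "16 * (NW * k0) \<le> 32 * (n * b)" by linarith
  moreover have "NW * (L + 1) \<le> NW * (16 * k0)" using k0(2) by (rule mult_le_mono2)
  moreover have "NW * (16 * k0) = 16 * (NW * k0)" by (rule mult.left_commute)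
  ultimately show ?thesis by linarith
qed

lemma nnb: "n \<le> n * b"
  using b by simp

text \<open>For \<open>k0\<close> at least 2 the product is of order 2 to the power
  \<open>5 * k0\<close>, at most n because \<open>8 * k0\<close> is at most L. The constant 432 is
  the value 3 * 9 * 16 attained at \<open>k0 = 1\<close>.\<close>

lemma cost_tab: "(k + 2) * (2 ^ (3 * (k * c)) + 1) * (L + 1) \<le> 432 * (n * b)"
proof -
  have "(k + 2) * (2 ^ (3 * (k * c)) + 1) * (L + 1) \<le> (k0 + 2) * (2 ^ (3 * k0) + 1) * (16 * k0)"
    using kc k0 by (intro mult_le_mono add_le_mono power_increasing) auto
  also have "\<dots> \<le> 432 * n"
  proof (cases "k0 = 1")
    case True
    then show ?thesis using n by simp
  next
    case False
    then have k2: "2 \<le> k0" "5 * k0 \<le> L" using k0 by linarith+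
    have a: "k0 < 2 ^ k0" by (rule less_exp)
    have "k0 + 2 \<le> 2 * 2 ^ k0" "2 ^ (3 * k0) + 1 \<le> 2 * (2::nat) ^ (3 * k0)" "16 * k0 \<le> 16 * 2 ^ k0"
    proof -
      have "1 \<le> (2::nat) ^ k0" "1 \<le> (2::nat) ^ (3 * k0)" by simp_all
      then show "k0 + 2 \<le> 2 * 2 ^ k0" "2 ^ (3 * k0) + 1 \<le> 2 * (2::nat) ^ (3 * k0)" "16 * k0 \<le> 16 * 2 ^ k0"
        using a by linarith+
    qed
    then have "(k0 + 2) * (2 ^ (3 * k0) + 1) * (16 * k0) \<le> (2 * 2 ^ k0) * (2 * 2 ^ (3 * k0)) * (16 * 2 ^ k0)"
      by (rule mult_le_mono[OF mult_le_mono])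
    also have "\<dots> = 64 * (2 ^ k0 * 2 ^ (3 * k0) * 2 ^ k0)" by simp
    also have "2 ^ k0 * 2 ^ (3 * k0) * 2 ^ k0 = (2::nat) ^ (5 * k0)" by (simp flip: power_add)
    also have "(2::nat) ^ (5 * k0) \<le> 2 ^ L" using k2 by (intro power_increasing) auto
    finally show ?thesis using L by linarith
  qed
  finally show ?thesis using nnb by linarith
qed

lemma cost_L: "L * (L + 1) \<le> 256 * (n * b)" "L + 1 \<le> n * b"
proof -
  have "L * (L + 1) \<le> (16 * k0) * (16 * k0)" using k0 by (intro mult_le_mono) auto
  also have "\<dots> \<le> 256 * n"
  proof (cases "k0 = 1")
    case False
    then have "k0 + k0 \<le> L" using k0 by linarith
    then have "(2::nat) ^ (k0 + k0) \<le> 2 ^ L" by (intro power_increasing) auto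
    moreover have "k0 * k0 \<le> 2 ^ k0 * 2 ^ k0" using less_exp[of k0] by (intro mult_le_mono) auto
    ultimately show ?thesis using L by (simp add: power_add)
  qed (use n in simp)
  finally show "L * (L + 1) \<le> 256 * (n * b)" using nnb by linarith
  show "L + 1 \<le> n * b" using L_le nnb by linarith
qed

lemma cost_H: "H * (L + 1) \<le> 20 * (n * b)"
proof -
  have "n div w * (L + 1) \<le> n div w * (2 * w)" using L_le w5 by (intro mult_le_mono2) linarith
  also have "\<dots> \<le> 2 * n" by simp
  finally have 1: "n div w * (L + 1) * b \<le> 2 * (n * b)" unfolding mult.assoc[symmetric] by (rule mult_le_mono1)
  have 2: "b * (L + 1) \<le> n * b" using mult_le_mono2[OF L_le(2), of b] by (simp only: mult.commute)
  have 3: "H * (L + 1) = n div w * (L + 1) * b + b * (L + 1) + 16 * (L + 1)" unfolding H_of_def by (simp add: algebra_simps)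
  have "h \<le> 20 * a" if "h = x + y + 16 * z" "x \<le> 2 * a" "y \<le> a" "z \<le> a" for h x y z a :: nat
    using that by linarith
  from this[OF 3 1 2 cost_L(2)] show ?thesis .
qed

lemma wp_par:
  assumes s: "fst s Rn = n" "fst s Rb = b" "fst s Rw = w"
  shows "wp w P_par (\<lambda>s' t'. fst s' Rk = k \<and> fst s' Rc = c \<and> fst s' Rs = sp \<and> fst s' RN = N \<and> fst s' RNW = NW \<and>
     fst s' 44 = (b - c * (sp - 1)) * k \<and> fst s' RA = H \<and> fst s' 53 = NW + 8 \<and> t' \<le> t + 30 * L + 200) s t"
  unfolding P_par_def
proof (rule wp_Asg_Sq[where v = 0], simp, rule wp_Asg_Sq[where v = n], use s in simp, rule wp_SqF,
    rule wp_Whl[where m = "\<lambda>s'. fst s' 51" and Q = "\<lambda>s' t'. fst s' 50 = L \<and> t' \<le> t + 30 * L + 20" and I = "\<lambda>s' t'.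
      fst s' 50 \<le> L \<and> 2 ^ (L - fst s' 50) \<le> fst s' 51 \<and> fst s' 51 < 2 * 2 ^ (L - fst s' 50) \<and> t' \<le> t + 10 + 30 * fst s' 50"], goal_cases)
  case 1
  then show ?case using L by simp
next
  case (2 s' t')
  have lt: "1 < (2::nat) ^ w" "2 < (2::nat) ^ w" "(1::nat) mod 2 ^ w = 1" "(2::nat) mod 2 ^ w = 2" using nw(2) w5 by simp_all
  have x: "1 < fst s' 51" using 2(2) lt by (simp split: if_splits)
  have "fst s' 50 < L"
  proof (rule ccontr)
    assume "\<not> ?thesis"
    then have "L - fst s' 50 = 0" by simp
    then show False using 2(1) x by simp
  qed
  then obtain d where d: "L - fst s' 50 = Suc d" "L - Suc (fst s' 50) = d" by (metis Suc_diff_Suc)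
  have b2: "2 ^ d \<le> fst s' 51 div 2" "fst s' 51 div 2 < 2 * 2 ^ d" using 2(1) d by auto
  have w2: "Suc (fst s' 50) < 2 ^ w"
    using \<open>fst s' 50 < L\<close> L_le less_exp[of w] by linarith
  then show ?case using 2(1) x b2 d \<open>fst s' 50 < L\<close> lt by simp
next
  case (3 s' t')
  have lt: "(1::nat) mod 2 ^ w = 1" using w5 by simp
  have "fst s' 51 \<le> 1" using 3(2) lt by (simp split: if_splits)
  then have "2 ^ (L - fst s' 50) \<le> (1::nat)" using 3(1) by linarith
  then have "L - fst s' 50 = 0" by (metis Suc_1 lessI nat_power_eq_Suc_0_iff le_antisym one_le_numeral one_le_power nat_neq_iff One_nat_def power_eq_iff_eq_base)
  then show ?case using 3(1) by simp
next
  case (4 s1 t1)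
  have r1: "fst s1 Rn = n" "fst s1 Rb = b" "fst s1 Rw = w"
    using 4(2) s unfolding frame_def by simp_all
  have c32: "8 mod 2 ^ w = (8::nat)" "1 mod 2 ^ w = (1::nat)" "16 mod 2 ^ w = (16::nat)" using nw(2) w5 by simp_all
  note tot = total
  have bk: "b + k0 < 2 ^ w" "k0 + 1 < 2 ^ w" "b + k0 - 1 < 2 ^ w" using tot b by linarith+
  show ?case
  proof (rule wp_SqI[where R = "\<lambda>s2 t2. fst s2 52 = L div 8 \<and> fst s2 Rn = n \<and> fst s2 Rb = b \<and> fst s2 Rw = w \<and> t2 \<le> t1 + 5"], goal_cases)
    case 1
    show ?case using 4(1) r1 c32 by simp
  next
    case (2 s2 t2)
    show ?case
    proof (rule wp_SqI[where R = "\<lambda>s3 t3. fst s3 52 = k0 \<and> fst s3 Rn = n \<and> fst s3 Rb = b \<and> fst s3 Rw = w \<and> t3 \<le> t1 + 15"], goal_cases)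
      case 1
      show ?case using 2 c32 by (simp add: k0_of_def)
    next
      case (2 s3 t3)
      show ?case
      proof (rule wp_SqI[where R = "\<lambda>s4 t4. fst s4 Rk = k \<and> fst s4 Rc = c \<and> fst s4 Rs = sp \<and> fst s4 Rn = n \<and> fst s4 Rb = b \<and> fst s4 Rw = w \<and> t4 \<le> t1 + 50"], goal_cases)
        case 1
        show ?case
        proof (rule wp_Cond, goal_cases)
          case 1
          then have "b \<le> k0" using 2 bk c32 by (simp split: if_splits)
          then show ?case using 2 c32 by (simp add: k_of_def c_of_def s_of_def)
        next
          case 2
          then have "\<not> b \<le> k0" using \<open>fst s3 52 = k0 \<and> _\<close> bk c32 by (simp split: if_splits)
          then show ?case using \<open>fst s3 52 = k0 \<and> _\<close> c32 bk k0(1) b by (simp add: k_of_def c_of_def s_of_def)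
        qed
      next
        case (2 s4 t4)
        have l1: "N < 2 ^ w" "c * (sp - 1) < 2 ^ w" "c * (sp - 1) \<le> b" "b < 2 ^ w" "sp < 2 ^ w" "sp - 1 < 2 ^ w" "(8::nat) < 2 ^ w"
          using tot sp(2) by linarith+
        have "NW + 8 \<le> H + 9 * (NW + 8) + 2 ^ (3 * (k * c))" by simp
        then have l8: "NW + 8 < 2 ^ w" using tot(1) by (rule le_less_trans)
        have l2: "(b - c * (sp - 1)) * k < 2 ^ w"
        proof -
          have "(b - c * (sp - 1)) * k \<le> b * k" by (intro mult_le_mono1) simp
          then show ?thesis using tot by linarith
        qed
        have "H < 2 ^ w" using tot by linarith
        then have l3: "n div w + 1 < 2 ^ w" "(n div w + 1) * b < 2 ^ w" "(n div w + 1) * b + 16 < 2 ^ w"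
        proof -
          assume h: "H < 2 ^ w"
          then show "(n div w + 1) * b + 16 < 2 ^ w" "(n div w + 1) * b < 2 ^ w" unfolding H_of_def by linarith+
          have "n div w + 1 \<le> (n div w + 1) * b" using mult_le_mono2[OF b(1), of "n div w + 1"] by simp
          then show "n div w + 1 < 2 ^ w" using h unfolding H_of_def by linarith
        qed
        show ?case
          apply (rule wp_Asg_Sq[where v = N])
          using 2 l1 apply simp
          apply (rule wp_Asg_Sq[where v = NW])
          using 2 apply simp
          apply (rule wp_Asg_Sq[where v = "(b - c * (sp - 1)) * k"])
          using 2 l1 l2 c32 sp(1) apply simp
          apply (rule wp_Asg_Sq[where v = H])
          using 2 l3 c32 apply (simp add: H_of_def)
          apply (rule wp_AsgV[where v = "NW + 8"])
          using l1 l8 apply simp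
          using 2 4(1) by simp
      qed
    qed
  qed
qed

end

section \<open>Finding the shortest period\<close>

context block_string
begin

text \<open>Short periods of the whole string that are too long to be found in the list of occurrences
  of the prefix of length \<open>M\<close> all lie in a short interval.\<close>

lemma period_enum:
  assumes t: "1 \<le> t" "2 * (t * s) \<le> N" "weq S (t * s) 0 (N - t * s)" "N < t * s + M"
    and s: "1 \<le> s" "s = 1 \<or> k = 1" "s \<le> N"
  shows "\<exists>t'. 1 \<le> t' \<and> t' \<le> t \<and> (N + s - M) div s \<le> t' \<and> t' < (N + s - M) div s + (k + 2) \<and>
     weq S (t' * s) 0 (N - t' * s)"
proof -
  define p where "p = t * s"
  \<comment> \<open>The least multiplier whose multiple of s leaves fewer than \<open>M\<close>
    letters to be matched.\<close>
  define t0 where "t0 = (N + s - M) div s"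
  have MN: "M \<le> N + 1" using M_nonper M_per rho k by (cases "rho = k + 1") auto
  have t0: "N + 1 \<le> t0 * s + M" "t0 * s \<le> N + s - M"
  proof -
    have "N + s - M = t0 * s + (N + s - M) mod s" "(N + s - M) mod s < s" using s(1) by (simp_all add: t0_def)
    then show "N + 1 \<le> t0 * s + M" "t0 * s \<le> N + s - M" using MN s(1) by linarith+
  qed
  have t0t: "t0 \<le> t"
  proof -
    have "t0 * s < (t + 1) * s" using t0(2) t(4) s(1) MN by (simp add: algebra_simps)
    then have "t0 < t + 1" unfolding mult_less_cancel2 by blast
    then show ?thesis by simp
  qed
  have close: ?thesis if "t * s < t0 * s + k"
  proof -
    have "t < t0 + k"
    proof (rule ccontr)
      assume "\<not> t < t0 + k"
      then have "(t0 + k) * s \<le> t * s" by (intro mult_le_mono1) simp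
      moreover have "k \<le> k * s" using s(1) by simp
      ultimately show False using that add_mult_distrib[of t0 k s] by linarith
    qed
    then show ?thesis using t t0t by (intro exI[of _ t]) (simp add: t0_def)
  qed
  consider "rho = k + 1" | "rho \<le> k" "M \<le> N" | "rho \<le> k" "M = N + 1"
    using rho M_per by force
  then show ?thesis
  proof cases
    case 1
    then have "M = 2 * k" by (rule M_nonper)
    then show ?thesis using t0(1) t(2) k by (intro close) linarith
  next
    case 2
    \<comment> \<open>Otherwise the first violation of \<open>rho\<close>, copied back by p, would
      fall into the \<open>rho\<close>-periodic part.\<close>
    have "M < p + rho + 1"
    proof (rule ccontr)
      assume "\<not> ?thesis"
      then have a: "p + rho + 1 \<le> M" by simp
      have p1: "1 \<le> p" using t(1) s(1) unfolding p_def by simp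
      have w: "S (p + i) = S i" if "p + i < N" for i
        using weqD[OF t(3), of i] that unfolding p_def by simp
      have "S (M - 1) = S (M - 1 - p)" using w[of "M - 1 - p"] a 2 p1 by simp
      also have "\<dots> = S (M - 1 - p - rho)" using M_good[OF 2(1), of "M - 1 - p"] a p1 by simp
      also have "\<dots> = S (M - 1 - rho)"
      proof -
        have "p + (M - 1 - p - rho) = M - 1 - rho" using a by simp
        then show ?thesis using w[of "M - 1 - p - rho"] 2 p1 a by simp
      qed
      finally show False using M_bad[OF 2] by simp
    qed
    then have "M \<le> t * s + k" using 2(1) unfolding p_def by linarith
    then show ?thesis using t0(1) t(2) by (intro close) linarith
  next
    case 3
    have all: "S x = S (x - rho)" if "rho \<le> x" "x < N" for x using M_good[OF 3(1) that(1)] that 3 by simp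
    show ?thesis
    proof (cases "t < t0 + (k + 2)")
      case True
      then show ?thesis using t t0t by (intro exI[of _ t]) (simp add: t0_def)
    next
      case False
      \<comment> \<open>The whole string is \<open>rho\<close>-periodic, so the interval starts at 0
        and a smaller multiplier takes the place of t: \<open>rho\<close> itself, or 1 if
        \<open>k = 1\<close>, where all letters are equal.\<close>
      have z: "t0 = 0" using 3 s(1) unfolding t0_def by simp
      show ?thesis
      proof (cases "s = 1")
        case True
        have "weq S (rho * s) 0 (N - rho * s)"
          unfolding weq_def using all True by (auto simp: add.commute)
        then show ?thesis using False rho z 3(1) by (intro exI[of _ rho]) (simp add: t0_def)
      next
        case False': False
        then have k1: "k = 1" "rho = 1" using s 3(1) rho by auto
        have c: "S x = S 0" if "x < N" for x
          using that
        proof (induction x)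
          case (Suc x)
          then show ?case using all[of "Suc x"] k1 by simp
        qed simp
        have "weq S (1 * s) 0 (N - 1 * s)"
          unfolding weq_def using s(3)
        proof (intro allI impI)
          fix i assume "i < N - 1 * s"
          then have "1 * s + i < N" "0 + i < N" by auto
          then show "S (1 * s + i) = S (0 + i)" using c by metis
        qed
        then show ?thesis using z t(1) by (intro exI[of _ 1]) (simp add: t0_def)
      qed
    qed
  qed
qed

end

text \<open>Shifts are measured in pieces, so only multiples of the number of pieces per letter are
  periods of \<open>T\<close>. Register 60 holds the minimum so far.\<close>

definition P_try :: com where
  "P_try = Cond ((Cst 0 \<lless> V 30) \<otimes> ((V 30 \<lless> V RN \<oplus> Cst 1) \<otimes> (Op Mod (V 30) (V Rs) \<doteq> Cst 0)))
     (Asg 31 (V RN \<ominus> V 30) ;; P_occ False ;;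
      Cond (V 32 \<otimes> (Op Div (V 30) (V Rs) \<lless> V 60)) (Asg 60 (Op Div (V 30) (V Rs))) Skip) Skip"

text \<open>A period that leaves at least \<open>M\<close> letters to match is a stored candidate;
  for the others \<open>k + 2\<close> consecutive multiples suffice, by \<open>period_enum\<close>.
  The start value n is a period vacuously.\<close>

definition P_per :: com where
  "P_per = Asg 60 (V Rn) ;;
     For 61 (V RNW \<oplus> Cst 1) (Asg 30 (Ld (V Rpos \<oplus> V 61)) ;; P_try) ;;
     For 61 (V Rk \<oplus> Cst 2) (Asg 30 ((Op Div (V RN \<oplus> V Rs \<ominus> V RM) (V Rs) \<oplus> V 61) \<otimes> V Rs) ;; P_try)"

lemma mods_P_try [simp]: "mods P_try = {31, 32, 60}" and no_store_P_try [simp]: "no_store P_try"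
  by (auto simp: P_try_def)

context params
begin

lemma ds_ok_regs:
  assumes "ds_ok rv S s" "\<And>x. x < 16 \<Longrightarrow> fst s' x = fst s x" "snd s' = snd s"
  shows "ds_ok rv S s'"
  by (rule ds_ok_cong[OF assms(1)]) (use assms(2,3) in auto)

definition good_per :: "(nat \<Rightarrow> nat) \<Rightarrow> nat \<Rightarrow> nat \<Rightarrow> bool" where
  "good_per S sp r \<longleftrightarrow> 1 \<le> r \<and> r * sp \<le> N \<and> weq S (r * sp) 0 (N - r * sp)"

lemma good_perD:
  assumes "good_per S sp r" shows "1 \<le> r" "r * sp \<le> N" "weq S (r * sp) 0 (N - r * sp)"
proof -
  note a = assms[unfolded good_per_def]
  show "1 \<le> r" by (rule conjunct1[OF a])
  show "r * sp \<le> N" by (rule conjunct1[OF conjunct2[OF a]])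
  show "weq S (r * sp) 0 (N - r * sp)" by (rule conjunct2[OF conjunct2[OF a]])
qed

lemma wp_try:
  assumes ds: "ds_ok False S s" and S: "\<And>x. S x < 2 ^ c" and sp: "fst s Rs = sp" "1 \<le> sp"
    and r: "fst s 60 = r" "good_per S sp r" and p: "fst s 30 = p"
  shows "wp w P_try (\<lambda>s' t'. good_per S sp (fst s' 60) \<and> fst s' 60 \<le> r \<and>
     (\<forall>u. p = u * sp \<longrightarrow> good_per S sp u \<longrightarrow> fst s' 60 \<le> u) \<and> t' \<le> t + 600) s t"
proof -
  have par: "par s" using ds unfolding ds_ok_def by blast
  let ?c = "0 < p \<and> p \<le> N \<and> p mod sp = 0"
  have ce: "ev w ((Cst 0 \<lless> V 30) \<otimes> ((V 30 \<lless> V RN \<oplus> Cst 1) \<otimes> (Op Mod (V 30) (V Rs) \<doteq> Cst 0))) s = of_bool ?c"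
  proof -
    have 1: "ev w (Cst 0 \<lless> V 30) s = of_bool (0 < p)" "ev w (V 30 \<lless> V RN \<oplus> Cst 1) s = of_bool (p \<le> N)"
       "ev w (Op Mod (V 30) (V Rs) \<doteq> Cst 0) s = of_bool (p mod sp = 0)"
      using p sp par_D[OF par] sizes by (simp_all add: less_Suc_eq_le)
    show ?thesis unfolding ev.simps(3)[of w Mul] 1 by simp
  qed
  show ?thesis
    unfolding P_try_def
  proof (rule wp_Cond, goal_cases)
    case 2
    have nc: "\<not> ?c" using 2[unfolded ce] by simp
    have cg: ?c if "p = u * sp" "good_per S sp u" for u
    proof -
      have u: "1 \<le> u" "u * sp \<le> N" by (rule good_perD[OF that(2)])+
      have "1 * 1 \<le> u * sp" by (rule mult_le_mono[OF u(1) sp(2)])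
      then have "0 < u * sp" "u * sp mod sp = 0" by simp_all
      then have "0 < u * sp \<and> u * sp \<le> N \<and> u * sp mod sp = 0" using u(2) by blast
      then show ?thesis by (simp only: that(1))
    qed
    have no: "\<not> good_per S sp u" if "p = u * sp" for u
      using nc cg[OF that] by (rule contrapos_nn)
    show ?case unfolding wp_Skip_eq
    proof (intro conjI allI impI)
      fix u assume u: "p = u * sp" "good_per S sp u"
      show "fst s 60 \<le> u" by (rule notE[OF no[OF u(1)] u(2)])
    qed (simp_all add: r)
  next
    case 1
    have cc: "0 < p" "p \<le> N" "p mod sp = 0" using 1[unfolded ce] by simp_all
    define q where "q = p div sp"
    have q: "p = q * sp" "1 \<le> q" using cc by (auto simp: q_def)
    let ?s1 = "((fst s)(31 := N - p), snd s)"
    have ds1: "ds_ok False S ?s1" by (rule ds_ok_regs[OF ds]) simp_all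
    show ?case
    proof (rule wp_Asg_Sq[where v = "N - p"], use p cc par_D[OF par] sizes in simp,
        rule wp_SqF, rule wp_occ[OF ds1 S, of p "N - p"], use p in simp, simp, use cc in simp, use cc in simp, goal_cases)
      case (1 s2 t2)
      have r2: "fst s2 60 = r" "fst s2 30 = p" "fst s2 Rs = sp"
        using frame_reg[OF 1(2)] r p sp by simp_all
      have g: "good_per S sp u \<longleftrightarrow> weq S p 0 (N - p)" if "p = u * sp" "1 \<le> u" for u
        using that(2) cc(2) unfolding good_per_def that(1)[symmetric] by blast
      have uq: "u = q" if "p = u * sp" for u using that q sp(2) by simp
      have e2: "ev w (V 32 \<otimes> (Op Div (V 30) (V Rs) \<lless> V 60)) s2 = of_bool (weq S p 0 (N - p) \<and> q < r)"
      proof -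
        have "ev w (V 32) s2 = of_bool (weq S p 0 (N - p))" "ev w (Op Div (V 30) (V Rs) \<lless> V 60) s2 = of_bool (q < r)"
          using 1(1) r2 by (simp_all add: q_def)
        then show ?thesis unfolding ev.simps(3)[of w Mul] by simp
      qed
      have t2: "t2 + 20 \<le> t + 600" using 1(1) by simp
      show ?case
      proof (rule wp_Cond, goal_cases)
        case 1
        have gq: "good_per S sp q" "q < r" using 1[unfolded e2] g[OF q] by simp_all
        show ?case
        proof (rule wp_AsgV[where v = q], goal_cases)
          case 1
          show ?case using r2 by (simp add: q_def)
        next
          case 2
          have qu: "q \<le> u" if "p = u * sp" for u unfolding uq[OF that] by (rule order_refl)
          show ?case
          proof (intro conjI allI impI, goal_cases)
            case (3 u)
            show ?case using qu[OF 3(1)] by simp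
          qed (use gq t2 in simp_all)
        qed
      next
        case 2
        have no: "r \<le> u" if "p = u * sp" "good_per S sp u" for u
        proof -
          have "good_per S sp q" using that(2) unfolding uq[OF that(1)] .
          then have "weq S p 0 (N - p)" unfolding g[OF q] .
          then have "\<not> q < r" using 2[unfolded e2] by simp
          then show ?thesis unfolding uq[OF that(1)] by simp
        qed
        show ?case unfolding wp_Skip_eq
        proof (intro conjI allI impI)
          fix u assume u: "p = u * sp" "good_per S sp u"
          show "fst s2 60 \<le> u" unfolding r2(1) by (rule no[OF u])
        qed (use r r2 t2 in simp_all)
      qed
    qed
  qed
qed

lemma wp_per:
  assumes ds: "ds_ok False S s" and S: "\<And>x. S x < 2 ^ c" and sp: "fst s Rs = sp" "1 \<le> sp" "sp = 1 \<or> k = 1"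
    and n: "fst s Rn = n" "1 \<le> n" "N = n * sp" and big': "4 * N + 4 * n + 100 < 2 ^ w"
  shows "wp w P_per (\<lambda>s' t'. good_per S sp (fst s' 60) \<and>
     (\<forall>u. good_per S sp u \<longrightarrow> 2 * u \<le> n \<longrightarrow> fst s' 60 \<le> u) \<and> t' \<le> t + 700 * (NW + 3) + 700 * (k + 3)) s t"
proof -
  obtain rho where bs: "block_string S N k NW rho (fst s RM) (\<lambda>m. snd s (fst s Rnb + m))"
    using ds unfolding ds_ok_def by blast
  interpret B: block_string S N k NW rho "fst s RM" "\<lambda>m. snd s (fst s Rnb + m)" by (rule bs)
  have M: "fst s RM \<le> N + 1" "2 * k \<le> fst s RM" and bd: "fst s Rpos + NW < 2 ^ w" and par: "par s"
    and lst: "B.list_ok (\<lambda>e. snd s (fst s Rpos + e)) (\<lambda>e. snd s (fst s Rzb + e)) ((NW + 1) * k)"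
    using ds B.M_ge unfolding ds_ok_def by auto
  define M' where "M' = fst s RM"
  have nN: "n \<le> N" "sp \<le> N" using n(2,3) sp(2) by simp_all
  have g0: "good_per S sp n" unfolding good_per_def using n by (simp add: weq_def)
  let ?pos = "\<lambda>m. snd s (fst s Rpos + m)"
  define t0 where "t0 = (N + sp - M') div sp"
  let ?J1 = "\<lambda>m s'. good_per S sp (fst s' 60) \<and> (\<forall>u j. j < m \<longrightarrow> ?pos j = u * sp \<longrightarrow> good_per S sp u \<longrightarrow> fst s' 60 \<le> u)"
  let ?J2 = "\<lambda>m s'. ?J1 (NW + 1) s' \<and> (\<forall>j<m. good_per S sp (t0 + j) \<longrightarrow> fst s' 60 \<le> t0 + j)"
  show ?thesis
    unfolding P_per_def
  proof (rule wp_Asg_Sq[where v = n], use n in simp, rule wp_SqF,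
      rule wp_For[where L = "NW + 1" and B = 610 and J = ?J1 and Q = "\<lambda>s' t'. ?J1 (NW + 1) s' \<and> t' \<le> t + 630 * (NW + 2) + 2"], goal_cases)
    case 1
    then show ?case using g0 by simp
  next
    case 2
    then show ?case using sizes by simp
  next
    case (3 s')
    then have "fst s' RNW = NW" using par_D[OF par] by (simp add: frame_reg)
    then show ?case using sizes by simp
  next
    case (4 m s' t')
    note f = frame_reg[OF 4(4)]
    have m: "snd s' = snd s" using frame_mem[OF 4(4)] by simp
    let ?s1 = "((fst s')(30 := ?pos m), snd s')"
    have ds1: "ds_ok False S ?s1" by (rule ds_ok_regs[OF ds]) (simp_all add: f m)
    have e: "ev w (Ld (V Rpos \<oplus> V 61)) s' = ?pos m" using 4(1,2) bd f m by simp
    show ?case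
    proof (rule wp_Asg_Sq[OF e], rule wp_monoF, rule wp_try[OF ds1 S _ sp(2) refl _ refl], goal_cases)
      case 1 then show ?case using f sp by simp
    next
      case 2 then show ?case using 4(3) by simp
    next
      case (3 s2 t2)
      have a: "fst s2 60 \<le> fst s' 60" "good_per S sp (fst s2 60)" "t2 \<le> t' + 610" using 3(1) by simp_all
      have b: "fst s2 60 \<le> u" if "j < Suc m" "?pos j = u * sp" "good_per S sp u" for j u
      proof (cases "j = m")
        case True then show ?thesis using 3(1) that by simp
      next
        case False
        then have "fst s' 60 \<le> u" using 4(3) that by (auto simp: less_Suc_eq)
        then show ?thesis using a by simp
      qed
      have "fst s2 61 = m" using frame_reg[OF 3(2), of 61] 4(2) by simp
      then show ?case using a b by simp
    qed
  next
    case (5 s' t')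
    then show ?case by simp
  next
    case (6 s1 t1)
    note f1 = frame_reg[OF 6(2)]
    have m1: "snd s1 = snd s" using frame_mem[OF 6(2)] by simp
    have k2: "k + 2 < 2 ^ w" using sizes big by linarith
    have t0k: "t0 * sp \<le> N + sp" "t0 \<le> N + sp" 
    proof -
      have "t0 * sp \<le> N + sp - M'" "t0 \<le> N + sp - M'" unfolding t0_def by simp_all
      then show "t0 * sp \<le> N + sp" "t0 \<le> N + sp" by linarith+
    qed
    show ?case
    proof (rule wp_For[where L = "k + 2" and B = 620 and J = ?J2], goal_cases)
      case 1
      then show ?case using 6(1) by simp
    next
      case 2
      then show ?case by (rule k2)
    next
      case (3 s')
      then have "fst s' Rk = k" using par_D[OF par] f1 by (simp add: frame_reg)
      then show ?case using k2 by simp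
    next
      case (4 m s' t')
      note f = frame_reg[OF 4(4)]
      have fs: "fst s' x = fst s x" if "x < 16" for x using that by (simp add: f f1)
      have m: "snd s' = snd s" using frame_mem[OF 4(4)] m1 by simp
      have tm: "(t0 + m) * sp \<le> 3 * N + 3 * sp"
      proof -
        have "m * sp \<le> (k + 1) * sp" using 4(1) by (intro mult_le_mono1) simp
        also have "\<dots> \<le> N + N + sp"
        proof (cases "sp = 1")
          case True then show ?thesis using sizes by simp
        next
          case False
          then have "k = 1" using sp by simp
          then show ?thesis using nN by simp
        qed
        finally show ?thesis using t0k(1) by (simp add: add_mult_distrib)
      qed
      let ?p = "(t0 + m) * sp"
      let ?s1 = "((fst s')(30 := ?p), snd s')"
      have ds1: "ds_ok False S ?s1" by (rule ds_ok_regs[OF ds]) (simp_all add: fs m)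
      have e: "ev w ((Op Div (V RN \<oplus> V Rs \<ominus> V RM) (V Rs) \<oplus> V 61) \<otimes> V Rs) s' = ?p"
      proof -
        have "3 * N + 3 * sp < 2 ^ w" "N + sp < 2 ^ w" "t0 + m < 2 ^ w" "fst s RM \<le> N + sp"
          using big' nN t0k 4(1) M sp(2) sizes big by linarith+
        then show ?thesis using tm 4(2) fs par_D[OF par] sp by (simp add: t0_def M'_def)
      qed
      show ?case
      proof (rule wp_Asg_Sq[OF e], rule wp_monoF, rule wp_try[OF ds1 S _ sp(2) refl _ refl], goal_cases)
        case 1 then show ?case using fs sp by simp
      next
        case 2 then show ?case using 4(3) by simp
      next
        case (3 s2 t2)
        have a: "fst s2 60 \<le> fst s' 60" "good_per S sp (fst s2 60)" "t2 \<le> t' + 620" using 3(1) by simp_all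
        have b: "fst s2 60 \<le> t0 + j" if "j < Suc m" "good_per S sp (t0 + j)" for j
        proof (cases "j = m")
          case True then show ?thesis using 3(1) that by simp
        next
          case False
          then have "fst s' 60 \<le> t0 + j" using 4(3) that by (auto simp: less_Suc_eq)
          then show ?thesis using a by simp
        qed
        have c: "fst s2 60 \<le> u" if "j < NW + 1" "?pos j = u * sp" "good_per S sp u" for j u
        proof -
          have "fst s' 60 \<le> u" using 4(3) that by blast
          then show ?thesis using a by simp
        qed
        have "fst s2 61 = m" using frame_reg[OF 3(2), of 61] 4(2) by simp
        then show ?case using a b c by simp
      qed
    next
      case (5 s' t')
      have "fst s' 60 \<le> u" if u: "good_per S sp u" "2 * u \<le> n" for u
      proof -
        have u1: "1 \<le> u" "u * sp \<le> N" "weq S (u * sp) 0 (N - u * sp)" by (rule good_perD[OF u(1)])+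
        have u2: "2 * (u * sp) \<le> N" using mult_le_mono1[OF u(2), of sp] n(3) by simp
        show ?thesis
        proof (cases "u * sp + fst s RM \<le> N")
          case True
          have cu: "B.cand (u * sp)" unfolding B.cand_def
            using True u1 sp(2) by (auto intro: weq_mono)
          have "u * sp + (fst s RM - 2 * k) < (NW + 1) * k" using True NWk sizes M by simp
          then have "?pos (u * sp div k) = u * sp" by (rule B.list_ok_pos[OF lst cu])
          moreover have "u * sp div k < NW + 1" using div_le_NW[OF u1(2)] by simp
          ultimately show ?thesis
            using 5(1)[THEN conjunct1, THEN conjunct2, rule_format, of "u * sp div k" u] u(1) by blast
        next
          case False
          \<comment> \<open>\<open>u'\<close> may be smaller than u, which is good enough for a
            minimum.\<close>
          then obtain u' where u': "1 \<le> u'" "u' \<le> u" "t0 \<le> u'" "u' < t0 + (k + 2)" "weq S (u' * sp) 0 (N - u' * sp)"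
            using B.period_enum[OF u1(1) u2 u1(3) _ sp(2,3) nN(2)] unfolding t0_def M'_def by auto
          have "u' * sp \<le> u * sp" using u'(2) by (rule mult_le_mono1)
          then have "u' * sp \<le> N" using u1(2) by (rule le_trans)
          then have "good_per S sp (t0 + (u' - t0))" unfolding good_per_def using u'(1,3,5) by simp
          moreover have "u' - t0 < k + 2" using u'(3,4) by linarith
          ultimately have "fst s' 60 \<le> t0 + (u' - t0)" using 5(1)[THEN conjunct2, rule_format, of "u' - t0"] by blast
          then show ?thesis using u'(2,3) by linarith
        qed
      qed
      moreover have "t' \<le> t + 700 * (NW + 3) + 700 * (k + 3)" using 5(4) 6(1) by simp
      ultimately show ?case using 5(1) by blast
    qed
  qed
qed

end

section \<open>The preprocessing and query programs\<close>

definition P_bases :: "exp \<Rightarrow> com" where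
  "P_bases a = Asg RW a ;; Asg Rnb (V RW \<oplus> V 53) ;; Asg Rpos (V Rnb \<oplus> V 53) ;; Asg Rzb (V Rpos \<oplus> V 53)"

text \<open>The header cells are written only after the input has been copied into blocks. Both
  directions share the space above \<open>H + 9 * st\<close> for their lookup table, which serves
  construction only and is not among the cells that a query may read.\<close>

definition P_main :: com where
  "P_main = P_bases (V RA \<oplus> V 53) ;; Asg Rtab (V RA \<oplus> Cst 9 \<otimes> V 53) ;; P_build False ;; P_per ;;
     Sto (Cst 0) (V Rk) ;; Sto (Cst 1) (V Rc) ;; Sto (Cst 2) (V Rs) ;; Sto (Cst 3) (V RN) ;; Sto (Cst 4) (V RNW) ;;
     Sto (Cst 5) (V Rn) ;; Sto (Cst 6) (V 60) ;; Sto (Cst 7) (V RM) ;; Sto (Cst 8) (V RW) ;; Sto (Cst 9) (V 53) ;;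
     P_bases (V Rzb \<oplus> V 53) ;; P_build True ;; Sto (Cst 10) (V RM)"

definition P_prep :: com where
  "P_prep = P_par ;; P_pack ;; P_main"

text \<open>If r divides d, including \<open>d = 0\<close>, the answer is one progression. Otherwise
  registers 75 and 32 hold the truth values for d and for 0, and their sum is the number of
  progressions. The first starts at d times register 75, hence at 0 when only 0 is an occurrence;
  the second is always 0.\<close>

definition P_query :: com where
  "P_query = Asg 70 (V 0) ;; Asg 71 (V 1) ;;
     Asg Rk (Ld (Cst 0)) ;; Asg Rc (Ld (Cst 1)) ;; Asg Rs (Ld (Cst 2)) ;; Asg RN (Ld (Cst 3)) ;; Asg RNW (Ld (Cst 4)) ;;
     Asg 72 (Ld (Cst 5)) ;; Asg 73 (Ld (Cst 6)) ;; Asg 53 (Ld (Cst 9)) ;; Asg RM (Ld (Cst 7)) ;;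
     P_bases (Ld (Cst 8)) ;;
     Cond (V 70 \<oplus> Cst 1 \<lless> V 71) (Asg 0 (Cst 0))
       (Asg 74 (V 70 \<oplus> Cst 1 \<ominus> V 71) ;;
        Cond (Op Mod (V 74) (V 73) \<doteq> Cst 0)
          (Asg 0 (Cst 1) ;; Asg 1 (Cst 0) ;; Asg 2 (V 73) ;; Asg 3 (Op Div (V 74) (V 73) \<oplus> Cst 1))
          (Asg 30 (V 74 \<otimes> V Rs) ;; Asg 31 (V 71 \<otimes> V Rs) ;; P_occ False ;; Asg 75 (V 32) ;;
           Asg RM (Ld (Cst 10)) ;; P_bases (V Rzb \<oplus> V 53) ;;
           Asg 31 ((V 72 \<ominus> Cst 1 \<ominus> V 70) \<otimes> V Rs) ;; P_occ True ;;
           Asg 0 (V 75 \<oplus> V 32) ;; Asg 1 (V 74 \<otimes> V 75) ;; Asg 2 (Cst 0) ;; Asg 3 (Cst 1) ;;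
           Asg 4 (Cst 0) ;; Asg 5 (Cst 0) ;; Asg 6 (Cst 1)))"

lemma wp_bases:
  assumes e: "ev w a s = x" and b: "fst s 53 = y" "x + 3 * y < 2 ^ w"
  shows "wp w (P_bases a) (\<lambda>s' t'. fst s' RW = x \<and> fst s' Rnb = x + y \<and> fst s' Rpos = x + 2 * y \<and>
    fst s' Rzb = x + 3 * y \<and> t' \<le> t + cost a + 13) s t"
  unfolding P_bases_def
proof (rule wp_Asg_Sq[OF e], rule wp_Asg_Sq[where v = "x + y"], use b in simp,
    rule wp_Asg_Sq[where v = "x + 2 * y"], use b in simp, rule wp_AsgV[where v = "x + 3 * y"], use b in simp, goal_cases)
  case 1
  show ?case by simp
qed

lemma mods_P_bases [simp]: "mods (P_bases a) = {RW, Rnb, Rpos, Rzb}" and no_store_P_bases [simp]: "no_store (P_bases a)"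
  by (auto simp: P_bases_def)

context packed
begin

definition st :: nat where "st = NW + 8"

text \<open>\<open>sF\<close> and \<open>sR\<close> are snapshots of the machine when the two
  structures were finished. The memory has to agree with them only on their arrays, which survives
  later writes elsewhere.\<close>

definition prepared :: "nat \<Rightarrow> (nat \<Rightarrow> nat) \<Rightarrow> bool" where
  "prepared H \<mu> \<longleftrightarrow> (\<exists>B sF sR r. (\<forall>x. B x < 2 ^ c) \<and> (\<forall>x<N. B (3 * k + x) = piece sp c T x) \<and>
     ds_ok False (fstr False B k N) sF \<and> ds_ok True (fstr True B k N) sR \<and>
     fst sF RW = H + st \<and> fst sF Rnb = H + 2 * st \<and> fst sF Rpos = H + 3 * st \<and> fst sF Rzb = H + 4 * st \<and>
     fst sR RW = H + 5 * st \<and> fst sR Rnb = H + 6 * st \<and> fst sR Rpos = H + 7 * st \<and> fst sR Rzb = H + 8 * st \<and>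
     (\<forall>a. H + st \<le> a \<longrightarrow> a < H + 5 * st \<longrightarrow> \<mu> a = snd sF a) \<and>
     (\<forall>a. H + 5 * st \<le> a \<longrightarrow> a < H + 9 * st \<longrightarrow> \<mu> a = snd sR a) \<and>
     \<mu> 0 = k \<and> \<mu> 1 = c \<and> \<mu> 2 = sp \<and> \<mu> 3 = N \<and> \<mu> 4 = NW \<and> \<mu> 5 = n \<and> \<mu> 6 = r \<and> \<mu> 7 = fst sF RM \<and>
     \<mu> 8 = H + st \<and> \<mu> 9 = st \<and> \<mu> 10 = fst sR RM \<and>
     good_per (fstr False B k N) sp r \<and> (\<forall>u. good_per (fstr False B k N) sp u \<longrightarrow> 2 * u \<le> n \<longrightarrow> r \<le> u))"

lemma prepared_agree:
  assumes "prepared H \<mu>" "agree_below (H + 9 * st) \<mu>' \<mu>" "16 \<le> H"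
  shows "prepared H \<mu>'"
proof -
  have e: "\<mu>' a = \<mu> a" if "a < H + 9 * st" for a using assms(2) that unfolding agree_below_def by blast
  have z: "\<mu>' 0 = \<mu> 0" "\<mu>' 1 = \<mu> 1" "\<mu>' 2 = \<mu> 2" "\<mu>' 3 = \<mu> 3" "\<mu>' 4 = \<mu> 4" "\<mu>' 5 = \<mu> 5" "\<mu>' 6 = \<mu> 6" "\<mu>' 7 = \<mu> 7"
    "\<mu>' 8 = \<mu> 8" "\<mu>' 9 = \<mu> 9" "\<mu>' 10 = \<mu> 10"
    by (rule e, use assms(3) in linarith)+
  have m1: "(\<forall>a. H + st \<le> a \<longrightarrow> a < H + 5 * st \<longrightarrow> \<mu>' a = f a) \<longleftrightarrow> (\<forall>a. H + st \<le> a \<longrightarrow> a < H + 5 * st \<longrightarrow> \<mu> a = f a)" for f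
  proof (intro all_cong1 imp_cong refl)
    fix a assume "a < H + 5 * st"
    then have "a < H + 9 * st" by linarith
    then show "\<mu>' a = f a \<longleftrightarrow> \<mu> a = f a" by (simp only: e)
  qed
  have m2: "(\<forall>a. H + 5 * st \<le> a \<longrightarrow> a < H + 9 * st \<longrightarrow> \<mu>' a = f a) \<longleftrightarrow> (\<forall>a. H + 5 * st \<le> a \<longrightarrow> a < H + 9 * st \<longrightarrow> \<mu> a = f a)" for f
    by (intro all_cong1 imp_cong refl) (simp only: e)
  show ?thesis using assms(1) unfolding prepared_def z m1 m2 .
qed

lemma wp_main:
  assumes par: "par s" and r: "fst s Rs = sp" "fst s RA = H" "fst s 53 = st" "fst s Rn = n"
    and bl: "blocks B s" "\<And>x. B x < 2 ^ c" "\<And>x. x < N \<Longrightarrow> B (3 * k + x) = piece sp c T x"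
    and H: "16 \<le> H" "H + 9 * st + 2 ^ (3 * (k * c)) < 2 ^ w" and big': "4 * N + 4 * n + 100 < 2 ^ w" and n: "2 \<le> n"
  shows "wp w P_main (\<lambda>s' t'. prepared H (snd s') \<and>
     t' \<le> t + 10000 * (NW + 2) + 4000 * ((k + 2) * (2 ^ (3 * (k * c)) + 1))) s t"
proof -
  let ?F = "fstr False B k N" and ?R = "fstr True B k N"
  have SF: "\<And>x. ?F x < 2 ^ c" using bl(2) by (rule fstr_less)
  have stw: "8 \<le> st" "st = NW + 8" by (simp_all add: st_def)
  have lt: "H + st < 2 ^ w" "H + st + 3 * st < 2 ^ w" "H + 4 * st + st < 2 ^ w" "H + 5 * st + 3 * st < 2 ^ w" "9 * st < 2 ^ w" "H + 9 * st < 2 ^ w" "16 < (2::nat) ^ w"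
    using H by linarith+
  have c9: "9 mod 2 ^ w = (9::nat)" "2 mod 2 ^ w = (2::nat)" "3 mod 2 ^ w = (3::nat)" "4 mod 2 ^ w = (4::nat)" "5 mod 2 ^ w = (5::nat)"
    "6 mod 2 ^ w = (6::nat)" "7 mod 2 ^ w = (7::nat)" "8 mod 2 ^ w = (8::nat)" "10 mod 2 ^ w = (10::nat)" using lt(7) by simp_all
  have e0: "ev w (V RA \<oplus> V 53) s = H + st" using r lt by simp
  show ?thesis
    unfolding P_main_def
  proof (rule wp_SqF, rule wp_bases[OF e0 r(3)], use lt in simp, goal_cases)
    case (1 s1 t1)
    note f1 = frame_reg[OF 1(2)] and g1 = 1(1)
    have m1: "snd s1 = snd s" using frame_mem[OF 1(2)] by simp
    let ?s2 = "((fst s1)(Rtab := H + 9 * st), snd s1)"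
    have q2: "fst ?s2 RA = H" "fst ?s2 RW = H + st" "fst ?s2 Rnb = H + 2 * st" "fst ?s2 Rpos = H + 3 * st" "fst ?s2 Rzb = H + 4 * st" "fst ?s2 Rtab = H + 9 * st"
      using g1 f1 r by simp_all
    have p2: "par ?s2" by (rule par_cong[OF par]) (simp_all add: f1)
    have b2: "blocks B ?s2" using bl(1) m1 f1 unfolding blocks_def by simp
    show ?case
    proof (rule wp_Asg_Sq[where v = "H + 9 * st"], use f1 r lt c9 in simp, rule wp_SqF,
        rule wp_build[OF p2 b2 bl(2)], unfold q2, use stw in linarith, use stw in linarith, use stw in linarith, use stw in linarith,
        use stw in linarith, use H in linarith, goal_cases)
      case (1 s3 t3)
      note f3 = frame_reg[OF 1(2), unfolded mods_P_build] and g3 = 1(1)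
      have q3: "fst s3 RW = H + st" "fst s3 Rnb = H + 2 * st" "fst s3 Rpos = H + 3 * st" "fst s3 Rzb = H + 4 * st" "fst s3 Rtab = H + 9 * st"
        "fst s3 53 = st" "fst s3 Rs = sp" "fst s3 Rn = n" "fst s3 RA = H"
        using q2 f1 r by (simp_all add: f3)
      have ds3: "ds_ok False ?F s3" using g3 by blast
      then have p3: "par s3" unfolding ds_ok_def by blast
      have sk: "sp = 1 \<or> k = 1" using sp(4) by blast
      have n1: "1 \<le> n" using n by simp
      show ?case
      proof (rule wp_SqF, rule wp_per[OF ds3 SF q3(7) sp(1) sk q3(8) n1 N big'], goal_cases)
        case (1 s4 t4)
        note g4 = 1(1)
        have md: "mods P_per = {30, 31, 32, 60, 61}" "no_store P_per" by (auto simp: P_per_def)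
        note f4 = frame_reg[OF 1(2), unfolded md]
        have m4: "snd s4 = snd s3" using frame_mem[OF 1(2)] md by simp
        have q4: "fst s4 RW = H + st" "fst s4 Rzb = H + 4 * st" "fst s4 Rtab = H + 9 * st"
          "fst s4 53 = st" "fst s4 Rs = sp" "fst s4 Rn = n" "fst s4 RA = H" "fst s4 RM = fst s3 RM"
          "fst s4 Rk = k" "fst s4 Rc = c" "fst s4 RN = N" "fst s4 RNW = NW"
          using q3 par_D[OF p3] by (simp_all add: f4)
        let ?\<mu> = "(snd s3)(0 := k, 1 := c, 2 := sp, 3 := N, 4 := NW, 5 := n, 6 := fst s4 60, 7 := fst s3 RM, 8 := H + st, 9 := st)"
        have big\<mu>: "?\<mu> a = snd s3 a" if "16 \<le> a" for a using that by simp
        let ?s5 = "(fst s4, ?\<mu>)"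
        have p5: "par ?s5" using q4 unfolding par_def by simp
        have b5: "blocks B ?s5"
          unfolding blocks_def
        proof (intro conjI allI impI)
          fix q assume q: "q < NW + 7"
          have "?\<mu> (H + q) = snd s3 (H + q)" using H by (intro big\<mu>) simp
          also have "\<dots> = snd s (H + q)" using g3 m1 q2 q stw by simp
          also have "\<dots> = code c (\<lambda>i. B (q * k + i)) k" using bl(1) q r unfolding blocks_def by simp
          finally show "snd ?s5 (fst ?s5 RA + q) = code c (\<lambda>i. B (q * k + i)) k" using q4 by simp
        qed (use q4 lt stw in simp)
        have C: "wp w (P_bases (V Rzb \<oplus> V 53) ;; P_build True ;; Sto (Cst 10) (V RM)) (\<lambda>s' t'. prepared H (snd s') \<and>
            t' \<le> t + 10000 * (NW + 2) + 4000 * ((k + 2) * (2 ^ (3 * (k * c)) + 1))) ?s5 t5"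
          if t5: "t5 \<le> t4 + 100" for t5
        proof (rule wp_SqF, rule wp_bases[of w _ _ "H + 5 * st" st], use q4 lt in simp, use q4 in simp, use lt in simp, goal_cases)
          case (1 s6 t6)
          note f6 = frame_reg[OF 1(2)] and g6 = 1(1)
          have m6: "snd s6 = ?\<mu>" using frame_mem[OF 1(2)] by simp
          have q6: "fst s6 RA = H" "fst s6 RW = H + 5 * st" "fst s6 Rnb = H + 6 * st" "fst s6 Rpos = H + 7 * st" "fst s6 Rzb = H + 8 * st" "fst s6 Rtab = H + 9 * st"
            using g6 q4 by (simp_all add: f6)
          have p6: "par s6" by (rule par_cong[OF p5]) (simp_all add: f6)
          have b6: "blocks B s6" using b5 m6 f6 unfolding blocks_def by simp
          show ?case
          proof (rule wp_SqF, rule wp_build[OF p6 b6 bl(2)], unfold q6, use stw in linarith, use stw in linarith, use stw in linarith, use stw in linarith,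
              use stw in linarith, use H in linarith, goal_cases)
            case (1 s7 t7)
            note f7 = frame_reg[OF 1(2), unfolded mods_P_build] and g7 = 1(1)
            have q7: "fst s7 RW = H + 5 * st" "fst s7 Rnb = H + 6 * st" "fst s7 Rpos = H + 7 * st" "fst s7 Rzb = H + 8 * st"
              using q6 by (simp_all add: f7)
            let ?\<nu> = "(snd s7)(10 := fst s7 RM)"
            have lo: "snd s7 a = ?\<mu> a" if "a < H + 5 * st" for a using g7 that m6 by simp
            have hi: "?\<nu> a = snd s7 a" if "16 \<le> a" for a using that by simp
            have v: "?\<nu> a = ?\<mu> a" if "a < 10" for a
            proof -
              have "a < H + 5 * st" using that H by linarith
              then have "snd s7 a = ?\<mu> a" by (rule lo)
              then show ?thesis using that by simp
            qed
            have "prepared H ?\<nu>"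
              unfolding prepared_def
            proof (rule exI[of _ B], rule exI[of _ s3], rule exI[of _ s7], rule exI[of _ "fst s4 60"], intro conjI)
              show "\<forall>a. H + st \<le> a \<longrightarrow> a < H + 5 * st \<longrightarrow> ?\<nu> a = snd s3 a"
              proof (intro allI impI)
                fix a assume a: "H + st \<le> a" "a < H + 5 * st"
                then have "16 \<le> a" using H by linarith
                then show "?\<nu> a = snd s3 a" using hi lo[OF a(2)] big\<mu> by simp
              qed
              show "\<forall>a. H + 5 * st \<le> a \<longrightarrow> a < H + 9 * st \<longrightarrow> ?\<nu> a = snd s7 a"
              proof (intro allI impI)
                fix a assume a: "H + 5 * st \<le> a" "a < H + 9 * st"
                then have "16 \<le> a" using H by linarith
                then show "?\<nu> a = snd s7 a" by (rule hi)
              qed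
              show "\<forall>x. B x < 2 ^ c" "\<forall>x<N. B (3 * k + x) = piece sp c T x" using bl by blast+
              show "ds_ok False ?F s3" "ds_ok True ?R s7" using ds3 g7 by blast+
              show "good_per ?F sp (fst s4 60)" "\<forall>u. good_per ?F sp u \<longrightarrow> 2 * u \<le> n \<longrightarrow> fst s4 60 \<le> u" using g4 by blast+
              show "?\<nu> 0 = k" "?\<nu> 1 = c" "?\<nu> 2 = sp" "?\<nu> 3 = N" "?\<nu> 4 = NW" "?\<nu> 5 = n" "?\<nu> 6 = fst s4 60" "?\<nu> 7 = fst s3 RM"
                "?\<nu> 8 = H + st" "?\<nu> 9 = st" by (subst v, simp, simp)+
              show "?\<nu> 10 = fst s7 RM" by simp
            qed (simp_all only: q3 q7)
            moreover have "t7 + 3 \<le> t + 10000 * (NW + 2) + 4000 * ((k + 2) * (2 ^ (3 * (k * c)) + 1))"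
            proof -
              define X Y K where "X = NW + 2" and "Y = (k + 2) * (2 ^ (3 * (k * c)) + 1)" and "K = k + 2"
              have k2: "K \<le> Y" "2 \<le> X" by (simp_all add: X_def Y_def K_def)
              have "t1 \<le> t + 20" using g1 by simp
              moreover have "t3 \<le> t1 + 6 + 3000 * X + 200 * Y + 400 * K"
                using g3 unfolding X_def Y_def K_def mult.assoc by simp
              ultimately have 1: "t3 \<le> t + 26 + 3000 * X + 200 * Y + 400 * K" by linarith
              have "t4 \<le> t3 + 1400 * X + 1400 * K" using g4 by (simp add: X_def K_def)
              then have 2: "t4 \<le> t + 26 + 4400 * X + 200 * Y + 1800 * K" using 1 by linarith
              have "t6 \<le> t4 + 120" using g6 t5 by simp
              then have 3: "t6 \<le> t + 146 + 4400 * X + 200 * Y + 1800 * K" using 2 by linarith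
              have "t7 \<le> t6 + 3000 * X + 200 * Y + 400 * K"
                using g7 unfolding X_def Y_def K_def mult.assoc by simp
              then have 4: "t7 \<le> t + 146 + 7400 * X + 400 * Y + 2200 * K" using 3 by linarith
              have "2200 * K \<le> 2200 * Y" using k2 by simp
              then have "t7 + 3 \<le> t + 149 + 7400 * X + 2600 * Y" using 4 by linarith
              then have "t7 + 3 \<le> t + 10000 * X + 4000 * Y" using k2(2) by simp
              then show ?thesis by (simp only: X_def Y_def)
            qed
            ultimately show ?case using c9 by (intro wp_StoV[where i = 10 and v = "fst s7 RM"]) simp_all
          qed
        qed
        show ?case
          apply (rule wp_Sto_Sq[where i = 0 and v = "k"], use c9 in simp, use q4 in simp)
          apply (rule wp_Sto_Sq[where i = 1 and v = "c"], use c9 in simp, use q4 in simp)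
          apply (rule wp_Sto_Sq[where i = 2 and v = "sp"], use c9 in simp, use q4 in simp)
          apply (rule wp_Sto_Sq[where i = 3 and v = "N"], use c9 in simp, use q4 in simp)
          apply (rule wp_Sto_Sq[where i = 4 and v = "NW"], use c9 in simp, use q4 in simp)
          apply (rule wp_Sto_Sq[where i = 5 and v = "n"], use c9 in simp, use q4 in simp)
          apply (rule wp_Sto_Sq[where i = 6 and v = "fst s4 60"], use c9 in simp, use q4 in simp)
          apply (rule wp_Sto_Sq[where i = 7 and v = "fst s3 RM"], use c9 in simp, use q4 in simp)
          apply (rule wp_Sto_Sq[where i = 8 and v = "H + st"], use c9 in simp, use q4 in simp)
          apply (rule wp_Sto_Sq[where i = 9 and v = "st"], use c9 in simp, use q4 in simp)
          apply (simp only: fst_conv snd_conv m4)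
          apply (rule C)
          apply simp
          done
      qed
    qed
  qed
qed

end

context packed
begin

lemma letters': "x < length T \<Longrightarrow> T ! x < 2 ^ (c * sp)"
proof -
  assume "x < length T"
  then have "T ! x < 2 ^ b" using letters len by simp
  also have "(2::nat) ^ b \<le> 2 ^ (c * sp)" using sp(3) by (intro power_increasing) auto
  finally show ?thesis .
qed

lemma fwd_match:
  assumes "\<forall>x<N. B (3 * k + x) = piece sp c T x" "d + l \<le> n"
  shows "weq (fstr False B k N) (d * sp) 0 (l * sp) \<longleftrightarrow> (\<forall>x<l. T ! (d + x) = T ! x)"
  by (rule match_pieces[OF letters']) (use assms sp(1) len N in \<open>auto simp: fstr_def\<close>)

lemma rev_match:
  assumes "\<forall>x<N. B (3 * k + x) = piece sp c T x" "d + l \<le> n"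
  shows "weq (fstr True B k N) (d * sp) 0 (l * sp) \<longleftrightarrow> (\<forall>x<l. T ! (n - 1 - (d + x)) = T ! (n - 1 - x))"
proof -
  have "fstr True B k N y = piece sp c T (N - 1 - y)" if "y < N" for y
  proof -
    have "3 * k + N - 1 - y = 3 * k + (N - 1 - y)" "N - 1 - y < N" using that by linarith+
    then show ?thesis using assms(1)[rule_format, of "N - 1 - y"] by (simp add: fstr_def)
  qed
  then show ?thesis
    using match_pieces_rev[of T c sp d l "fstr True B k N", OF letters'] assms(2) sp(1) len N by simp
qed

lemma good_per_iff:
  assumes "\<forall>x<N. B (3 * k + x) = piece sp c T x"
  shows "good_per (fstr False B k N) sp r \<longleftrightarrow> 1 \<le> r \<and> r \<le> n \<and> per_on ((!) T) 0 n r"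
proof -
  have 1: "r * sp \<le> N \<longleftrightarrow> r \<le> n" using sp(1) N by simp
  have 2: "weq (fstr False B k N) (r * sp) 0 (N - r * sp) \<longleftrightarrow> per_on ((!) T) 0 n r" if "r \<le> n"
  proof -
    have "N - r * sp = (n - r) * sp" unfolding N by (simp add: diff_mult_distrib)
    then have "weq (fstr False B k N) (r * sp) 0 (N - r * sp) \<longleftrightarrow> (\<forall>x<n - r. T ! (r + x) = T ! x)"
      using fwd_match[where B = B and d = r and l = "n - r", OF assms] that by simp
    also have "\<dots> \<longleftrightarrow> per_on ((!) T) 0 n r"
      unfolding per_on_def by (metis add.commute less_diff_conv zero_le)
    finally show ?thesis .
  qed
  show ?thesis unfolding good_per_def using 1 2 by blast
qed

lemma pre_match:
  assumes "\<forall>x<N. B (3 * k + x) = piece sp c T x" "j + d \<le> n"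
  shows "weq (fstr False B k N) (d * sp) 0 (j * sp) \<longleftrightarrow> per_on ((!) T) 0 (j + d) d"
proof -
  have "d + j \<le> n" using assms(2) by simp
  note m = fwd_match[where B = B, OF assms(1) this]
  show ?thesis unfolding m per_on_def by (auto simp: add.commute)
qed

text \<open>The suffix from j on becomes a prefix of the reversed string, and periods are invariant
  under reversal.\<close>

lemma suf_match:
  assumes "\<forall>x<N. B (3 * k + x) = piece sp c T x" "j + d \<le> n"
  shows "weq (fstr True B k N) (d * sp) 0 ((n - (j + d)) * sp) \<longleftrightarrow> per_on ((!) T) j n d"
proof -
  have "d + (n - (j + d)) \<le> n" using assms(2) by simp
  note m = rev_match[where B = B, OF assms(1) this]
  show ?thesis unfolding m per_on_def
  proof (intro iffI allI impI)
    fix y assume *: "\<forall>x<n - (j + d). T ! (n - 1 - (d + x)) = T ! (n - 1 - x)" "j \<le> y" "y + d < n"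
    have "n - 1 - (y + d) < n - (j + d)" "n - 1 - (d + (n - 1 - (y + d))) = y" "n - 1 - (n - 1 - (y + d)) = y + d"
      using *(2,3) by linarith+
    then show "T ! y = T ! (y + d)" using *(1) by metis
  next
    fix x assume *: "\<forall>y. j \<le> y \<longrightarrow> y + d < n \<longrightarrow> T ! y = T ! (y + d)" "x < n - (j + d)"
    have "j \<le> n - 1 - (d + x)" "n - 1 - (d + x) + d < n" "n - 1 - (d + x) + d = n - 1 - x"
      using *(2) by linarith+
    then show "T ! (n - 1 - (d + x)) = T ! (n - 1 - x)" using *(1) by metis
  qed
qed

definition out_set :: "(nat \<Rightarrow> nat) \<Rightarrow> nat set" where
  "out_set f = (\<Union>q<f 0. arith_prog (f (3 * q + 1)) (f (3 * q + 2)) (f (3 * q + 3)))"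

lemma out_set_0: "f 0 = 0 \<Longrightarrow> out_set f = {}"
  by (simp add: out_set_def)

lemma out_set_1: "f 0 = 1 \<Longrightarrow> out_set f = arith_prog (f 1) (f 2) (f 3)"
  by (simp add: out_set_def lessThan_Suc eval_nat_numeral)

lemma out_set_2: "f 0 = 2 \<Longrightarrow> out_set f = arith_prog (f 1) (f 2) (f 3) \<union> arith_prog (f 4) (f 5) (f 6)"
proof -
  assume "f 0 = 2"
  moreover have "{..<2::nat} = {0, 1}" by auto
  ultimately show ?thesis by (simp add: out_set_def eval_nat_numeral)
qed

lemma arith_prog_1: "arith_prog a 0 1 = {a}"
  by (auto simp: arith_prog_def)

lemma wp_query:
  assumes pr: "prepared H (snd s)" and ij: "fst s 0 = i" "fst s 1 = j" "i < n" "j < n"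
    and H: "16 \<le> H" "H + 9 * st < 2 ^ w" and big': "4 * N + 4 * n + 100 < 2 ^ w"
  shows "wp w P_query (\<lambda>s' t'. fst s' 0 \<le> 2 \<and> out_set (fst s') = pref_suf T i j \<and> t' \<le> t + 3000) s t"
proof -
  define \<mu> where "\<mu> = snd s"
  obtain B sF sR r where B: "\<And>x. B x < 2 ^ c" "\<forall>x<N. B (3 * k + x) = piece sp c T x"
    and ds: "ds_ok False (fstr False B k N) sF" "ds_ok True (fstr True B k N) sR"
    and rF: "fst sF RW = H + st" "fst sF Rnb = H + 2 * st" "fst sF Rpos = H + 3 * st" "fst sF Rzb = H + 4 * st"
    and rR: "fst sR RW = H + 5 * st" "fst sR Rnb = H + 6 * st" "fst sR Rpos = H + 7 * st" "fst sR Rzb = H + 8 * st"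
    and mF: "\<And>a. H + st \<le> a \<Longrightarrow> a < H + 5 * st \<Longrightarrow> \<mu> a = snd sF a"
    and mR: "\<And>a. H + 5 * st \<le> a \<Longrightarrow> a < H + 9 * st \<Longrightarrow> \<mu> a = snd sR a"
    and \<mu>: "\<mu> 0 = k" "\<mu> 1 = c" "\<mu> 2 = sp" "\<mu> 3 = N" "\<mu> 4 = NW" "\<mu> 5 = n" "\<mu> 6 = r" "\<mu> 7 = fst sF RM"
     "\<mu> 8 = H + st" "\<mu> 9 = st" "\<mu> 10 = fst sR RM"
    and gr: "good_per (fstr False B k N) sp r" "\<And>u. good_per (fstr False B k N) sp u \<Longrightarrow> 2 * u \<le> n \<Longrightarrow> r \<le> u"
    using pr unfolding prepared_def \<mu>_def by blast
  note gp = good_per_iff[where B = B, OF B(2)]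
  have r: "1 \<le> r" "r \<le> n" "per_on ((!) T) 0 n r" using gp[of r, THEN iffD1, OF gr(1)] by blast+
  have rm: "r \<le> q" if "0 < q" "2 * q \<le> n" "per_on ((!) T) 0 n q" for q
  proof (rule gr(2)[OF _ that(2)])
    have "1 \<le> q" "q \<le> n" using that(1,2) by linarith+
    then show "good_per (fstr False B k N) sp q" using gp[of q, THEN iffD2] that(3) by blast
  qed
  have lt: "H + st + 3 * st < 2 ^ w" "H + 4 * st + st < 2 ^ w" "H + 5 * st + 3 * st < 2 ^ w" "i + 1 < 2 ^ w" "n < 2 ^ w" "16 < (2::nat) ^ w" "n + 1 < 2 ^ w"
    using H big' ij by linarith+
  have cm: "2 mod 2 ^ w = (2::nat)" "3 mod 2 ^ w = (3::nat)" "4 mod 2 ^ w = (4::nat)" "5 mod 2 ^ w = (5::nat)"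
    "6 mod 2 ^ w = (6::nat)" "7 mod 2 ^ w = (7::nat)" "8 mod 2 ^ w = (8::nat)" "9 mod 2 ^ w = (9::nat)" "10 mod 2 ^ w = (10::nat)" using lt(6) by simp_all
  have parF: "par sF" and parR: "par sR" using ds unfolding ds_ok_def by blast+
  have stw: "NW < st" by (simp add: st_def)
  have j1: "i + 1 \<le> n" using ij by simp
  note ps = pref_suf_split[of i T j, unfolded len, OF ij(3,4)]
  let ?s1 = "((fst s)(70 := i, 71 := j, Rk := k, Rc := c, Rs := sp, RN := N, RNW := NW, 72 := n, 73 := r, 53 := st, RM := fst sF RM), \<mu>)"
  let ?Q = "\<lambda>s' t'. fst s' 0 \<le> 2 \<and> out_set (fst s') = pref_suf T i j \<and> t' \<le> t + 3000"
  let ?occ2 = "Asg 30 (V 74 \<otimes> V Rs) ;; Asg 31 (V 71 \<otimes> V Rs) ;; P_occ False ;; Asg 75 (V 32) ;;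
           Asg RM (Ld (Cst 10)) ;; P_bases (V Rzb \<oplus> V 53) ;;
           Asg 31 ((V 72 \<ominus> Cst 1 \<ominus> V 70) \<otimes> V Rs) ;; P_occ True ;;
           Asg 0 (V 75 \<oplus> V 32) ;; Asg 1 (V 74 \<otimes> V 75) ;; Asg 2 (Cst 0) ;; Asg 3 (Cst 1) ;;
           Asg 4 (Cst 0) ;; Asg 5 (Cst 0) ;; Asg 6 (Cst 1)"
  let ?body = "Cond (V 70 \<oplus> Cst 1 \<lless> V 71) (Asg 0 (Cst 0))
       (Asg 74 (V 70 \<oplus> Cst 1 \<ominus> V 71) ;;
        Cond (Op Mod (V 74) (V 73) \<doteq> Cst 0)
          (Asg 0 (Cst 1) ;; Asg 1 (Cst 0) ;; Asg 2 (V 73) ;; Asg 3 (Op Div (V 74) (V 73) \<oplus> Cst 1)) ?occ2)"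
  have main: "wp w (P_bases (Ld (Cst 8)) ;; ?body) ?Q ?s1 t1" if t1: "t1 \<le> t + 40" for t1
  proof (rule wp_SqF, rule wp_bases[of w _ _ "H + st" st], use \<mu> cm in simp, simp, use lt in simp, goal_cases)
    case (1 s2 t2)
    note f2 = frame_reg[OF 1(2), unfolded mods_P_bases] and g2 = 1(1)
    have m2: "snd s2 = \<mu>" using frame_mem[OF 1(2)] by simp
    have q2: "fst s2 70 = i" "fst s2 71 = j" "fst s2 Rk = k" "fst s2 Rc = c" "fst s2 Rs = sp" "fst s2 RN = N" "fst s2 RNW = NW"
      "fst s2 72 = n" "fst s2 73 = r" "fst s2 53 = st" "fst s2 RM = fst sF RM"
      "fst s2 RW = H + st" "fst s2 Rnb = H + 2 * st" "fst s2 Rpos = H + 3 * st" "fst s2 Rzb = H + 4 * st"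
      using g2 by (simp_all add: f2)
    have t2: "t2 \<le> t + 60" using g2 t1 by simp
    show ?case
    proof (rule wp_Cond, goal_cases)
      case 1
      then have "\<not> j \<le> i + 1" using q2 lt by (simp split: if_splits)
      then have "pref_suf T i j = {}" using ps by simp
      then show ?case using t2 by (intro wp_AsgV[where v = 0]) (simp_all add: out_set_0)
    next
      case 2
      then have ji: "j \<le> i + 1" using q2 lt by (simp split: if_splits)
      define d where "d = i + 1 - j"
      have d: "j + d = i + 1" "d \<le> n" "j + d \<le> n" using ji j1 by (simp_all add: d_def)
      have pset: "pref_suf T i j = split_set ((!) T) n j d" using ps ji by (simp add: d_def)
      have r0: "0 < r" using r by simp
      let ?s3 = "((fst s2)(74 := d), snd s2)"
      have s3: "wp w (Cond (Op Mod (V 74) (V 73) \<doteq> Cst 0)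
          (Asg 0 (Cst 1) ;; Asg 1 (Cst 0) ;; Asg 2 (V 73) ;; Asg 3 (Op Div (V 74) (V 73) \<oplus> Cst 1)) ?occ2) ?Q ?s3 t3"
        if t3: "t3 \<le> t + 80" for t3
      proof (rule wp_Cond, goal_cases)
        case 1
        then have "r dvd d" using q2 by (simp split: if_splits add: dvd_eq_mod_eq_0)
        then have res: "pref_suf T i j = arith_prog 0 r (d div r + 1)"
          unfolding pset by (intro split_set_dvd[OF d(3) r0 r(3) rm])
        have "d div r \<le> d" by simp
        then have dr: "d div r + 1 < 2 ^ w" using d(2) lt by linarith
        show ?case
          apply (rule wp_Asg_Sq[where v = 1], simp)
          apply (rule wp_Asg_Sq[where v = 0], simp)
          apply (rule wp_Asg_Sq[where v = r], use q2 in simp)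
          apply (rule wp_AsgV[where v = "d div r + 1"], use q2 dr in simp)
          using t3 by (simp add: out_set_1 res)
      next
        case 2
        then have nd: "\<not> r dvd d" using q2 by (simp split: if_splits add: dvd_eq_mod_eq_0)
        then have d1: "1 \<le> d" by (cases d) auto
        have res: "pref_suf T i j = {p. p = 0 \<and> per_on ((!) T) j n d \<or> p = d \<and> per_on ((!) T) 0 (j + d) d}"
          unfolding pset by (intro split_set_not_dvd[OF d(3) r0 r(3) rm nd])
        have ml: "x * sp \<le> N" if "x \<le> n" for x unfolding N using that by (rule mult_le_mono1)
        have dsp: "1 \<le> d * sp" "d * sp + j * sp \<le> N" "d * sp + (n - (j + d)) * sp \<le> N" "d * sp < 2 ^ w" "j * sp < 2 ^ w" "(n - (j + d)) * sp < 2 ^ w"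
        proof -
          show "1 \<le> d * sp" using mult_le_mono[OF d1 sp(1)] by simp
          show a: "d * sp + j * sp \<le> N" using ml[of "d + j"] d by (simp add: add_mult_distrib)
          show b: "d * sp + (n - (j + d)) * sp \<le> N" using ml[of "d + (n - (j + d))", unfolded add_mult_distrib] d(3) by linarith
          show "d * sp < 2 ^ w" "j * sp < 2 ^ w" "(n - (j + d)) * sp < 2 ^ w" using a b sizes by linarith+
        qed
        let ?s5 = "((fst s2)(74 := d, 30 := d * sp, 31 := j * sp), snd s2)"
        have ds5: "ds_ok False (fstr False B k N) ?s5"
        proof (rule ds_ok_cong[OF ds(1)])
          fix x assume "x \<in> {Rk, Rc, RN, RNW, RM, RW, Rnb, Rpos, Rzb}"
          then show "fst ?s5 x = fst sF x" using q2 rF par_D[OF parF] by auto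
        qed (simp_all only: snd_conv m2 rF, (rule mF, use stw in linarith, use stw in linarith)+)
        have wF: "wp w (P_occ False) (\<lambda>s' t'. fst s' 32 = of_bool (per_on ((!) T) 0 (j + d) d) \<and> t' \<le> t5 + 500) ?s5 t5" for t5
          using wp_occ[OF ds5 fstr_less[where B = B, OF B(1)], of "d * sp" "j * sp" t5] dsp pre_match[where B = B, OF B(2) d(3)] by simp
        show ?case
        proof (rule wp_Asg_Sq[where v = "d * sp"], use q2 dsp in simp, rule wp_Asg_Sq[where v = "j * sp"], use q2 dsp in simp,
            simp only: fst_conv snd_conv, rule wp_SqF, rule wF, goal_cases)
          case (1 s6 t6)
          note f6 = frame_reg[OF 1(2), unfolded mods_P_occ] and g6 = 1(1)
          have m6: "snd s6 = \<mu>" using frame_mem[OF 1(2)] m2 by simp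
          let ?s7 = "((fst s6)(75 := of_bool (per_on ((!) T) 0 (j + d) d), RM := fst sR RM), snd s6)"
          have q6: "fst s6 70 = i" "fst s6 Rk = k" "fst s6 Rc = c" "fst s6 Rs = sp" "fst s6 RN = N" "fst s6 RNW = NW"
            "fst s6 72 = n" "fst s6 53 = st" "fst s6 Rzb = H + 4 * st" "fst s6 74 = d" "fst s6 30 = d * sp"
            using q2 by (simp_all add: f6)
          have e7: "ev w (V Rzb \<oplus> V 53) ?s7 = H + 5 * st" using q6 lt by simp
          show ?case
          proof (rule wp_Asg_Sq[where v = "of_bool (per_on ((!) T) 0 (j + d) d)"], use g6 in simp,
              rule wp_Asg_Sq[where v = "fst sR RM"], use m6 \<mu> cm in simp, simp only: fst_conv snd_conv,
              rule wp_SqF, rule wp_bases[OF e7, of st], use q6 in simp, use lt in simp, goal_cases)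
            case (1 s8 t8)
            note f8 = frame_reg[OF 1(2), unfolded mods_P_bases] and g8 = 1(1)
            have m8: "snd s8 = \<mu>" using frame_mem[OF 1(2)] m6 by simp
            have q8: "fst s8 70 = i" "fst s8 Rk = k" "fst s8 Rc = c" "fst s8 Rs = sp" "fst s8 RN = N" "fst s8 RNW = NW"
              "fst s8 72 = n" "fst s8 RM = fst sR RM" "fst s8 74 = d" "fst s8 30 = d * sp" "fst s8 75 = of_bool (per_on ((!) T) 0 (j + d) d)"
              "fst s8 RW = H + 5 * st" "fst s8 Rnb = H + 6 * st" "fst s8 Rpos = H + 7 * st" "fst s8 Rzb = H + 8 * st"
              using g8 q6 by (simp_all add: f8)
            let ?l = "(n - (j + d)) * sp"
            let ?s9 = "((fst s8)(31 := ?l), snd s8)"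
            have ds9: "ds_ok True (fstr True B k N) ?s9"
            proof (rule ds_ok_cong[OF ds(2)])
              fix x assume "x \<in> {Rk, Rc, RN, RNW, RM, RW, Rnb, Rpos, Rzb}"
              then show "fst ?s9 x = fst sR x" using q8 rR par_D[OF parR] by auto
            qed (simp_all only: snd_conv m8 rR, (rule mR, use stw in linarith, use stw in linarith)+)
            have wR: "wp w (P_occ True) (\<lambda>s' t'. fst s' 32 = of_bool (per_on ((!) T) j n d) \<and> t' \<le> t9 + 500) ?s9 t9" for t9
              using wp_occ[OF ds9 fstr_less[where B = B, OF B(1)], of "d * sp" ?l t9] dsp q8 suf_match[where B = B, OF B(2) d(3)] by simp
            have nl: "n - 1 - i = n - (j + d)" "1 \<le> n" "i \<le> n - 1" using d ij by linarith+
            have u1: "ev w (V 72 \<ominus> Cst 1) s8 = n - 1" using q8(7) lt(5,7) nl(2) by simp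
            have u2: "binop_val w Sub (n - 1) i = n - 1 - i" using lt(5) nl(3) by (intro bv_Sub) linarith+
            have u3: "ev w ((V 72 \<ominus> Cst 1 \<ominus> V 70) \<otimes> V Rs) s8 = ?l"
              using u1 u2 q8(1,4) dsp(6) unfolding nl(1)[symmetric] by (simp del: diff_diff_left)
            show ?case
            proof (rule wp_Asg_Sq[OF u3], rule wp_SqF, rule wR, goal_cases)
              case (1 s10 t10)
              note f10 = frame_reg[OF 1(2), unfolded mods_P_occ] and g10 = 1(1)
              define a e where "a = per_on ((!) T) 0 (j + d) d" and "e = per_on ((!) T) j n d"
              have q10: "fst s10 75 = of_bool a" "fst s10 32 = of_bool e" "fst s10 74 = d"
                using q8 g10 by (simp_all add: f10 a_def e_def)
              have T10: "t10 + 60 \<le> t + 3000" using g10 g8 g6 t3 by simp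
              have l1: "of_bool a + of_bool e < (2::nat) ^ w" "d * of_bool a < 2 ^ w"
                using lt d by (cases a; cases e; simp)+
              have res': "pref_suf T i j = (if e then {0} else {}) \<union> (if a then {d} else {})"
                unfolding res a_def e_def by auto
              show ?case
                apply (rule wp_Asg_Sq[where v = "of_bool a + of_bool e"], use q10 l1 in simp)
                apply (rule wp_Asg_Sq[where v = "d * of_bool a"], use q10 l1 in simp)
                apply (rule wp_Asg_Sq[where v = 0], simp)
                apply (rule wp_Asg_Sq[where v = 1], simp)
                apply (rule wp_Asg_Sq[where v = 0], simp)
                apply (rule wp_Asg_Sq[where v = 0], simp)
                apply (rule wp_AsgV[where v = 1], simp)
                using T10 unfolding res'
                by (cases a; cases e) (simp_all add: out_set_0 out_set_1 out_set_2 arith_prog_1[unfolded One_nat_def] insert_commute)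
            qed
          qed
        qed
      qed
      show ?case
        by (rule wp_Asg_Sq[where v = d], use q2 lt ji in \<open>simp add: d_def\<close>, rule s3, use t2 in simp)
    qed
  qed
  show ?thesis
    unfolding P_query_def
    apply (rule wp_Asg_Sq[where v = i], use ij in simp)
    apply (rule wp_Asg_Sq[where v = j], use ij in simp)
    apply (rule wp_Asg_Sq[where v = k], use \<mu> in \<open>simp add: \<mu>_def\<close>)
    apply (rule wp_Asg_Sq[where v = c], use \<mu> cm in \<open>simp add: \<mu>_def\<close>)
    apply (rule wp_Asg_Sq[where v = sp], use \<mu> cm in \<open>simp add: \<mu>_def\<close>)
    apply (rule wp_Asg_Sq[where v = N], use \<mu> cm in \<open>simp add: \<mu>_def\<close>)
    apply (rule wp_Asg_Sq[where v = NW], use \<mu> cm in \<open>simp add: \<mu>_def\<close>)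
    apply (rule wp_Asg_Sq[where v = n], use \<mu> cm in \<open>simp add: \<mu>_def\<close>)
    apply (rule wp_Asg_Sq[where v = r], use \<mu> cm in \<open>simp add: \<mu>_def\<close>)
    apply (rule wp_Asg_Sq[where v = st], use \<mu> cm in \<open>simp add: \<mu>_def\<close>)
    apply (rule wp_Asg_Sq[where v = "fst sF RM"], use \<mu> cm in \<open>simp add: \<mu>_def\<close>)
    apply (simp only: fst_conv snd_conv \<mu>_def[symmetric])
    apply (rule main)
    apply simp
    done
qed

end

lemma vars_ok_programs [simp]: "vars_ok (P_win rv)" "vars_ok (P_rho rv)" "vars_ok (P_nb rv)" "vars_ok (P_M rv)"
    "vars_ok (P_tab rv)"
  by (simp_all add: P_win_def P_rho_def P_nb_def P_M_def P_tab_def)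

lemma vars_ok_programs2 [simp]: "vars_ok P_box" "vars_ok (P_cand rv)" "vars_ok (P_ins rv)" "vars_ok (P_z rv)"
  by (simp_all add: P_box_def P_cand_def P_ins_def P_z_def)

lemma vars_ok_programs3 [simp]: "vars_ok (P_build rv)" "vars_ok (P_occ rv)" "vars_ok P_pack" "vars_ok P_par"
  by (simp_all add: P_build_def P_occ_def P_pack_def P_par_def)

lemma vars_ok_programs4 [simp]: "vars_ok P_try" "vars_ok P_per"
  by (simp_all add: P_try_def P_per_def)

lemma vars_ok_P_prep: "vars_ok P_prep"
  by (simp add: P_prep_def P_main_def P_bases_def)

lemma vars_ok_P_query: "vars_ok P_query"
  by (simp add: P_query_def P_bases_def)

lemma no_store_P_query: "no_store P_query"
  by (simp add: P_query_def)

section \<open>Final assembly and asymptotic bounds\<close>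

lemma lt_parts:
  fixes h m p q :: nat
  assumes "h + 9 * (m + 8) + p < q"
  shows "h + m + 7 < q" "h + 9 * (m + 8) < q"
proof -
  show "h + m + 7 < q" using assms by presburger
  show "h + 9 * (m + 8) < q" using assms by presburger
qed

lemma time_sum:
  fixes t1 t2 t3 L m p :: nat
  assumes "t1 \<le> 0 + 30 * L + 200" "t2 \<le> t1 + 200 * (m + 6)" "t3 \<le> t2 + 10000 * (m + 2) + 4000 * p"
  shows "t3 \<le> 30 * L + 200 + 200 * (m + 6) + 10000 * (m + 2) + 4000 * p"
  using assms by linarith

context sizes_ok
begin

lemma packed: "length T = n \<Longrightarrow> (\<And>x. x < n \<Longrightarrow> T ! x < 2 ^ b) \<Longrightarrow> packed w k c N NW n b sp T"
  apply (rule packed.intro)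
   apply (rule params.intro)
        apply (rule kc(2))
       apply (rule N_le(4))
      apply (rule kc(3))
     apply (rule kc(4))
    apply (rule refl)
   apply (rule total(2))
  apply (rule packed_axioms.intro)
        apply assumption
       apply assumption
      apply (rule sp(1))
     apply (rule sp(2))
    apply (rule sp(3))
   apply (rule sp(4))
  apply (rule refl)
  done

lemma solves:
  assumes len: "length T = n" and letters: "\<And>x. x < n \<Longrightarrow> T ! x < 2 ^ b"
    and tb: "real (30 * L + 200 + 200 * (NW + 6) + 10000 * (NW + 2) + 4000 * ((k + 2) * (2 ^ (3 * (k * c)) + 1))) \<le> tb"
      "real (H + 9 * (NW + 8)) \<le> tb" and C: "3000 \<le> C"
  shows "solves_pref_suf w (ccom 0 P_prep) (ccom 0 P_query) b T tb tb C C"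
  unfolding solves_pref_suf_def
proof (intro allI impI)
  fix M assume M: "holds_packed w b T M"
  interpret P: packed w k c N NW n b sp T by (rule packed[OF len letters])
  define s0 where "s0 = (reg (start [length T, b, w] M), M)"
  have ag0: "agrees (start [length T, b, w] M) s0" "pc (start [length T, b, w] M) = 0"
    by (simp_all add: s0_def agrees_def start_def)
  have r0: "fst s0 Rn = n" "fst s0 Rb = b" "fst s0 Rw = w" "snd s0 = M"
    by (simp_all add: s0_def start_def len)
  let ?tt = "30 * L + 200 + 200 * (NW + 6) + 10000 * (NW + 2) + 4000 * ((k + 2) * (2 ^ (3 * (k * c)) + 1))"
  have H2: "H + 9 * P.st + 2 ^ (3 * (k * c)) < 2 ^ w" unfolding P.st_def by (rule total(1))
  have H1: "H + NW + 7 < 2 ^ w" "H + 9 * P.st < 2 ^ w" using H2 unfolding P.st_def by (rule lt_parts)+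
  have prep: "wp w P_prep (\<lambda>s' t'. P.prepared H (snd s') \<and> t' \<le> ?tt) s0 0"
    unfolding P_prep_def
  proof (rule wp_SqF, rule wp_par[OF r0(1-3)], goal_cases)
    case (1 s1 t1)
    note f1 = frame_reg[OF 1(2)]
    have g1: "fst s1 Rn = n" "fst s1 Rw = w" using r0 by (simp_all add: f1 P_par_def)
    have m1: "snd s1 = M" using frame_mem[OF 1(2)] r0 by (simp add: P_par_def)
    have h1: "fst s1 Rs = sp" "fst s1 44 = (b - c * (sp - 1)) * k" "fst s1 RA = H" "fst s1 53 = NW + 8"
      and t1: "t1 \<le> 0 + 30 * L + 200"
      using 1(1) by blast+
    have par1: "P.par s1" unfolding P.par_def using 1(1) by blast
    have w1: "\<And>a. snd s1 a < 2 ^ w" using M unfolding m1 holds_packed_def word_mem_def by blast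
    have w2: "snd s1 q = packed_word w b T q" if "q * w < n * b" for q
      using M that len unfolding m1 holds_packed_def by blast
    show ?case
    proof (rule wp_SqF, rule P.wp_pack[OF par1 h1(1) g1(2) h1(2,3) H1(1) H_le(2) w1], goal_cases)
      case (1 q)
      then show ?case by (rule w2)
    next
      case 2
      show ?case by (rule total(6))
    next
      case (3 s2 t2)
      have m2: "mods P_pack \<subseteq> {20, 40, 41, 42, 43}" by (simp add: P_pack_def)
      have f2: "fst s2 x = fst s1 x" if "x \<notin> {20, 40, 41, 42, 43}" for x
        by (rule frame_reg[OF 3(2)]) (use m2 that in blast)
      obtain B where B: "P.blocks B s2" "\<And>x. B x < 2 ^ c" "\<forall>x<N. B (3 * k + x) = piece sp c T x" using 3(1) by blast
      have t2: "t2 \<le> t1 + 200 * (NW + 6)" using 3(1) by blast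
      have par2: "P.par s2" using par1 unfolding P.par_def by (simp add: f2)
      have h2: "fst s2 Rs = sp" "fst s2 RA = H" "fst s2 53 = P.st" "fst s2 Rn = n"
        using h1 g1 by (simp_all add: f2 P.st_def)
      show ?case
      proof (rule wp_monoF, rule P.wp_main[where B = B and H = H, OF par2 h2 B(1,2)], goal_cases)
        case (1 x)
        then show ?case using B(3) by blast
      next
        case 2 show ?case by (rule H_le(3))
      next
        case 3 show ?case by (rule H2)
      next
        case 4 show ?case by (rule total(3))
      next
        case 5 show ?case by (rule n)
      next
        case (6 s3 t3)
        then have "t3 \<le> t2 + 10000 * (NW + 2) + 4000 * ((k + 2) * (2 ^ (3 * (k * c)) + 1))" "P.prepared H (snd s3)" by blast+
        then show ?case using time_sum[OF t1 t2] by blast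
      qed
    qed
  qed
  then obtain t s' where t: "big w P_prep s0 t s'" and s': "P.prepared H (snd s')" and tt: "0 + t \<le> ?tt"
    unfolding wp_def by blast
  have "t \<le> ?tt" using tt by (simp only: add_0_left)
  from order_trans[OF of_nat_mono[OF this] tb(1)] have "real t \<le> tb" .
  from compile_halts[OF t vars_ok_P_prep ag0 this]
  obtain c' where c': "halts_within w (ccom 0 P_prep) (start [length T, b, w] M) tb c'" "agrees c' s'" by blast
  have mc: "mem c' = snd s'" using c'(2) by (simp add: agrees_def)
  \<comment> \<open>The lookup table begins exactly at \<open>H + 9 * (NW + 8)\<close>, so the data
    structure ends just before it.\<close>
  have "answers_queries w (ccom 0 P_query) T C C (H + 9 * (NW + 8)) (mem c')"
    unfolding answers_queries_def
  proof (intro allI impI, goal_cases)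
    case (1 i j M')
    then have ij: "i < n" "j < n" and M': "agree_below (H + 9 * (NW + 8)) M' (mem c')" using len by simp_all
    define q0 where "q0 = (reg (start [i, j] M'), M')"
    have ag: "agrees (start [i, j] M') q0" "pc (start [i, j] M') = 0"
      by (simp_all add: q0_def agrees_def start_def)
    have q: "fst q0 0 = i" "fst q0 1 = j" "snd q0 = M'" by (simp_all add: q0_def start_def)
    have "P.prepared H (snd q0)"
      using P.prepared_agree[OF s' _ H_le(3)] M' unfolding q mc P.st_def by blast
    note wq = P.wp_query[OF this q(1,2) ij H_le(3) H1(2) total(3), of 0]
    obtain t2 s2 where t2: "big w P_query q0 t2 s2" and s2: "fst s2 0 \<le> 2" "P.out_set (fst s2) = pref_suf T i j" "0 + t2 \<le> 0 + 3000"
      using wq unfolding wp_def by blast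
    have "real t2 \<le> C" using s2(3) C by linarith
    from compile_halts[OF t2 vars_ok_P_query ag this]
    obtain c2 where c2: "halts_within w (ccom 0 P_query) (start [i, j] M') C c2" "agrees c2 s2" by blast
    have "snd s2 = M'" using big_no_store[OF t2 no_store_P_query] q by simp
    then have m: "mem c2 = M'" using c2(2) by (simp add: agrees_def)
    have rg: "reg c2 x = fst s2 x" if "x < 7" for x using c2(2) that by (simp add: agrees_def)
    have "output_set c2 = P.out_set (fst s2)"
      unfolding output_set_def P.out_set_def by (rule SUP_cong) (use rg s2(1) in auto)
    moreover have "real (output_size c2) \<le> C" using rg[of 0] s2(1) C by (simp add: output_size_def)
    ultimately show ?case using c2(1) m M' s2(2) by (intro exI[of _ c2] conjI) simp_all
  qed
  then show "\<exists>c s. halts_within w (ccom 0 P_prep) (start [length T, b, w] M) tb c \<and> real s \<le> tb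
      \<and> answers_queries w (ccom 0 P_query) T C C s (mem c)"
    using c'(1) tb(2) by blast
qed

end

text \<open>The coefficients add up to 2083480, rounded up to 2500000.\<close>

lemma time_total:
  fixes L W m t :: nat
  assumes "W * (L + 1) \<le> 32 * m" "t * (L + 1) \<le> 432 * m" "L * (L + 1) \<le> 256 * m" "L + 1 \<le> m"
  shows "(30 * L + 200 + 200 * (W + 6) + 10000 * (W + 2) + 4000 * t) * (L + 1) \<le> 2500000 * m"
proof -
  have "(30 * L + 200 + 200 * (W + 6) + 10000 * (W + 2) + 4000 * t) * (L + 1)
      = 30 * (L * (L + 1)) + 21400 * (L + 1) + 10200 * (W * (L + 1)) + 4000 * (t * (L + 1))"
    by (simp add: algebra_simps)
  also have "\<dots> \<le> 30 * (256 * m) + 21400 * m + 10200 * (32 * m) + 4000 * (432 * m)"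
    using assms by (intro add_le_mono mult_le_mono2)
  finally show ?thesis by simp
qed

lemma size_total:
  fixes L W m H :: nat
  assumes "W * (L + 1) \<le> 32 * m" "H * (L + 1) \<le> 20 * m" "L + 1 \<le> m"
  shows "(H + 9 * (W + 8)) * (L + 1) \<le> 2500000 * m"
proof -
  have "(H + 9 * (W + 8)) * (L + 1) = H * (L + 1) + 9 * (W * (L + 1)) + 72 * (L + 1)"
    by (simp add: algebra_simps)
  also have "\<dots> \<le> 20 * m + 9 * (32 * m) + 72 * m"
    using assms by (intro add_le_mono mult_le_mono2)
  finally show ?thesis by simp
qed

lemma letter_bits_bounds:
  assumes "2 \<le> \<sigma>"
  shows "1 \<le> letter_bits \<sigma>" "\<sigma> \<le> 2 ^ letter_bits \<sigma>" "real (letter_bits \<sigma>) < log 2 \<sigma> + 1" "real (letter_bits \<sigma>) \<le> 2 * log 2 \<sigma>"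
proof -
  have 1: "1 \<le> log 2 (real \<sigma>)" using assms by simp
  then have "0 \<le> \<lceil>log 2 (real \<sigma>)\<rceil>" by linarith
  then have b: "real (letter_bits \<sigma>) = of_int \<lceil>log 2 (real \<sigma>)\<rceil>" by (simp add: letter_bits_def)
  have lb: "log 2 (real \<sigma>) \<le> real (letter_bits \<sigma>)" unfolding b by linarith
  show "1 \<le> letter_bits \<sigma>" using 1 lb by linarith
  show 3: "real (letter_bits \<sigma>) < log 2 \<sigma> + 1" unfolding b by linarith
  then show "real (letter_bits \<sigma>) \<le> 2 * log 2 \<sigma>" using 1 by linarith
  have "real \<sigma> = 2 powr log 2 (real \<sigma>)" using assms by simp
  also have "\<dots> \<le> 2 powr real (letter_bits \<sigma>)" using lb by simp
  also have "\<dots> = real (2 ^ letter_bits \<sigma>)" by (simp add: powr_realpow)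
  finally show "\<sigma> \<le> 2 ^ letter_bits \<sigma>" by (simp only: of_nat_le_iff)
qed

lemma log_less_Suc:
  assumes "1 \<le> n" "n < 2 * 2 ^ L"
  shows "log 2 (real n) < real (L + 1)"
proof -
  have "real n < real (2 * 2 ^ L)" using assms(2) by (simp only: of_nat_less_iff)
  also have "\<dots> = 2 powr real (L + 1)" by (simp add: powr_add powr_realpow)
  finally show ?thesis using assms(1) by (subst log_less_iff) simp_all
qed

text \<open>The rounded-up letter length is at most twice the logarithm of \<sigma>, and this 2
  doubles the constant. The logarithm of n is below \<open>L + 1\<close>, and the quotient of the
  two logarithms is the logarithm of n to base \<sigma>.\<close>

lemma linear_over_log:
  assumes n: "2 \<le> n" "n < 2 * 2 ^ L" and \<sigma>: "2 \<le> \<sigma>" and b: "real b \<le> 2 * log 2 \<sigma>" and Y: "Y * (L + 1) \<le> Z * (n * b)"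
  shows "real Y \<le> 2 * real Z * (real n / log (real \<sigma>) (real n))"
proof -
  have ls: "0 < log 2 (real \<sigma>)" and ln: "0 < log 2 (real n)" using \<sigma> n by simp_all
  have "real Y * log 2 n \<le> real Y * real (L + 1)"
    using log_less_Suc[of n L] n by (intro mult_left_mono) simp_all
  also have "\<dots> = real (Y * (L + 1))" by (simp only: of_nat_mult)
  also have "\<dots> \<le> real (Z * (n * b))" using Y by (simp only: of_nat_le_iff)
  also have "\<dots> = (real Z * real n) * real b" by simp
  also have "\<dots> \<le> (real Z * real n) * (2 * log 2 \<sigma>)" using b by (rule mult_left_mono) simp
  finally have "real Y \<le> (real Z * real n) * (2 * log 2 \<sigma>) / log 2 n" using ln by (simp only: pos_le_divide_eq)
  also have "\<dots> = 2 * real Z * (real n / (log 2 n / log 2 \<sigma>))" by simp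
  also have "log 2 n / log 2 \<sigma> = log (real \<sigma>) (real n)" using \<sigma> by (intro log_base_change[symmetric]) simp_all
  finally show ?thesis .
qed

theorem theorem1:
  fixes e :: nat
  shows "\<exists>(P :: instr list) (Q :: instr list) (K :: nat) (C :: real).
    \<forall>(n :: nat) (\<sigma> :: nat) (T :: nat list) (w :: nat).
      length T = n \<and> 2 \<le> \<sigma> \<and> set T \<subseteq> {0..<\<sigma>} \<and> \<sigma> \<le> n ^ e \<and> K * n \<le> 2 ^ w \<longrightarrow>
      solves_pref_suf w P Q (letter_bits \<sigma>) T
        (C * (real n / log (real \<sigma>) (real n)))
        (C * (real n / log (real \<sigma>) (real n)))
        C
        C"
proof (rule exI[of _ "ccom 0 P_prep"], rule exI[of _ "ccom 0 P_query"], rule exI[of _ "2000 * (e + 1)"],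
    rule exI[of _ 5000000], intro allI impI, goal_cases)
  case (1 n \<sigma> T w)
  then have len: "length T = n" and \<sigma>: "2 \<le> \<sigma>" "\<sigma> \<le> n ^ e" and T: "set T \<subseteq> {0..<\<sigma>}" and w: "2000 * (e + 1) * n \<le> 2 ^ w"
    by blast+
  \<comment> \<open>An alphabet of at least two letters rules out n below 2, where
    \<open>n ^ e\<close> would be at most 1.\<close>
  have n: "2 \<le> n"
  proof (rule ccontr)
    assume "\<not> 2 \<le> n"
    then have "n ^ e \<le> 1 ^ e" by (intro power_mono) simp_all
    then show False using \<sigma> by simp
  qed
  obtain L where L: "2 ^ L \<le> n" "n < 2 * 2 ^ L" using ex_power_ivl1[of 2 n] n by auto
  let ?b = "letter_bits \<sigma>"
  note lb = letter_bits_bounds[OF \<sigma>(1)]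
  have "log 2 (real \<sigma>) \<le> log 2 (real (n ^ e))"
  proof (rule log_mono)
    show "0 < real \<sigma>" using \<sigma>(1) by simp
    show "real \<sigma> \<le> real (n ^ e)" using \<sigma>(2) by (simp only: of_nat_le_iff)
  qed simp
  also have "\<dots> = real e * log 2 (real n)" using n by (simp add: log_nat_power)
  also have "\<dots> \<le> real e * real (L + 1)" using log_less_Suc[of n L] n L by (intro mult_left_mono) simp_all
  finally have "real ?b < real (e * (L + 1) + 1)" using lb(3) by (simp add: distrib_left)
  then have be: "?b \<le> e * (L + 1) + 1" by (simp only: of_nat_less_iff)
  interpret sizes_ok e n ?b L w by (rule sizes_ok.intro[OF n L lb(1) be w])
  have letters: "T ! x < 2 ^ ?b" if "x < n" for x
    using nth_mem[of x T] that len T lb(2) by fastforce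
  have lin: "real Y \<le> 5000000 * (real n / log (real \<sigma>) (real n))" if "Y * (L + 1) \<le> 2500000 * (n * ?b)" for Y
    using linear_over_log[OF n L(2) \<sigma>(1) lb(4) that] by simp
  show ?case
    by (rule solves[OF len letters lin[OF time_total[OF cost_NW cost_tab cost_L]] lin[OF size_total[OF cost_NW cost_H cost_L(2)]]]) simp_all
qed

end
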